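(* Let $\mathfrak{D}$ be one of the Dynkin types $A_n$, $B_n$, $D_3$, or $G_2$. Then the simplicial complex $\Delta_{\mathfrak{D}}$ of antichains in the root poset of type $\mathfrak{D}$ is shellable. For the Dynkin types $D_n$ with $n\geq 4$, $F_4$, $E_6$, $E_7$, and $E_8$, the simplicial complex $\Delta_{\mathfrak{D}}$ is not shellable.
   Context: Let $\mathfrak{D}$ be a crystallographic Dynkin type and $\Phi(\mathfrak{D})$ the crystallographic root system of type $\mathfrak{D}$. Identify $\mathfrak{D}$ with a set of simple roots of $\Phi(\mathfrak{D})$, let $\mathbb{N}=\{0,1,2,\ldots\}$, let $\mathbb{N}\mathfrak{D}$ denote the set of non-negative integer combinations of simple roots, and let $\Phi_+(\mathfrak{D})=\Phi(\mathfrak{D})\cap\mathbb{N}\mathfrak{D}$ be the set of positive roots. The root poset of type $\mathfrak{D}$ is $\Phi_+(\mathfrak{D})$ ordered by $\alpha\le\beta$ if and only if $\beta-\alpha\in\mathbb{N}\mathfrak{D}$. Set $\Delta_{\mathfrak{D}}=\{A\subseteq\Phi_+(\mathfrak{D}) : A\text{ is an antichain}\}$ (the empty set counts as an antichain); this is a simplicial complex on the ground set $\Phi_+(\mathfrak{D})$. Type $D_n$ (including $D_3$) refers to the root system $\{\pm e_i\pm e_j : 1\le i<j\le n\}$ in $\mathbb{R}^n$. A finite simplicial complex $\Delta$ (not necessarily pure) is shellable if there is a linear order $\prec$ on the set of its maximal (by inclusion) faces such that whenever $\sigma\prec\tau$ are maximal faces there is a maximal face $\gamma\prec\tau$ with $\sigma\cap\tau\subseteq\gamma\cap\tau=\tau\setminus\{x\}$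 for some $x\in\tau$. *)

theory Defs
  imports "HOL-Analysis.Analysis" "HOL-Analysis.Finite_Function_Topology"
begin

text \<open>
  All root systems live in the space of finitely supported real vectors indexed by the natural
  numbers; the Euclidean space of dimension n is the subspace of vectors supported on 1, ..., n.
\<close>

type_synonym vec = "nat \<Rightarrow>\<^sub>0 real"

abbreviation e :: "nat \<Rightarrow> vec" where
  "e i \<equiv> Poly_Mapping.single i 1"

datatype dynkin_type =
  Type_A nat | Type_B nat | Type_C nat | Type_D nat
| Type_E6 | Type_E7 | Type_E8 | Type_F4 | Type_G2

definition signs :: "real set" where
  "signs = {-1, 1}"

definition roots_D :: "nat \<Rightarrow> vec set" where
  "roots_D n = {s *\<^sub>R e i + t *\<^sub>R e j | s t i j.
                 s \<in> signs \<and> t \<in> signs \<and> 1 \<le> i \<and> i < j \<and> j \<le> n}"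

definition roots_E8 :: "vec set" where
  "roots_E8 = roots_D 8 \<union>
     {(1/2) *\<^sub>R (\<Sum>i=1..8. s i *\<^sub>R e i) | s. (\<forall>i\<in>{1..8}. s i \<in> signs) \<and> (\<Prod>i=1..8. s i) = 1}"

text \<open>
  The standard models of Bourbaki. The systems \<open>E\<^sub>7\<close> and \<open>E\<^sub>6\<close> are cut out of \<open>E\<^sub>8\<close> by the
  orthogonal complements of \<open>e\<^sub>7 + e\<^sub>8\<close> and of \<open>{e\<^sub>6 - e\<^sub>7, e\<^sub>7 + e\<^sub>8}\<close>, respectively.
\<close>

fun root_system :: "dynkin_type \<Rightarrow> vec set" where
  "root_system (Type_A n) = {e i - e j | i j. i \<in> {1..n+1} \<and> j \<in> {1..n+1} \<and> i \<noteq> j}"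
| "root_system (Type_B n) = roots_D n \<union> {s *\<^sub>R e i | s i. s \<in> signs \<and> i \<in> {1..n}}"
| "root_system (Type_C n) = roots_D n \<union> {(2 * s) *\<^sub>R e i | s i. s \<in> signs \<and> i \<in> {1..n}}"
| "root_system (Type_D n) = roots_D n"
| "root_system Type_E8 = roots_E8"
| "root_system Type_E7 =
     {\<alpha> \<in> roots_E8. Poly_Mapping.lookup \<alpha> 7 = - Poly_Mapping.lookup \<alpha> 8}"
| "root_system Type_E6 =
     {\<alpha> \<in> roots_E8. Poly_Mapping.lookup \<alpha> 6 = Poly_Mapping.lookup \<alpha> 7 \<and>
                   Poly_Mapping.lookup \<alpha> 7 = - Poly_Mapping.lookup \<alpha> 8}"
| "root_system Type_F4 = roots_D 4 \<union> {s *\<^sub>R e i | s i. s \<in> signs \<and> i \<in> {1..4}} \<union>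
     {(1/2) *\<^sub>R (\<Sum>i=1..4. s i *\<^sub>R e i) | s. \<forall>i\<in>{1..4}. s i \<in> signs}"
| "root_system Type_G2 = {e i - e j | i j. i \<in> {1..3} \<and> j \<in> {1..3} \<and> i \<noteq> j} \<union>
     {s *\<^sub>R (2 *\<^sub>R e i - e j - e k) | s i j k. s \<in> signs \<and> {i, j, k} = {1..3}}"

text \<open>Non-negative integer combinations; only used for finite \<open>S\<close>.\<close>

definition nat_combinations :: "vec set \<Rightarrow> vec set" where
  "nat_combinations S = {\<Sum>\<alpha>\<in>S. real (c \<alpha>) *\<^sub>R \<alpha> | c. True}"

definition simple_roots :: "vec set \<Rightarrow> vec set \<Rightarrow> bool" where
  "simple_roots \<Phi> S \<longleftrightarrow> S \<subseteq> \<Phi> \<and> independent S \<and>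
     (\<forall>\<beta>\<in>\<Phi>. \<beta> \<in> nat_combinations S \<or> - \<beta> \<in> nat_combinations S)"

definition positive_roots :: "vec set \<Rightarrow> vec set \<Rightarrow> vec set" where
  "positive_roots \<Phi> S = \<Phi> \<inter> nat_combinations S"

definition root_le :: "vec set \<Rightarrow> vec \<Rightarrow> vec \<Rightarrow> bool" where
  "root_le S \<alpha> \<beta> \<longleftrightarrow> \<beta> - \<alpha> \<in> nat_combinations S"

definition antichain_complex :: "vec set \<Rightarrow> vec set \<Rightarrow> vec set set" where
  "antichain_complex \<Phi> S =
     {A. A \<subseteq> positive_roots \<Phi> S \<and> (\<forall>\<alpha>\<in>A. \<forall>\<beta>\<in>A. root_le S \<alpha> \<beta> \<longrightarrow> \<alpha> = \<beta>)}"

definition facets :: "'a set set \<Rightarrow> 'a set set" where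
  "facets \<Delta> = {\<sigma> \<in> \<Delta>. \<forall>\<tau>\<in>\<Delta>. \<sigma> \<subseteq> \<tau> \<longrightarrow> \<sigma> = \<tau>}"

text \<open>
  Shellability in the not necessarily pure sense; \<open>\<Delta>\<close> is understood to be a finite simplicial
  complex. The pair \<open>(\<sigma>, \<tau>) \<in> r\<close> means that \<open>\<sigma>\<close> strictly precedes \<open>\<tau>\<close>.
\<close>

definition shellable :: "'a set set \<Rightarrow> bool" where
  "shellable \<Delta> \<longleftrightarrow> (\<exists>r. strict_linear_order_on (facets \<Delta>) r \<and>
     (\<forall>\<sigma>\<in>facets \<Delta>. \<forall>\<tau>\<in>facets \<Delta>. (\<sigma>, \<tau>) \<in> r \<longrightarrow>
        (\<exists>\<gamma>\<in>facets \<Delta>. (\<gamma>, \<tau>) \<in> r \<and>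
           (\<exists>x\<in>\<tau>. \<sigma> \<inter> \<tau> \<subseteq> \<gamma> \<inter> \<tau> \<and> \<gamma> \<inter> \<tau> = \<tau> - {x}))))"

end

(*
  Weyl group elements act by isomorphisms of root posets, so one simple system per type suffices.

  For A_n, B_n, D_3 = A_3 and G_2 the root poset embeds into the plane in such a way that antichains
  become chains of the order that is strict in both coordinates. If a chain continues beyond a point
  (i, j), it could also continue with (i + 1, j + 1), which leaves the most room for later points. The
  lexicographic order of the facets is therefore a shelling.

  For the remaining types some link is shown to have a part that cannot be connected: in D_4 the roots
  of height three form a triangle none of whose edges lies in another triangle, and in F_4 the same
  happens for the set of triangles spanned by the roots of heights four and five. Types D_n and E_n
  contain D_4 as the link of the simple roots outside a D_4 subdiagram.
*)
theory Submission
  imports Defs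
begin

section \<open>Shellability\<close>

text \<open>The simple system is arbitrary, so conjugacy of simple systems has to be proved, and for
  this each root system must be closed under its own reflections. Instead of checking pairs of
  roots, types A, B, D, E8, F4 and G2 are characterised as the vectors of prescribed norms in a
  lattice, with E7 and E6 as sections of E8: reflections are isometries, and integral Cartan numbers
  keep them inside the lattice. Independence of the chosen simple systems, and explicit root orders,
  come from linear functionals dual to the simple roots.

  The complexes need not be pure. For a shelling it is enough to control one exchanged vertex,
  whatever else the new facet contains. Against a shelling, only facets containing
  \<open>\<rho>\<close> and at least three further vertices are considered: for two of these the
  shelling condition supplies a third of the same kind, and the shared face keeps an edge outside
  \<open>\<rho>\<close>. If two classes of such facets share no such edge, the later of their two
  first members has no admissible predecessor.

  The diagram of F4 is a path and contains no D4, so its obstruction is read off from the list of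
  its 24 positive roots.\<close>

lemma facets_mem: "\<sigma> \<in> facets \<Delta> \<Longrightarrow> \<sigma> \<in> \<Delta>"
  by (simp add: facets_def)

lemma facets_maximal: "\<sigma> \<in> facets \<Delta> \<Longrightarrow> \<tau> \<in> \<Delta> \<Longrightarrow> \<sigma> \<subseteq> \<tau> \<Longrightarrow> \<sigma> = \<tau>"
  by (simp add: facets_def)

lemma face_in_facet:
  assumes "finite \<Delta>" "A \<in> \<Delta>"
  obtains \<gamma> where "\<gamma> \<in> facets \<Delta>" "A \<subseteq> \<gamma>"
proof -
  from finite_has_maximal2[OF assms] obtain m where "m \<in> \<Delta>" "A \<subseteq> m" "\<forall>b\<in>\<Delta>. m \<subseteq> b \<longrightarrow> m = b"
    by auto
  then show ?thesis
    using that by (auto simp: facets_def)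
qed

lemma facets_image:
  assumes "inj_on f (\<Union>\<Delta>)"
  shows "facets ((`) f ` \<Delta>) = (`) f ` facets \<Delta>"
proof -
  have iff: "f ` \<sigma> \<subseteq> f ` \<tau> \<longleftrightarrow> \<sigma> \<subseteq> \<tau>" if "\<sigma> \<in> \<Delta>" "\<tau> \<in> \<Delta>" for \<sigma> \<tau>
    using assms that by (intro inj_on_image_subset_iff[of f "\<Union>\<Delta>"] Union_upper)
  have eq: "f ` \<sigma> = f ` \<tau> \<longleftrightarrow> \<sigma> = \<tau>" if "\<sigma> \<in> \<Delta>" "\<tau> \<in> \<Delta>" for \<sigma> \<tau>
    using assms that by (intro inj_on_image_eq_iff[of f "\<Union>\<Delta>"] Union_upper)
  have "f ` \<sigma> \<in> facets ((`) f ` \<Delta>) \<longleftrightarrow> \<sigma> \<in> facets \<Delta>" if "\<sigma> \<in> \<Delta>" for \<sigma>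
    using that by (simp add: facets_def iff eq)
  moreover have "facets ((`) f ` \<Delta>) \<subseteq> (`) f ` \<Delta>" "facets \<Delta> \<subseteq> \<Delta>"
    by (simp_all add: facets_def)
  ultimately show ?thesis
    by blast
qed

text \<open>An injective relabelling of vertices commutes with intersections and differences of
  facets, so the order can be carried over. It serves both to move between simple systems and to
  pass from points in the plane to roots.\<close>

lemma shellable_image:
  assumes inj: "inj_on f (\<Union>\<Delta>)" and "shellable \<Delta>"
  shows "shellable ((`) f ` \<Delta>)"
proof -
  let ?F = "facets \<Delta>"
  obtain r where lin: "strict_linear_order_on ?F r"
    and shell: "\<And>\<sigma> \<tau>. \<sigma> \<in> ?F \<Longrightarrow> \<tau> \<in> ?F \<Longrightarrow> (\<sigma>, \<tau>) \<in> r \<Longrightarrow>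
      \<exists>\<gamma>\<in>?F. (\<gamma>, \<tau>) \<in> r \<and> (\<exists>x\<in>\<tau>. \<sigma> \<inter> \<tau> \<subseteq> \<gamma> \<inter> \<tau> \<and> \<gamma> \<inter> \<tau> = \<tau> - {x})"
    using assms(2) unfolding shellable_def by metis
  have sub: "\<sigma> \<subseteq> \<Union>\<Delta>" if "\<sigma> \<in> ?F" for \<sigma>
    using facets_mem[OF that] by (rule Union_upper)
  have eq: "f ` \<sigma> = f ` \<tau> \<longleftrightarrow> \<sigma> = \<tau>" if "\<sigma> \<in> ?F" "\<tau> \<in> ?F" for \<sigma> \<tau>
    using inj that by (intro inj_on_image_eq_iff[of f "\<Union>\<Delta>"] sub)
  have int: "f ` \<sigma> \<inter> f ` \<tau> = f ` (\<sigma> \<inter> \<tau>)" if "\<sigma> \<in> ?F" "\<tau> \<in> ?F" for \<sigma> \<tau>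
    using inj that by (intro inj_on_image_Int[symmetric, of f "\<Union>\<Delta>"] sub)
  have diff: "f ` \<tau> - {f x} = f ` (\<tau> - {x})" if "\<tau> \<in> ?F" "x \<in> \<tau>" for \<tau> x
  proof -
    have "inj_on f \<tau>"
      using inj sub[OF that(1)] by (rule inj_on_subset)
    then show ?thesis
      using that(2) by (auto simp: inj_on_def)
  qed
  define r' where "r' = {(f ` \<sigma>, f ` \<tau>) | \<sigma> \<tau>. \<sigma> \<in> ?F \<and> \<tau> \<in> ?F \<and> (\<sigma>, \<tau>) \<in> r}"
  have r': "(f ` \<sigma>, f ` \<tau>) \<in> r' \<longleftrightarrow> (\<sigma>, \<tau>) \<in> r" if "\<sigma> \<in> ?F" "\<tau> \<in> ?F" for \<sigma> \<tau>
  proof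
    assume "(f ` \<sigma>, f ` \<tau>) \<in> r'"
    then obtain \<sigma>' \<tau>' where "\<sigma>' \<in> ?F" "\<tau>' \<in> ?F" "(\<sigma>', \<tau>') \<in> r" "f ` \<sigma> = f ` \<sigma>'" "f ` \<tau> = f ` \<tau>'"
      by (auto simp: r'_def)
    then show "(\<sigma>, \<tau>) \<in> r"
      using that eq by simp
  qed (use that in \<open>auto simp: r'_def\<close>)
  have "trans r'"
  proof (rule transI)
    fix A B C assume "(A, B) \<in> r'" "(B, C) \<in> r'"
    then obtain \<sigma> \<tau> \<tau>' \<upsilon> where *: "A = f ` \<sigma>" "B = f ` \<tau>" "B = f ` \<tau>'" "C = f ` \<upsilon>"
      "\<sigma> \<in> ?F" "\<tau> \<in> ?F" "\<tau>' \<in> ?F" "\<upsilon> \<in> ?F" "(\<sigma>, \<tau>) \<in> r" "(\<tau>', \<upsilon>) \<in> r"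
      by (auto simp: r'_def)
    then have "\<tau> = \<tau>'"
      using eq by simp
    then have "(\<sigma>, \<upsilon>) \<in> r"
      using * lin unfolding strict_linear_order_on_def by (meson transD)
    then show "(A, C) \<in> r'"
      using * r' by simp
  qed
  moreover have "irrefl r'"
    using lin eq by (auto simp: strict_linear_order_on_def irrefl_def r'_def)
  moreover have "total_on ((`) f ` ?F) r'"
  proof (unfold total_on_def, intro ballI impI)
    fix A B assume "A \<in> (`) f ` ?F" "B \<in> (`) f ` ?F" "A \<noteq> B"
    then obtain \<sigma> \<tau> where *: "A = f ` \<sigma>" "B = f ` \<tau>" "\<sigma> \<in> ?F" "\<tau> \<in> ?F" "\<sigma> \<noteq> \<tau>"
      by auto
    then have "(\<sigma>, \<tau>) \<in> r \<or> (\<tau>, \<sigma>) \<in> r"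
      using lin by (simp add: strict_linear_order_on_def total_on_def)
    then show "(A, B) \<in> r' \<or> (B, A) \<in> r'"
      using * r' by simp
  qed
  ultimately have "strict_linear_order_on ((`) f ` ?F) r'"
    by (simp add: strict_linear_order_on_def)
  moreover have "\<exists>\<gamma>\<in>(`) f ` ?F. (\<gamma>, f ` \<tau>) \<in> r' \<and>
      (\<exists>x\<in>f ` \<tau>. f ` \<sigma> \<inter> f ` \<tau> \<subseteq> \<gamma> \<inter> f ` \<tau> \<and> \<gamma> \<inter> f ` \<tau> = f ` \<tau> - {x})"
    if *: "\<sigma> \<in> ?F" "\<tau> \<in> ?F" "(\<sigma>, \<tau>) \<in> r" for \<sigma> \<tau>
  proof -
    obtain \<gamma> x where g: "\<gamma> \<in> ?F" "(\<gamma>, \<tau>) \<in> r" "x \<in> \<tau>" "\<sigma> \<inter> \<tau> \<subseteq> \<gamma> \<inter> \<tau>" "\<gamma> \<inter> \<tau> = \<tau> - {x}"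
      using shell[OF *] by blast
    show ?thesis
    proof (intro bexI conjI)
      show "f ` \<sigma> \<inter> f ` \<tau> \<subseteq> f ` \<gamma> \<inter> f ` \<tau>"
        using g * by (simp add: int image_mono)
      show "f ` \<gamma> \<inter> f ` \<tau> = f ` \<tau> - {f x}"
        using g * by (simp add: int diff)
    qed (use g * r' in auto)
  qed
  ultimately show ?thesis
    unfolding shellable_def facets_image[OF inj]
    by (intro exI[of _ r']) (auto simp: r')
qed

text \<open>
  Facets are ordered by the smallest key at which they differ, the facet that contains it coming
  first.
\<close>

lemma shellable_by_key:
  fixes key :: "'a \<Rightarrow> nat"
  assumes inj: "inj_on key (\<Union>\<Delta>)"
    and exch: "\<And>\<sigma> \<tau> s. \<lbrakk>\<sigma> \<in> facets \<Delta>; \<tau> \<in> facets \<Delta>; s \<in> \<sigma>; s \<notin> \<tau>;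
        \<And>x. x \<in> \<Union>\<Delta> \<Longrightarrow> key x < key s \<Longrightarrow> x \<in> \<sigma> \<longleftrightarrow> x \<in> \<tau>\<rbrakk> \<Longrightarrow>
      \<exists>\<gamma>\<in>facets \<Delta>. \<exists>t\<in>\<tau>. \<exists>m\<in>\<gamma>. t \<notin> \<sigma> \<and> \<gamma> \<inter> \<tau> = \<tau> - {t} \<and> m \<notin> \<tau> \<and> key m < key t"
  shows "shellable \<Delta>"
proof -
  let ?F = "facets \<Delta>"
  have sub: "\<sigma> \<subseteq> \<Union>\<Delta>" if "\<sigma> \<in> ?F" for \<sigma>
    using facets_mem[OF that] by blast
  define first where
    "first \<sigma> \<tau> a \<longleftrightarrow> a \<in> \<sigma> \<and> a \<notin> \<tau> \<and> (\<forall>x\<in>\<Union>\<Delta>. key x < key a \<longrightarrow> x \<in> \<sigma> \<longleftrightarrow> x \<in> \<tau>)" for \<sigma> \<tau> a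
  define r where "r = {(\<sigma>, \<tau>). \<sigma> \<in> ?F \<and> \<tau> \<in> ?F \<and> (\<exists>a. first \<sigma> \<tau> a)}"
  have "trans r"
  proof (rule transI)
    fix \<sigma> \<tau> \<upsilon> assume "(\<sigma>, \<tau>) \<in> r" "(\<tau>, \<upsilon>) \<in> r"
    then obtain a b where F: "\<sigma> \<in> ?F" "\<tau> \<in> ?F" "\<upsilon> \<in> ?F" and a: "first \<sigma> \<tau> a" and b: "first \<tau> \<upsilon> b"
      unfolding r_def by blast
    have mem: "a \<in> \<Union>\<Delta>" "b \<in> \<Union>\<Delta>"
      using a b F sub unfolding first_def by blast+
    have "a \<noteq> b"
      using a b unfolding first_def by blast
    then consider "key a < key b" | "key b < key a"
      using inj mem by (meson inj_onD linorder_neqE_nat)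
    \<comment> \<open>All three facets agree below the smaller of the two keys, so the vertex with
      that key is the first difference of \<open>\<sigma>\<close> and
      \<open>\<upsilon>\<close>.\<close>
    then have "first \<sigma> \<upsilon> a \<or> first \<sigma> \<upsilon> b"
    proof cases
      case 1
      then have "first \<sigma> \<upsilon> a"
        using a b mem unfolding first_def by (metis less_trans)
      then show ?thesis ..
    next
      case 2
      then have "first \<sigma> \<upsilon> b"
        using a b mem unfolding first_def by (metis less_trans)
      then show ?thesis ..
    qed
    then show "(\<sigma>, \<upsilon>) \<in> r"
      using F unfolding r_def by blast
  qed
  moreover have "irrefl r"
    unfolding irrefl_def r_def first_def by blast
  moreover have "total_on ?F r"
  proof (unfold total_on_def, intro ballI impI)
    fix \<sigma> \<tau> assume F: "\<sigma> \<in> ?F" "\<tau> \<in> ?F" and "\<sigma> \<noteq> \<tau>"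
    then obtain y where "(y \<in> \<sigma>) \<noteq> (y \<in> \<tau>)"
      by blast
    from ex_has_least_nat[of "\<lambda>y. (y \<in> \<sigma>) \<noteq> (y \<in> \<tau>)" y key, OF this]
    obtain a where a: "(a \<in> \<sigma>) \<noteq> (a \<in> \<tau>)" and "\<And>y. (y \<in> \<sigma>) \<noteq> (y \<in> \<tau>) \<Longrightarrow> key a \<le> key y"
      by blast
    then have "\<forall>x\<in>\<Union>\<Delta>. key x < key a \<longrightarrow> x \<in> \<sigma> \<longleftrightarrow> x \<in> \<tau>"
      by (meson leD)
    with a have "first \<sigma> \<tau> a \<or> first \<tau> \<sigma> a"
      unfolding first_def by blast
    then show "(\<sigma>, \<tau>) \<in> r \<or> (\<tau>, \<sigma>) \<in> r"
      using F unfolding r_def by blast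
  qed
  moreover have "\<exists>\<gamma>\<in>?F. (\<gamma>, \<tau>) \<in> r \<and> (\<exists>x\<in>\<tau>. \<sigma> \<inter> \<tau> \<subseteq> \<gamma> \<inter> \<tau> \<and> \<gamma> \<inter> \<tau> = \<tau> - {x})"
    if F: "\<sigma> \<in> ?F" "\<tau> \<in> ?F" and "(\<sigma>, \<tau>) \<in> r" for \<sigma> \<tau>
  proof -
    obtain s where "first \<sigma> \<tau> s"
      using \<open>(\<sigma>, \<tau>) \<in> r\<close> unfolding r_def by blast
    then obtain \<gamma> t m where g: "\<gamma> \<in> ?F" "t \<in> \<tau>" "m \<in> \<gamma>" "t \<notin> \<sigma>" "\<gamma> \<inter> \<tau> = \<tau> - {t}" "m \<notin> \<tau>" "key m < key t"
      using exch[OF F, of s] unfolding first_def by blast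
    \<comment> \<open>The hypothesis only gives some \<open>m\<close> in \<open>\<gamma>\<close>
      outside \<open>\<tau>\<close>. The least such vertex is the first difference: the only vertex
      of \<open>\<tau>\<close> missing from \<open>\<gamma>\<close> is \<open>t\<close>, whose key
      is larger.\<close>
    obtain a where a: "a \<in> \<gamma> \<and> a \<notin> \<tau>" and least: "\<And>y. y \<in> \<gamma> \<and> y \<notin> \<tau> \<Longrightarrow> key a \<le> key y"
      using ex_has_least_nat[of "\<lambda>y. y \<in> \<gamma> \<and> y \<notin> \<tau>" m key] g by blast
    have "key a \<le> key m"
      using least g by blast
    have "x \<in> \<gamma> \<longleftrightarrow> x \<in> \<tau>" if "key x < key a" for x
    proof
      show "x \<in> \<tau>" if "x \<in> \<gamma>"
        using that \<open>key x < key a\<close> least[of x] by auto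
      show "x \<in> \<gamma>" if "x \<in> \<tau>"
        using that \<open>key x < key a\<close> \<open>key a \<le> key m\<close> g by (metis DiffI IntD1 less_irrefl less_le_trans less_trans singletonD)
    qed
    with a have "first \<gamma> \<tau> a"
      unfolding first_def by blast
    then show ?thesis
      using g F unfolding r_def by blast
  qed
  ultimately show ?thesis
    unfolding shellable_def strict_linear_order_on_def by blast
qed

text \<open>A point stands for the interval between its two coordinates and the order is inclusion
  of intervals, hence the reversed inequality in the first coordinate.\<close>

definition planar_antichains :: "(nat \<times> nat) set \<Rightarrow> (nat \<times> nat) set set" where
  "planar_antichains Q = {A. A \<subseteq> Q \<and> (\<forall>p\<in>A. \<forall>q\<in>A. fst q \<le> fst p \<and> snd p \<le> snd q \<longrightarrow> p = q)}"

text \<open>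
  Antichains are chains for the order \<open>\<lless>\<close> that is strict in both coordinates. Whenever some
  point of \<open>Q\<close> lies above \<open>p\<close>, the diagonal neighbour \<open>m\<close> of \<open>p\<close> lies in \<open>Q\<close> and below everything
  that lies above a point above \<open>p\<close>. Hence the successor of \<open>p\<close> in any chain can be exchanged for \<open>m\<close>.
\<close>

lemma planar_shellable:
  assumes fin: "finite Q" and pos: "\<And>a b. (a, b) \<in> Q \<Longrightarrow> 0 < a \<and> 0 < b"
    and closed: "\<And>i j a b. (i, j) \<in> insert (0, 0) Q \<Longrightarrow> (a, b) \<in> Q \<Longrightarrow> i < a \<Longrightarrow> j < b \<Longrightarrow>
      (Suc i, Suc j) \<in> Q"
  shows "shellable (planar_antichains Q)"
proof -
  let ?\<Delta> = "planar_antichains Q"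
  define below (infix "\<lless>" 50) where "p \<lless> q \<longleftrightarrow> fst p < fst q \<and> snd p < snd q" for p q :: "nat \<times> nat"
  have chain: "A \<in> ?\<Delta> \<longleftrightarrow> A \<subseteq> Q \<and> (\<forall>p\<in>A. \<forall>q\<in>A. p = q \<or> p \<lless> q \<or> q \<lless> p)" for A
  proof -
    have "(fst q \<le> fst p \<and> snd p \<le> snd q \<longrightarrow> p = q) \<and> (fst p \<le> fst q \<and> snd q \<le> snd p \<longrightarrow> q = p) \<longleftrightarrow>
        p = q \<or> p \<lless> q \<or> q \<lless> p" for p q :: "nat \<times> nat"
      unfolding below_def by (auto simp: prod_eq_iff)
    then show ?thesis
      unfolding planar_antichains_def by blast
  qed
  have sub_closed: "B \<in> ?\<Delta>" if "A \<in> ?\<Delta>" "B \<subseteq> A" for A B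
    using that unfolding planar_antichains_def by blast
  have insert_chain: "insert x A \<in> ?\<Delta>" if "A \<in> ?\<Delta>" "x \<in> Q" "\<And>y. y \<in> A \<Longrightarrow> x = y \<or> x \<lless> y \<or> y \<lless> x" for x A
    using that unfolding chain by blast
  have fin\<Delta>: "finite ?\<Delta>"
    by (rule finite_subset[of _ "Pow Q"]) (auto simp: planar_antichains_def fin)
  have Union: "\<Union>?\<Delta> \<subseteq> Q"
    by (auto simp: planar_antichains_def)
  \<comment> \<open>\<open>key\<close> is the lexicographic order written as a number in base
    \<open>K\<close>, which exceeds every second coordinate in \<open>Q\<close>.\<close>
  define K where "K = Suc (Max (snd ` Q))"
  define key where "key p = fst p * K + snd p" for p
  have K: "snd p < K" if "p \<in> Q" for p
    using that fin by (simp add: K_def less_Suc_eq_le)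
  have key_mono: "key p \<le> key q" if "fst p \<le> fst q" "snd p \<le> snd q" for p q
    using that by (simp add: key_def add_mono)
  have key_strict: "key p < key q" if "p \<lless> q" for p q
    using that by (simp add: key_def below_def add_le_less_mono)
  have key_inj: "p = q" if "p \<in> Q" "q \<in> Q" "key p = key q" for p q
  proof -
    have "key p div K = key q div K" "key p mod K = key q mod K"
      using that(3) by simp_all
    then show ?thesis
      using K[OF that(1)] K[OF that(2)] by (simp add: key_def prod_eq_iff)
  qed
  show ?thesis
  proof (rule shellable_by_key[where key = key])
    show "inj_on key (\<Union>?\<Delta>)"
      using Union key_inj by (meson inj_onI subsetD)
  next
    fix \<sigma> \<tau> s
    assume \<sigma>: "\<sigma> \<in> facets ?\<Delta>" and \<tau>: "\<tau> \<in> facets ?\<Delta>" and s: "s \<in> \<sigma>" "s \<notin> \<tau>"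
      and agree0: "\<And>x. x \<in> \<Union>?\<Delta> \<Longrightarrow> key x < key s \<Longrightarrow> x \<in> \<sigma> \<longleftrightarrow> x \<in> \<tau>"
    have Q: "\<sigma> \<subseteq> Q" "\<tau> \<subseteq> Q"
      using facets_mem[OF \<sigma>] facets_mem[OF \<tau>] by (auto simp: chain)
    have agree: "x \<in> \<sigma> \<longleftrightarrow> x \<in> \<tau>" if "key x < key s" for x
      using agree0[OF _ that] facets_mem[OF \<sigma>] facets_mem[OF \<tau>] by blast
    have chain\<sigma>: "x = y \<or> x \<lless> y \<or> y \<lless> x" if "x \<in> \<sigma>" "y \<in> \<sigma>" for x y
      using that facets_mem[OF \<sigma>] unfolding chain by blast
    have chain\<tau>: "x = y \<or> x \<lless> y \<or> y \<lless> x" if "x \<in> \<tau>" "y \<in> \<tau>" for x y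
      using that facets_mem[OF \<tau>] unfolding chain by blast
    have full: "x \<in> \<tau>" if "insert x \<tau> \<in> ?\<Delta>" for x
      using facets_maximal[OF \<tau> that] by blast
    define P where "P = {x \<in> \<tau>. key x < key s}"
    define T where "T = {x \<in> \<tau>. key s < key x}"
    have split: "x \<in> P \<or> x \<in> T" if "x \<in> \<tau>" for x
      using that s Q key_inj unfolding P_def T_def by (metis (mono_tags, lifting) linorder_neqE_nat mem_Collect_eq subsetD)
    have Ps: "x \<lless> s" if "x \<in> P" for x
    proof -
      have "x \<in> \<sigma>" "key x < key s"
        using that agree by (auto simp: P_def)
      then show ?thesis
        using chain\<sigma>[of x s] s key_strict[of s x] by auto
    qed
    have "finite \<tau>"
      using Q fin finite_subset by blast
    \<comment> \<open>\<open>P\<close> is the common beginning of both chains and \<open>p\<close>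
      its last point. If it is empty, the origin serves as a virtual predecessor, which is why
      \<open>closed\<close> admits \<open>(0, 0)\<close> and \<open>pos\<close> keeps
      \<open>Q\<close> off the axes.\<close>
    obtain p where p: "p \<in> insert (0, 0) Q" "p \<lless> s"
      and pP: "\<And>x. x \<in> P \<Longrightarrow> x = p \<or> x \<lless> p" and pT: "\<And>x. x \<in> T \<Longrightarrow> p \<lless> x"
    proof (cases "P = {}")
      case True
      have "(0, 0) \<lless> x" if "x \<in> Q" for x
        using pos[of "fst x" "snd x"] that by (simp add: below_def)
      moreover have "s \<in> Q" "T \<subseteq> Q"
        using s Q by (auto simp: T_def)
      ultimately show ?thesis
        using True by (intro that[of "(0, 0)"]) auto
    next
      case False
      have "finite P"
        using \<open>finite \<tau>\<close> by (simp add: P_def)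
      then have "Max (key ` P) \<in> key ` P"
        using False by simp
      then obtain p where "p \<in> P" "key p = Max (key ` P)"
        by auto
      then have p: "p \<in> P" "\<And>x. x \<in> P \<Longrightarrow> key x \<le> key p"
        using \<open>finite P\<close> by simp_all
      show ?thesis
      proof (rule that[of p])
        show "p \<in> insert (0, 0) Q" "p \<lless> s"
          using p Ps Q by (auto simp: P_def)
        show "x = p \<or> x \<lless> p" if "x \<in> P" for x
          using chain\<tau>[of x p] that p(1) p(2)[OF that] key_strict[of p x] by (auto simp: P_def)
        show "p \<lless> x" if "x \<in> T" for x
          using chain\<tau>[of x p] that p key_strict[of x p] by (auto simp: P_def T_def)
      qed
    qed
    \<comment> \<open>Otherwise \<open>s\<close> could be appended to the facet
      \<open>\<tau>\<close>.\<close>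
    have "T \<noteq> {}"
    proof
      assume "T = {}"
      then have "x \<lless> s" if "x \<in> \<tau>" for x
        using split[OF that] Ps by blast
      then have "insert s \<tau> \<in> ?\<Delta>"
        using s Q by (intro insert_chain[OF facets_mem[OF \<tau>]]) auto
      then show False
        using full s by blast
    qed
    then obtain t where t: "t \<in> T" "\<And>x. x \<in> T \<Longrightarrow> key t \<le> key x"
      using ex_has_least_nat[of "\<lambda>x. x \<in> T" _ key] by blast
    have tT: "x = t \<or> t \<lless> x" if "x \<in> T" for x
      using chain\<tau>[of x t] that t(1) t(2)[OF that] key_strict[of x t] by (auto simp: T_def)
    \<comment> \<open>Otherwise \<open>s\<close> would fit into the facet \<open>\<tau>\<close>
      between \<open>P\<close> and \<open>t\<close>.\<close>
    have "t \<notin> \<sigma>"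
    proof
      assume "t \<in> \<sigma>"
      then have "s \<lless> t"
        using chain\<sigma>[of s t] s t key_strict[of t s] by (auto simp: T_def)
      then have "x \<lless> s \<or> s \<lless> x" if "x \<in> \<tau>" for x
        using split[OF that] Ps tT unfolding below_def by fastforce
      then have "insert s \<tau> \<in> ?\<Delta>"
        using s Q by (intro insert_chain[OF facets_mem[OF \<tau>]]) auto
      then show False
        using full s by blast
    qed
    define m where "m = (Suc (fst p), Suc (snd p))"
    have "m \<in> Q"
      using closed[of "fst p" "snd p" "fst s" "snd s"] p s Q unfolding m_def below_def by auto
    have "key m \<le> key s"
      using p by (intro key_mono) (auto simp: m_def below_def)
    have "p \<lless> t"
      using pT t by blast
    have Pm: "x \<lless> m" if "x \<in> P" for x
      using pP[OF that] by (auto simp: m_def below_def)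
    have tm: "m \<lless> x" if "t \<lless> x" for x
      using that \<open>p \<lless> t\<close> by (auto simp: m_def below_def)
    have "m \<notin> \<tau>"
    proof
      assume "m \<in> \<tau>"
      then consider "m \<in> P" | "m \<in> T"
        using split by blast
      then show False
        using Pm[of m] \<open>key m \<le> key s\<close> by cases (auto simp: below_def T_def)
    qed
    have "insert m (\<tau> - {t}) \<in> ?\<Delta>"
    proof (rule insert_chain)
      show "\<tau> - {t} \<in> ?\<Delta>"
        using sub_closed[OF facets_mem[OF \<tau>]] by blast
      show "m = y \<or> m \<lless> y \<or> y \<lless> m" if "y \<in> \<tau> - {t}" for y
        using that split[of y] Pm tT tm by blast
    qed fact
    \<comment> \<open>The extension to a facet may add further vertices but not \<open>t\<close>,
      since then the chain \<open>insert m \<tau>\<close> would properly contain the facet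
      \<open>\<tau>\<close>.\<close>
    then obtain \<gamma> where \<gamma>: "\<gamma> \<in> facets ?\<Delta>" "insert m (\<tau> - {t}) \<subseteq> \<gamma>"
      using face_in_facet[OF fin\<Delta>] by blast
    have "t \<notin> \<gamma>"
    proof
      assume "t \<in> \<gamma>"
      then have "insert m \<tau> \<subseteq> \<gamma>"
        using \<gamma> by blast
      then show False
        using full[of m] sub_closed[OF facets_mem[OF \<gamma>(1)]] \<open>m \<notin> \<tau>\<close> by blast
    qed
    show "\<exists>\<gamma>\<in>facets ?\<Delta>. \<exists>t\<in>\<tau>. \<exists>m\<in>\<gamma>. t \<notin> \<sigma> \<and> \<gamma> \<inter> \<tau> = \<tau> - {t} \<and> m \<notin> \<tau> \<and> key m < key t"
    proof (intro bexI conjI)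
      show "\<gamma> \<inter> \<tau> = \<tau> - {t}"
        using \<gamma> \<open>t \<notin> \<gamma>\<close> by blast
      show "key m < key t"
        using \<open>key m \<le> key s\<close> t by (auto simp: T_def)
      show "t \<in> \<tau>"
        using t by (simp add: T_def)
    qed (use \<open>t \<notin> \<sigma>\<close> \<open>m \<notin> \<tau>\<close> \<gamma> in auto)
  qed
qed

section \<open>An obstruction to shellability\<close>

text \<open>
  In the link of \<open>\<rho>\<close>, faces of dimension at least two inside \<open>W\<close> and those not inside \<open>W\<close> never
  share an edge, so neither class can be entered from the other one in a shelling.
\<close>

lemma not_shellable_if_split:
  assumes fin: "finite \<Delta>" and finA: "\<And>A. A \<in> \<Delta> \<Longrightarrow> finite A"
    and A\<^sub>1: "A\<^sub>1 \<in> \<Delta>" "\<rho> \<subseteq> A\<^sub>1" "3 \<le> card (A\<^sub>1 - \<rho>)" "A\<^sub>1 \<subseteq> \<rho> \<union> W"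
    and A\<^sub>2: "A\<^sub>2 \<in> \<Delta>" "\<rho> \<subseteq> A\<^sub>2" "3 \<le> card (A\<^sub>2 - \<rho>)" "\<not> A\<^sub>2 \<subseteq> \<rho> \<union> W"
    and sep: "\<And>A. A \<in> \<Delta> \<Longrightarrow> \<rho> \<subseteq> A \<Longrightarrow> 2 \<le> card (A \<inter> W) \<Longrightarrow> A \<subseteq> \<rho> \<union> W"
  shows "\<not> shellable \<Delta>"
proof
  let ?F = "facets \<Delta>"
  assume "shellable \<Delta>"
  then obtain r where lin: "strict_linear_order_on ?F r"
    and shell: "\<And>\<sigma> \<tau>. \<sigma> \<in> ?F \<Longrightarrow> \<tau> \<in> ?F \<Longrightarrow> (\<sigma>, \<tau>) \<in> r \<Longrightarrow>
      \<exists>\<gamma>\<in>?F. (\<gamma>, \<tau>) \<in> r \<and> (\<exists>x\<in>\<tau>. \<sigma> \<inter> \<tau> \<subseteq> \<gamma> \<inter> \<tau> \<and> \<gamma> \<inter> \<tau> = \<tau> - {x})"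
    unfolding shellable_def by metis
  have tr: "trans r" "irrefl r" and tot: "total_on ?F r"
    using lin by (auto simp: strict_linear_order_on_def)
  \<comment> \<open>The bound three leaves at least two vertices outside \<open>\<rho>\<close> after
    one is removed, enough for \<open>sep\<close> to apply.\<close>
  define G where "G = {\<sigma> \<in> ?F. \<rho> \<subseteq> \<sigma> \<and> 3 \<le> card (\<sigma> - \<rho>)}"
  have card2: "2 \<le> card (\<sigma> \<inter> W)" if "B \<subseteq> \<sigma>" "B \<subseteq> W" "2 \<le> card B" "\<sigma> \<in> \<Delta>" for B \<sigma>
    using that finA[OF that(4)] by (meson Int_greatest card_mono finite_Int le_trans)
  have card_up: "3 \<le> card (\<sigma> - \<rho>)" if "A \<subseteq> \<sigma>" "3 \<le> card (A - \<rho>)" "\<sigma> \<in> \<Delta>" for A \<sigma>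
    using that finA[OF that(3)] by (meson Diff_mono card_mono finite_Diff le_trans order_refl)
  obtain \<sigma>\<^sub>1 where \<sigma>\<^sub>1: "\<sigma>\<^sub>1 \<in> ?F" "A\<^sub>1 \<subseteq> \<sigma>\<^sub>1"
    using face_in_facet[OF fin A\<^sub>1(1)] .
  have "2 \<le> card (\<sigma>\<^sub>1 \<inter> W)"
    by (rule card2[of "A\<^sub>1 - \<rho>"]) (use \<sigma>\<^sub>1 A\<^sub>1 facets_mem in auto)
  then have in\<^sub>1: "\<sigma>\<^sub>1 \<in> G" "\<sigma>\<^sub>1 \<subseteq> \<rho> \<union> W"
    using \<sigma>\<^sub>1 A\<^sub>1 sep[of \<sigma>\<^sub>1] card_up[of A\<^sub>1 \<sigma>\<^sub>1] facets_mem unfolding G_def by blast+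
  obtain \<sigma>\<^sub>2 where \<sigma>\<^sub>2: "\<sigma>\<^sub>2 \<in> ?F" "A\<^sub>2 \<subseteq> \<sigma>\<^sub>2"
    using face_in_facet[OF fin A\<^sub>2(1)] .
  have in\<^sub>2: "\<sigma>\<^sub>2 \<in> G" "\<not> \<sigma>\<^sub>2 \<subseteq> \<rho> \<union> W"
    using \<sigma>\<^sub>2 A\<^sub>2 card_up[of A\<^sub>2 \<sigma>\<^sub>2] facets_mem unfolding G_def by blast+
  have step: "\<exists>\<gamma>\<in>G. (\<gamma>, \<tau>) \<in> r \<and> (\<gamma> \<subseteq> \<rho> \<union> W \<longleftrightarrow> \<tau> \<subseteq> \<rho> \<union> W)"
    if "\<sigma> \<in> G" "\<tau> \<in> G" and rel: "(\<sigma>, \<tau>) \<in> r" for \<sigma> \<tau>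
  proof -
    have F: "\<sigma> \<in> ?F" "\<tau> \<in> ?F" and \<rho>: "\<rho> \<subseteq> \<sigma>" "\<rho> \<subseteq> \<tau>" and c3: "3 \<le> card (\<tau> - \<rho>)"
      using that by (auto simp: G_def)
    obtain \<gamma> x where \<gamma>: "\<gamma> \<in> ?F" "(\<gamma>, \<tau>) \<in> r" "x \<in> \<tau>" "\<sigma> \<inter> \<tau> \<subseteq> \<gamma> \<inter> \<tau>" "\<gamma> \<inter> \<tau> = \<tau> - {x}"
      using shell[OF F rel] by blast
    \<comment> \<open>\<open>\<rho>\<close> lies in both \<open>\<sigma>\<close> and
      \<open>\<tau>\<close>, hence in \<open>\<tau> - {x}\<close>.\<close>
    have \<rho>\<gamma>: "\<rho> \<subseteq> \<gamma>" and "x \<notin> \<rho>"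
      using \<rho> \<gamma> by blast+
    define B where "B = \<tau> - \<rho> - {x}"
    have B: "B \<subseteq> \<gamma>" "B \<subseteq> \<tau>" "B \<inter> \<rho> = {}"
      using \<gamma> by (auto simp: B_def)
    have "card (\<tau> - \<rho>) = Suc (card B)"
      unfolding B_def using \<open>x \<notin> \<rho>\<close> \<gamma> finA[OF facets_mem[OF F(2)]] by (metis DiffI card_Suc_Diff1 finite_Diff)
    with c3 have c2: "2 \<le> card B"
      by simp
    \<comment> \<open>The facets differ in \<open>x\<close>, so \<open>\<gamma>\<close> also brings
      a vertex outside \<open>\<tau>\<close>. Together with \<open>B\<close> this makes three
      vertices outside \<open>\<rho>\<close>, so \<open>\<gamma>\<close> stays in
      \<open>G\<close>.\<close>
    have "\<not> \<gamma> \<subseteq> \<tau>"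
      using facets_maximal[OF \<gamma>(1) facets_mem[OF F(2)]] \<gamma> by blast
    then obtain y where y: "y \<in> \<gamma>" "y \<notin> \<tau>"
      by blast
    have "card (insert y B) \<le> card (\<gamma> - \<rho>)"
      by (rule card_mono) (use finA[OF facets_mem[OF \<gamma>(1)]] y B \<rho> in auto)
    moreover have "card (insert y B) = Suc (card B)"
      using y B finA[OF facets_mem[OF F(2)]] finite_subset by (metis card_insert_disjoint subsetD)
    ultimately have "\<gamma> \<in> G"
      using c2 \<gamma> \<rho>\<gamma> by (simp add: G_def)
    \<comment> \<open>The shared set \<open>B\<close> avoids \<open>\<rho>\<close>. If one of the
      two facets lies in \<open>\<rho> \<union> W\<close>, then \<open>B\<close> lies in
      \<open>W\<close>, and \<open>sep\<close> forces the other facet into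
      \<open>\<rho> \<union> W\<close> as well.\<close>
    moreover have "\<gamma> \<subseteq> \<rho> \<union> W \<longleftrightarrow> \<tau> \<subseteq> \<rho> \<union> W"
    proof
      assume "\<gamma> \<subseteq> \<rho> \<union> W"
      then have "2 \<le> card (\<tau> \<inter> W)"
        using B c2 facets_mem[OF F(2)] by (intro card2[of B]) auto
      then show "\<tau> \<subseteq> \<rho> \<union> W"
        using sep facets_mem[OF F(2)] \<rho> by blast
    next
      assume "\<tau> \<subseteq> \<rho> \<union> W"
      then have "2 \<le> card (\<gamma> \<inter> W)"
        using B c2 facets_mem[OF \<gamma>(1)] by (intro card2[of B]) auto
      then show "\<gamma> \<subseteq> \<rho> \<union> W"
        using sep facets_mem[OF \<gamma>(1)] \<rho>\<gamma> by blast
    qed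
    ultimately show ?thesis
      using \<gamma> by blast
  qed
  have "finite G"
    using fin by (auto simp: G_def facets_def)
  have "acyclic r"
    using tr by (simp add: acyclic_irrefl)
  then have "wf (r \<inter> G \<times> G)"
    using \<open>finite G\<close> by (intro finite_acyclic_wf) (auto intro: acyclic_subset)
  then have first: "\<exists>\<tau>\<in>H. \<forall>\<gamma>\<in>H. (\<gamma>, \<tau>) \<notin> r" if "H \<subseteq> G" "H \<noteq> {}" for H
  proof -
    obtain x where "x \<in> H"
      using \<open>H \<noteq> {}\<close> by blast
    with \<open>wf _\<close> obtain \<tau> where "\<tau> \<in> H" "\<And>\<gamma>. (\<gamma>, \<tau>) \<in> r \<inter> G \<times> G \<Longrightarrow> \<gamma> \<notin> H"
      by (rule wfE_min) blast
    then show ?thesis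
      using \<open>H \<subseteq> G\<close> by blast
  qed
  obtain \<tau>\<^sub>1 where \<tau>\<^sub>1: "\<tau>\<^sub>1 \<in> G" "\<tau>\<^sub>1 \<subseteq> \<rho> \<union> W" and m\<^sub>1: "\<And>\<gamma>. \<gamma> \<in> G \<Longrightarrow> \<gamma> \<subseteq> \<rho> \<union> W \<Longrightarrow> (\<gamma>, \<tau>\<^sub>1) \<notin> r"
    using first[of "{\<gamma> \<in> G. \<gamma> \<subseteq> \<rho> \<union> W}"] in\<^sub>1 by blast
  obtain \<tau>\<^sub>2 where \<tau>\<^sub>2: "\<tau>\<^sub>2 \<in> G" "\<not> \<tau>\<^sub>2 \<subseteq> \<rho> \<union> W" and m\<^sub>2: "\<And>\<gamma>. \<gamma> \<in> G \<Longrightarrow> \<not> \<gamma> \<subseteq> \<rho> \<union> W \<Longrightarrow> (\<gamma>, \<tau>\<^sub>2) \<notin> r"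
    using first[of "{\<gamma> \<in> G. \<not> \<gamma> \<subseteq> \<rho> \<union> W}"] in\<^sub>2 by blast
  \<comment> \<open>These are the earliest members of the two classes. Whichever comes later has the
    other before it, so \<open>step\<close> would yield a still earlier member of its own
    class.\<close>
  have "\<tau>\<^sub>1 \<in> ?F" "\<tau>\<^sub>2 \<in> ?F" "\<tau>\<^sub>1 \<noteq> \<tau>\<^sub>2"
    using \<tau>\<^sub>1 \<tau>\<^sub>2 by (auto simp: G_def)
  then have "(\<tau>\<^sub>1, \<tau>\<^sub>2) \<in> r \<or> (\<tau>\<^sub>2, \<tau>\<^sub>1) \<in> r"
    using tot by (simp add: total_on_def)
  then show False
    using step[OF \<tau>\<^sub>1(1) \<tau>\<^sub>2(1)] step[OF \<tau>\<^sub>2(1) \<tau>\<^sub>1(1)] \<tau>\<^sub>1 \<tau>\<^sub>2 m\<^sub>1 m\<^sub>2 by blast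
qed

section \<open>Simple systems\<close>

lemma lookup_scaleR [simp]: "Poly_Mapping.lookup (c *\<^sub>R x) i = c *\<^sub>R Poly_Mapping.lookup x i"
proof -
  have "finite {i. c *\<^sub>R Poly_Mapping.lookup x i \<noteq> 0}"
    by (rule finite_subset[of _ "Poly_Mapping.keys x"]) (auto simp: in_keys_iff)
  then show ?thesis
    by (simp add: scaleR_poly_mapping_def)
qed

section \<open>Inner product and reflections\<close>

abbreviation coord :: "vec \<Rightarrow> nat \<Rightarrow> real" where
  "coord \<equiv> Poly_Mapping.lookup"

text \<open>Summing over the support of the first argument keeps the sum finite without fixing a
  dimension. \<open>ip_eq_sum\<close> allows any larger finite index set, from which symmetry
  follows.\<close>

definition ip :: "vec \<Rightarrow> vec \<Rightarrow> real" where
  "ip x y = (\<Sum>i\<in>Poly_Mapping.keys x. coord x i * coord y i)"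

lemma ip_eq_sum:
  assumes "finite A" "Poly_Mapping.keys x \<subseteq> A"
  shows "ip x y = (\<Sum>i\<in>A. coord x i * coord y i)"
  unfolding ip_def by (rule sum.mono_neutral_left) (use assms in \<open>auto simp: in_keys_iff\<close>)

lemma ip_commute: "ip x y = ip y x"
  by (simp add: ip_eq_sum[of "Poly_Mapping.keys x \<union> Poly_Mapping.keys y"] mult.commute)

lemma ip_add_left: "ip (x + y) z = ip x z + ip y z"
proof -
  let ?A = "Poly_Mapping.keys x \<union> Poly_Mapping.keys y \<union> Poly_Mapping.keys (x + y)"
  have "ip u z = (\<Sum>i\<in>?A. coord u i * coord z i)"
    if "u \<in> {x, y, x + y}" for u
    by (rule ip_eq_sum) (use that in auto)
  then show ?thesis
    by (simp add: lookup_add distrib_right sum.distrib)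
qed

lemma ip_scaleR_left [simp]: "ip (c *\<^sub>R x) y = c * ip x y"
proof -
  let ?A = "Poly_Mapping.keys x \<union> Poly_Mapping.keys (c *\<^sub>R x)"
  have "ip u y = (\<Sum>i\<in>?A. coord u i * coord y i)"
    if "u \<in> {x, c *\<^sub>R x}" for u
    by (rule ip_eq_sum) (use that in auto)
  then show ?thesis
    by (simp add: sum_distrib_left mult.assoc)
qed

lemma ip_add_right: "ip x (y + z) = ip x y + ip x z"
  by (metis ip_add_left ip_commute)

lemma ip_scaleR_right [simp]: "ip x (c *\<^sub>R y) = c * ip x y"
  by (metis ip_scaleR_left ip_commute)

lemma ip_zero [simp]: "ip 0 x = 0" "ip x 0 = 0"
  using ip_scaleR_left[of 0 0 x] ip_scaleR_right[of x 0 0] by simp_all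

lemma ip_minus_left [simp]: "ip (- x) y = - ip x y"
  using ip_scaleR_left[of "-1" x y] by simp

lemma ip_minus_right [simp]: "ip x (- y) = - ip x y"
  using ip_scaleR_right[of x "-1" y] by simp

lemma ip_diff_left: "ip (x - y) z = ip x z - ip y z"
  using ip_add_left[of x "- y" z] by simp

lemma ip_diff_right: "ip x (y - z) = ip x y - ip x z"
  using ip_add_right[of x y "- z"] by simp

lemmas ip_bilinear = ip_add_left ip_add_right ip_diff_left ip_diff_right

lemma ip_e_left [simp]: "ip (e i) x = coord x i"
  by (simp add: ip_eq_sum[of "{i}"])

lemma ip_e_right [simp]: "ip x (e i) = coord x i"
  using ip_e_left[of i x] ip_commute by simp

lemma ip_self_nonneg: "0 \<le> ip x x"
  unfolding ip_def by (simp add: sum_nonneg)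

lemma ip_self_eq_0 [simp]: "ip x x = 0 \<longleftrightarrow> x = 0"
  unfolding ip_def by (auto simp: sum_nonneg_eq_0_iff in_keys_iff intro: poly_mapping_eqI)

definition reflect :: "vec \<Rightarrow> vec \<Rightarrow> vec" where
  "reflect \<alpha> x = x - (2 * ip x \<alpha> / ip \<alpha> \<alpha>) *\<^sub>R \<alpha>"

lemma linear_reflect: "linear (reflect \<alpha>)"
  by (rule linearI) (simp_all add: reflect_def ip_add_left algebra_simps add_divide_distrib)

lemma reflect_self: "ip \<alpha> \<alpha> \<noteq> 0 \<Longrightarrow> reflect \<alpha> \<alpha> = - \<alpha>"
  by (simp add: reflect_def scaleR_2)

lemma reflect_reflect: "ip \<alpha> \<alpha> \<noteq> 0 \<Longrightarrow> reflect \<alpha> (reflect \<alpha> x) = x"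
  by (simp add: reflect_def ip_diff_left)

lemma ip_reflect: "ip \<alpha> \<alpha> \<noteq> 0 \<Longrightarrow> ip (reflect \<alpha> x) (reflect \<alpha> x) = ip x x"
  by (simp add: reflect_def ip_bilinear ip_commute[of \<alpha> x])

section \<open>Non-negative integer combinations and simple systems\<close>

abbreviation scoeff :: "vec set \<Rightarrow> vec \<Rightarrow> vec \<Rightarrow> real" where
  "scoeff \<equiv> real_vector.representation"

text \<open>Independence makes the coefficients unique, so those of the combination are the ones
  returned by \<open>scoeff\<close>.\<close>

lemma nat_combinations_iff:
  assumes "independent S" "finite S"
  shows "x \<in> nat_combinations S \<longleftrightarrow> x \<in> span S \<and> (\<forall>\<alpha>\<in>S. scoeff S x \<alpha> \<in> \<nat>)"
proof
  assume "x \<in> nat_combinations S"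
  then obtain c where x: "x = (\<Sum>\<alpha>\<in>S. real (c \<alpha>) *\<^sub>R \<alpha>)"
    unfolding nat_combinations_def by blast
  have "scoeff S x \<beta> = real (c \<beta>)" if "\<beta> \<in> S" for \<beta>
  proof -
    have "scoeff S x \<beta> = (\<Sum>\<alpha>\<in>S. scoeff S (real (c \<alpha>) *\<^sub>R \<alpha>) \<beta>)"
      unfolding x by (subst real_vector.representation_sum) (auto simp: assms span_base span_scale)
    also have "\<dots> = (\<Sum>\<alpha>\<in>S. if \<alpha> = \<beta> then real (c \<beta>) else 0)"
      by (rule sum.cong)
        (auto simp: real_vector.representation_scale real_vector.representation_basis assms span_base)
    finally show ?thesis
      using that assms by simp
  qed
  moreover have "x \<in> span S"
    unfolding x by (intro span_sum span_scale span_base)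
  ultimately show "x \<in> span S \<and> (\<forall>\<alpha>\<in>S. scoeff S x \<alpha> \<in> \<nat>)"
    by simp
next
  assume *: "x \<in> span S \<and> (\<forall>\<alpha>\<in>S. scoeff S x \<alpha> \<in> \<nat>)"
  then have "\<forall>\<alpha>\<in>S. \<exists>n. scoeff S x \<alpha> = real n"
    by (auto simp: Nats_def)
  then obtain c where "\<forall>\<alpha>\<in>S. scoeff S x \<alpha> = real (c \<alpha>)"
    by metis
  then have "(\<Sum>\<alpha>\<in>S. real (c \<alpha>) *\<^sub>R \<alpha>) = (\<Sum>\<alpha>\<in>S. scoeff S x \<alpha> *\<^sub>R \<alpha>)"
    by simp
  also have "\<dots> = x"
    using * assms by (intro real_vector.sum_representation_eq) auto
  finally show "x \<in> nat_combinations S"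
    unfolding nat_combinations_def by auto
qed

lemma nat_combinations_0: "0 \<in> nat_combinations S"
  unfolding nat_combinations_def by (auto intro: exI[of _ "\<lambda>_. 0"])

lemma nat_combinations_add:
  assumes "x \<in> nat_combinations S" "y \<in> nat_combinations S"
  shows "x + y \<in> nat_combinations S"
proof -
  from assms obtain c d where "x = (\<Sum>\<alpha>\<in>S. real (c \<alpha>) *\<^sub>R \<alpha>)" "y = (\<Sum>\<alpha>\<in>S. real (d \<alpha>) *\<^sub>R \<alpha>)"
    unfolding nat_combinations_def by blast
  then have "x + y = (\<Sum>\<alpha>\<in>S. real (c \<alpha> + d \<alpha>) *\<^sub>R \<alpha>)"
    by (simp add: scaleR_left_distrib sum.distrib)
  then show ?thesis
    unfolding nat_combinations_def by (intro CollectI exI[of _ "\<lambda>\<alpha>. c \<alpha> + d \<alpha>"] conjI TrueI)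
qed

lemma nat_combinations_base:
  assumes "finite S" "\<alpha> \<in> S"
  shows "\<alpha> \<in> nat_combinations S"
proof -
  have "(\<Sum>\<beta>\<in>S. real (if \<beta> = \<alpha> then 1 else 0) *\<^sub>R \<beta>) = (\<Sum>\<beta>\<in>S. if \<beta> = \<alpha> then \<beta> else 0)"
    by (rule sum.cong) auto
  also have "\<dots> = \<alpha>"
    using assms by simp
  finally show ?thesis
    unfolding nat_combinations_def
    by (intro CollectI exI[of _ "\<lambda>\<beta>. if \<beta> = \<alpha> then 1 else 0"]) simp
qed

lemma nat_combinations_sum:
  "(\<And>i. i \<in> I \<Longrightarrow> f i \<in> nat_combinations S) \<Longrightarrow> sum f I \<in> nat_combinations S"
  by (induction I rule: infinite_finite_induct) (auto intro: nat_combinations_0 nat_combinations_add)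

lemma nat_combinations_scale:
  "x \<in> nat_combinations S \<Longrightarrow> real n *\<^sub>R x \<in> nat_combinations S"
  by (induction n) (auto intro: nat_combinations_0 nat_combinations_add simp: scaleR_left_distrib)

lemma nat_combinations_subset:
  assumes "S \<subseteq> nat_combinations T"
  shows "nat_combinations S \<subseteq> nat_combinations T"
  using assms unfolding nat_combinations_def[of S]
  by (auto intro!: nat_combinations_sum nat_combinations_scale)

lemma nat_combinations_image:
  assumes "linear w" "inj_on w S"
  shows "nat_combinations (w ` S) = w ` nat_combinations S"
proof -
  have *: "(\<Sum>\<beta>\<in>w ` S. real (c \<beta>) *\<^sub>R \<beta>) = w (\<Sum>\<alpha>\<in>S. real (c (w \<alpha>)) *\<^sub>R \<alpha>)" for c
    using assms by (simp add: sum.reindex linear_sum linear_scale)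
  show ?thesis
  proof (intro set_eqI iffI)
    fix x assume "x \<in> nat_combinations (w ` S)"
    then obtain c where "x = (\<Sum>\<beta>\<in>w ` S. real (c \<beta>) *\<^sub>R \<beta>)"
      unfolding nat_combinations_def by blast
    then show "x \<in> w ` nat_combinations S"
      unfolding * nat_combinations_def by (intro image_eqI) auto
  next
    fix x assume "x \<in> w ` nat_combinations S"
    then obtain c where x: "x = w (\<Sum>\<alpha>\<in>S. real (c \<alpha>) *\<^sub>R \<alpha>)"
      unfolding nat_combinations_def by blast
    have "x = (\<Sum>\<beta>\<in>w ` S. real (c (inv_into S w \<beta>)) *\<^sub>R \<beta>)"
      unfolding * x using assms(2) by (intro arg_cong[of _ _ w] sum.cong) auto
    then show "x \<in> nat_combinations (w ` S)"
      unfolding nat_combinations_def by (intro CollectI exI[of _ "\<lambda>\<beta>. c (inv_into S w \<beta>)"]) simp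
  qed
qed

lemma simple_roots_image:
  assumes "linear w" "inj w" "simple_roots \<Phi> S"
  shows "simple_roots (w ` \<Phi>) (w ` S)"
proof -
  have "inj_on w A" for A
    using assms(2) inj_on_subset by blast
  then have "nat_combinations (w ` S) = w ` nat_combinations S" "independent (w ` S)"
    using assms nat_combinations_image[of w S] linear_independent_injective_image[of w S]
    by (auto simp: simple_roots_def)
  then show ?thesis
    using assms(3) by (auto simp: simple_roots_def simp flip: linear_neg[OF assms(1)])
qed

lemma antichain_complex_image:
  assumes "linear w" "inj w"
  shows "antichain_complex (w ` \<Phi>) (w ` S) = (`) w ` antichain_complex \<Phi> S"
proof -
  have "nat_combinations (w ` S) = w ` nat_combinations S"
    using assms inj_on_subset by (intro nat_combinations_image) auto
  then have pos: "positive_roots (w ` \<Phi>) (w ` S) = w ` positive_roots \<Phi> S"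
    and le: "root_le (w ` S) (w \<alpha>) (w \<beta>) \<longleftrightarrow> root_le S \<alpha> \<beta>" for \<alpha> \<beta>
    using assms by (simp_all add: positive_roots_def root_le_def image_Int inj_image_mem_iff
        flip: linear_diff[OF assms(1)])
  have mem: "w ` A \<in> antichain_complex (w ` \<Phi>) (w ` S) \<longleftrightarrow> A \<in> antichain_complex \<Phi> S" for A
    using assms(2) by (simp add: antichain_complex_def pos le inj_image_subset_iff inj_eq)
  show ?thesis
  proof (intro set_eqI iffI)
    fix B assume B: "B \<in> antichain_complex (w ` \<Phi>) (w ` S)"
    then obtain A where "B = w ` A"
      unfolding antichain_complex_def pos by (auto elim: subset_imageE)
    then show "B \<in> (`) w ` antichain_complex \<Phi> S"
      using B mem by simp
  qed (use mem in auto)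
qed

lemma simple_roots_finite: "finite \<Phi> \<Longrightarrow> simple_roots \<Phi> S \<Longrightarrow> finite S"
  by (auto simp: simple_roots_def intro: finite_subset)

lemma simple_roots_nat_combinations_iff:
  "finite \<Phi> \<Longrightarrow> simple_roots \<Phi> S \<Longrightarrow>
    x \<in> nat_combinations S \<longleftrightarrow> x \<in> span S \<and> (\<forall>\<alpha>\<in>S. scoeff S x \<alpha> \<in> \<nat>)"
  using nat_combinations_iff simple_roots_finite simple_roots_def by blast

lemma nat_combinations_antisym:
  assumes "independent S" "finite S" "x \<in> nat_combinations S" "- x \<in> nat_combinations S"
  shows "x = 0"
proof -
  have x: "x \<in> span S" and "\<forall>\<alpha>\<in>S. scoeff S x \<alpha> \<in> \<nat> \<and> - scoeff S x \<alpha> \<in> \<nat>"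
    using assms by (auto simp: nat_combinations_iff real_vector.representation_neg)
  then have "\<forall>\<alpha>\<in>S. scoeff S x \<alpha> = 0"
    using Nats_cases by (metis neg_0_le_iff_le of_nat_0_le_iff order_antisym)
  then show ?thesis
    using real_vector.sum_representation_eq[of S x S] x assms by simp
qed

text \<open>The coefficients of \<open>x\<close> and \<open>y\<close> are natural numbers adding up
  to a single 1, so one of the two vectors has only zero coefficients.\<close>

lemma nat_combinations_indecomposable:
  assumes "independent S" "finite S" "\<alpha> \<in> S"
    and "x \<in> nat_combinations S" "y \<in> nat_combinations S" "\<alpha> = x + y"
  shows "x = 0 \<or> y = 0"
proof -
  have x: "x \<in> span S" "\<forall>\<gamma>\<in>S. scoeff S x \<gamma> \<in> \<nat>" and y: "y \<in> span S" "\<forall>\<gamma>\<in>S. scoeff S y \<gamma> \<in> \<nat>"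
    using assms by (auto simp: nat_combinations_iff)
  have sum: "scoeff S x \<gamma> + scoeff S y \<gamma> = (if \<gamma> = \<alpha> then 1 else 0)" for \<gamma>
    using real_vector.representation_add[OF assms(1) y(1) x(1)]
      real_vector.representation_basis[OF assms(1,3)] assms(6)
    by metis
  have nn: "0 \<le> scoeff S x \<gamma>" "0 \<le> scoeff S y \<gamma>" if "\<gamma> \<in> S" for \<gamma>
    using x y that Nats_cases by (metis of_nat_0_le_iff)+
  have "\<forall>\<gamma>\<in>S. \<gamma> \<noteq> \<alpha> \<longrightarrow> scoeff S x \<gamma> = 0 \<and> scoeff S y \<gamma> = 0"
    using nn sum by (metis add_nonneg_eq_0_iff)
  moreover have "scoeff S x \<alpha> = 0 \<or> scoeff S y \<alpha> = 0"
  proof -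
    obtain m n where mn: "scoeff S x \<alpha> = real m" "scoeff S y \<alpha> = real n"
      using x y assms(3) by (metis Nats_cases)
    then have "real (m + n) = 1"
      using sum[of \<alpha>] by simp
    then have "m = 0 \<or> n = 0"
      by linarith
    then show ?thesis
      using mn by auto
  qed
  ultimately have "(\<forall>\<gamma>\<in>S. scoeff S x \<gamma> = 0) \<or> (\<forall>\<gamma>\<in>S. scoeff S y \<gamma> = 0)"
    by metis
  then show ?thesis
    using real_vector.sum_representation_eq[of S x S] real_vector.sum_representation_eq[of S y S] x y assms
    by auto
qed

text \<open>A basis is recovered from its monoid as the set of indecomposable elements: splitting
  one \<open>\<gamma>\<close> off the expansion of \<open>\<alpha>\<close> over \<open>T\<close>
  decomposes \<open>\<alpha>\<close> within the common monoid, which forces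
  \<open>\<alpha> = \<gamma>\<close>.\<close>

lemma simple_roots_subset:
  assumes S: "independent S" "finite S" and T: "independent T" "finite T"
    and eq: "nat_combinations S = nat_combinations T"
  shows "S \<subseteq> T"
proof
  fix \<alpha> assume \<alpha>: "\<alpha> \<in> S"
  then have "\<alpha> \<noteq> 0"
    using S dependent_zero by blast
  have "\<alpha> \<in> nat_combinations T"
    using \<alpha> S eq nat_combinations_base by blast
  then obtain c where c: "\<alpha> = (\<Sum>\<gamma>\<in>T. real (c \<gamma>) *\<^sub>R \<gamma>)"
    unfolding nat_combinations_def by blast
  then have "\<exists>\<gamma>\<in>T. c \<gamma> \<noteq> 0"
    using \<open>\<alpha> \<noteq> 0\<close> by (metis (no_types, lifting) of_nat_0 scaleR_zero_left sum.neutral)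
  then obtain \<gamma> k where \<gamma>: "\<gamma> \<in> T" "c \<gamma> = Suc k"
    using not0_implies_Suc by blast
  have "\<alpha> = \<gamma> + (real k *\<^sub>R \<gamma> + (\<Sum>\<delta>\<in>T - {\<gamma>}. real (c \<delta>) *\<^sub>R \<delta>))"
    unfolding c using \<gamma> T by (simp add: sum.remove[of T \<gamma>] scaleR_left_distrib)
  moreover have "real k *\<^sub>R \<gamma> + (\<Sum>\<delta>\<in>T - {\<gamma>}. real (c \<delta>) *\<^sub>R \<delta>) \<in> nat_combinations S"
    unfolding eq using T \<gamma>
    by (intro nat_combinations_add nat_combinations_scale nat_combinations_sum nat_combinations_base) auto
  moreover have "\<gamma> \<in> nat_combinations S"
    using \<gamma> T eq nat_combinations_base by blast
  ultimately have "\<gamma> = 0 \<or> \<alpha> = \<gamma>"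
    using nat_combinations_indecomposable[OF S \<alpha>] by fastforce
  then show "\<alpha> \<in> T"
    using \<gamma> T dependent_zero by blast
qed

section \<open>Root systems and conjugacy of simple systems\<close>

text \<open>The norm condition makes the system reduced: it excludes \<open>k \<alpha>\<close> for all \<open>k \<ge> 2\<close>.\<close>

locale root_sys =
  fixes \<Phi> :: "vec set"
  assumes finite_roots: "finite \<Phi>"
    and reflect_root: "\<alpha> \<in> \<Phi> \<Longrightarrow> \<beta> \<in> \<Phi> \<Longrightarrow> reflect \<alpha> \<beta> \<in> \<Phi>"
    and norm_bound: "\<alpha> \<in> \<Phi> \<Longrightarrow> \<beta> \<in> \<Phi> \<Longrightarrow> ip \<beta> \<beta> < 4 * ip \<alpha> \<alpha>"
begin

lemma norm_pos: "\<alpha> \<in> \<Phi> \<Longrightarrow> 0 < ip \<alpha> \<alpha>"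
  using norm_bound[of \<alpha> \<alpha>] by simp

lemma reflect_image: "\<alpha> \<in> \<Phi> \<Longrightarrow> reflect \<alpha> ` \<Phi> = \<Phi>"
  using reflect_root reflect_reflect norm_pos by (metis image_eqI image_subsetI less_irrefl subsetI subset_antisym)

lemma inj_reflect: "\<alpha> \<in> \<Phi> \<Longrightarrow> inj (reflect \<alpha>)"
  using reflect_reflect norm_pos by (metis injI less_irrefl)

lemma neg_root: "\<alpha> \<in> \<Phi> \<Longrightarrow> - \<alpha> \<in> \<Phi>"
  using reflect_root[of \<alpha> \<alpha>] reflect_self norm_pos by (metis less_irrefl)

text \<open>By the norm bound \<open>\<beta>\<close> is not a multiple of \<open>\<alpha>\<close>,
  so it has a positive coefficient at another simple root. Reflection in \<open>\<alpha>\<close>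
  changes only the coefficient at \<open>\<alpha>\<close>, so that positive coefficient survives and
  the image cannot be a negative root.\<close>

lemma reflect_positive:
  assumes S: "simple_roots \<Phi> S" and \<alpha>: "\<alpha> \<in> S" and \<beta>: "\<beta> \<in> \<Phi>" "\<beta> \<in> nat_combinations S" "\<beta> \<noteq> \<alpha>"
  shows "reflect \<alpha> \<beta> \<in> nat_combinations S"
proof -
  have ind: "independent S" and fin: "finite S" and "\<alpha> \<in> \<Phi>"
    using S \<alpha> simple_roots_finite[OF finite_roots S] by (auto simp: simple_roots_def)
  have span: "\<beta> \<in> span S" "\<alpha> \<in> span S"
    using nat_combinations_iff[OF ind fin] \<beta> \<alpha> span_base by blast+
  have nat: "\<forall>\<gamma>\<in>S. scoeff S \<beta> \<gamma> \<in> \<nat>"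
    using nat_combinations_iff[OF ind fin] \<beta> by blast
  have "\<exists>\<gamma>\<in>S. \<gamma> \<noteq> \<alpha> \<and> scoeff S \<beta> \<gamma> \<noteq> 0"
  proof (rule ccontr)
    assume "\<not> ?thesis"
    then have "(\<Sum>\<gamma>\<in>S. scoeff S \<beta> \<gamma> *\<^sub>R \<gamma>) = (\<Sum>\<gamma>\<in>S. if \<gamma> = \<alpha> then scoeff S \<beta> \<alpha> *\<^sub>R \<alpha> else 0)"
      by (intro sum.cong) auto
    then have eq: "\<beta> = scoeff S \<beta> \<alpha> *\<^sub>R \<alpha>"
      using real_vector.sum_representation_eq[OF ind span(1) fin] \<alpha> fin by simp
    obtain n where n: "scoeff S \<beta> \<alpha> = real n"
      using nat \<alpha> Nats_cases by blast
    have "ip \<beta> \<beta> = (real n)\<^sup>2 * ip \<alpha> \<alpha>"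
      using eq n by (metis ip_scaleR_left ip_scaleR_right mult.assoc power2_eq_square)
    then have "(real n)\<^sup>2 < 4" "n \<noteq> 0"
      using norm_bound[OF \<open>\<alpha> \<in> \<Phi>\<close> \<beta>(1)] norm_pos[OF \<open>\<alpha> \<in> \<Phi>\<close>] norm_pos[OF \<beta>(1)]
      by (auto intro!: gr0I)
    then have "(real n)\<^sup>2 < 2\<^sup>2"
      by simp
    then have "real n < 2"
      by (rule power2_less_imp_less) simp
    then have "n = 1"
      using \<open>n \<noteq> 0\<close> by linarith
    then show False
      using eq n \<beta>(3) by simp
  qed
  then obtain \<gamma> where \<gamma>: "\<gamma> \<in> S" "\<gamma> \<noteq> \<alpha>" "scoeff S \<beta> \<gamma> \<noteq> 0"
    by blast
  have "scoeff S (reflect \<alpha> \<beta>) \<gamma> = scoeff S \<beta> \<gamma>"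
    using \<gamma> ind \<alpha> span unfolding reflect_def
    by (simp add: real_vector.representation_diff real_vector.representation_scale
        real_vector.representation_basis span_scale)
  moreover have "0 < scoeff S \<beta> \<gamma>"
    using \<gamma> nat by (metis Nats_cases of_nat_0_le_iff order_le_less)
  ultimately have "\<not> scoeff S (- reflect \<alpha> \<beta>) \<gamma> \<in> \<nat>"
    if "reflect \<alpha> \<beta> \<in> span S"
    using that ind by (metis Nats_cases neg_0_le_iff_le not_le of_nat_0_le_iff real_vector.representation_neg)
  moreover have "reflect \<alpha> \<beta> \<in> span S"
    unfolding reflect_def using span by (intro span_diff span_scale)
  ultimately have "- reflect \<alpha> \<beta> \<notin> nat_combinations S"
    using \<gamma> nat_combinations_iff[OF ind fin] by blast
  then show ?thesis
    using S reflect_root[OF \<open>\<alpha> \<in> \<Phi>\<close> \<beta>(1)] unfolding simple_roots_def by blast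
qed

text \<open>
  Induction on the number of roots that are positive for \<open>S\<close> and negative for \<open>T\<close>: reflecting in
  such a simple root of \<open>S\<close> lowers it.
\<close>

theorem simple_roots_conjugate:
  assumes "simple_roots \<Phi> S" "simple_roots \<Phi> T"
  shows "\<exists>w. linear w \<and> inj w \<and> w ` \<Phi> = \<Phi> \<and> w ` S = T"
  using assms(1)
proof (induction "card {\<beta> \<in> \<Phi>. \<beta> \<in> nat_combinations S \<and> - \<beta> \<in> nat_combinations T}"
    arbitrary: S rule: less_induct)
  case less
  note S = less.prems and T = assms(2)
  let ?N = "\<lambda>S. {\<beta> \<in> \<Phi>. \<beta> \<in> nat_combinations S \<and> - \<beta> \<in> nat_combinations T}"
  have indS: "independent S" "finite S" "S \<subseteq> \<Phi>" and indT: "independent T" "finite T" "T \<subseteq> \<Phi>"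
    using S T simple_roots_finite[OF finite_roots] by (auto simp: simple_roots_def)
  have nonzero: "\<beta> \<noteq> 0" if "\<beta> \<in> \<Phi>" for \<beta>
    using norm_pos[OF that] by auto
  show ?case
  \<comment> \<open>If all of \<open>S\<close> is positive for \<open>T\<close>, no root has
    different signs for the two systems. The monoids then coincide, and with them their
    indecomposable elements.\<close>
  proof (cases "S \<subseteq> nat_combinations T")
    case True
    then have le: "nat_combinations S \<subseteq> nat_combinations T"
      by (rule nat_combinations_subset)
    have "T \<subseteq> nat_combinations S"
    proof
      fix \<beta> assume "\<beta> \<in> T"
      then have "\<beta> \<in> \<Phi>" "\<beta> \<in> nat_combinations T"
        using indT nat_combinations_base by blast+
      then have "- \<beta> \<notin> nat_combinations S"
        using le nat_combinations_antisym[OF indT(1,2)] nonzero by blast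
      then show "\<beta> \<in> nat_combinations S"
        using S \<open>\<beta> \<in> \<Phi>\<close> by (auto simp: simple_roots_def)
    qed
    then have "nat_combinations S = nat_combinations T"
      using le nat_combinations_subset by blast
    then have "S = T"
      using simple_roots_subset indS indT by (metis subset_antisym)
    then show ?thesis
      by (intro exI[of _ id]) (auto simp: linear_id)
  next
    case False
    then obtain \<alpha> where \<alpha>: "\<alpha> \<in> S" "\<alpha> \<notin> nat_combinations T"
      by blast
    then have "\<alpha> \<in> \<Phi>" "- \<alpha> \<in> nat_combinations T" "\<alpha> \<in> nat_combinations S"
      using indS T nat_combinations_base by (auto simp: simple_roots_def)
    let ?s = "reflect \<alpha>"
    have s: "linear ?s" "inj ?s" "?s ` \<Phi> = \<Phi>" "?s (?s x) = x" for x
      using linear_reflect inj_reflect[OF \<open>\<alpha> \<in> \<Phi>\<close>] reflect_image[OF \<open>\<alpha> \<in> \<Phi>\<close>]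
        reflect_reflect[of \<alpha>] nonzero[OF \<open>\<alpha> \<in> \<Phi>\<close>] by simp_all
    have "?s \<alpha> = - \<alpha>"
      using reflect_self nonzero[OF \<open>\<alpha> \<in> \<Phi>\<close>] by simp
    have S': "simple_roots \<Phi> (?s ` S)"
      using simple_roots_image[OF s(1,2) S] s(3) by simp
    have nat: "nat_combinations (?s ` S) = ?s ` nat_combinations S"
      by (rule nat_combinations_image[OF s(1) inj_on_subset[OF s(2) subset_UNIV]])
    \<comment> \<open>By \<open>reflect_positive\<close>, a root counted for the reflected system
      was already counted for \<open>S\<close>. The possible exception \<open>- \<alpha>\<close> is
      not counted, because \<open>\<alpha>\<close> is not positive for \<open>T\<close>; and
      \<open>\<alpha>\<close> itself drops out.\<close>
    have "?N (?s ` S) \<subseteq> ?N S - {\<alpha>}"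
    proof
      fix \<beta> assume \<beta>: "\<beta> \<in> ?N (?s ` S)"
      then have pos: "?s \<beta> \<in> nat_combinations S"
        unfolding nat using s(4) by auto
      have "?s \<beta> \<noteq> \<alpha>"
      proof
        assume "?s \<beta> = \<alpha>"
        then have "\<beta> = - \<alpha>"
          using s(4) \<open>?s \<alpha> = - \<alpha>\<close> by metis
        then show False
          using \<beta> \<alpha> by simp
      qed
      moreover have "?s \<beta> \<in> \<Phi>"
        using \<beta> reflect_root[OF \<open>\<alpha> \<in> \<Phi>\<close>] by simp
      ultimately have "\<beta> \<in> nat_combinations S"
        using reflect_positive[OF S \<alpha>(1) _ pos] s(4) by metis
      moreover have "\<beta> \<noteq> \<alpha>"
        using pos \<open>?s \<alpha> = - \<alpha>\<close> nat_combinations_antisym[OF indS(1,2)] nonzero[OF \<open>\<alpha> \<in> \<Phi>\<close>]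
          \<open>\<alpha> \<in> nat_combinations S\<close> by metis
      ultimately show "\<beta> \<in> ?N S - {\<alpha>}"
        using \<beta> by simp
    qed
    moreover have "\<alpha> \<in> ?N S"
      using \<open>\<alpha> \<in> \<Phi>\<close> \<open>- \<alpha> \<in> nat_combinations T\<close> \<open>\<alpha> \<in> nat_combinations S\<close> by simp
    ultimately have "?N (?s ` S) \<subset> ?N S"
      by blast
    then have "card (?N (?s ` S)) < card (?N S)"
      using finite_roots by (intro psubset_card_mono) auto
    from less.hyps[OF this S'] obtain w where w: "linear w" "inj w" "w ` \<Phi> = \<Phi>" "w ` ?s ` S = T"
      by blast
    show ?thesis
    proof (intro exI conjI)
      show "linear (w \<circ> ?s)"
        using s w linear_compose by blast
      show "inj (w \<circ> ?s)"
        using s w inj_compose by blast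
      show "(w \<circ> ?s) ` \<Phi> = \<Phi>" "(w \<circ> ?s) ` S = T"
        using s(3) w by (simp_all only: image_comp[symmetric])
    qed
  qed
qed

end

lemma of_nat_diff_in_Nats_iff: "real n - real m \<in> \<nat> \<longleftrightarrow> m \<le> n"
proof
  assume "real n - real m \<in> \<nat>"
  then have "0 \<le> real n - real m"
    by (auto elim!: Nats_cases)
  then show "m \<le> n"
    by simp
qed (simp flip: of_nat_diff)

text \<open>The coefficients of a difference of positive roots are automatically integers, so only
  their signs matter.\<close>

lemma simple_root_le_iff:
  assumes \<Phi>: "finite \<Phi>" "simple_roots \<Phi> S" and xy: "x \<in> positive_roots \<Phi> S" "y \<in> positive_roots \<Phi> S"
  shows "root_le S x y \<longleftrightarrow> (\<forall>\<gamma>\<in>S. scoeff S x \<gamma> \<le> scoeff S y \<gamma>)"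
proof -
  have ind: "independent S"
    using \<Phi> by (simp add: simple_roots_def)
  have "z \<in> span S \<and> (\<forall>\<gamma>\<in>S. scoeff S z \<gamma> \<in> \<nat>)" if "z \<in> positive_roots \<Phi> S" for z
    using that simple_roots_nat_combinations_iff[OF \<Phi>, of z] by (simp add: positive_roots_def)
  then have x: "x \<in> span S" "\<forall>\<gamma>\<in>S. scoeff S x \<gamma> \<in> \<nat>" and y: "y \<in> span S" "\<forall>\<gamma>\<in>S. scoeff S y \<gamma> \<in> \<nat>"
    using xy by blast+
  have "scoeff S y \<gamma> - scoeff S x \<gamma> \<in> \<nat> \<longleftrightarrow> scoeff S x \<gamma> \<le> scoeff S y \<gamma>" if "\<gamma> \<in> S" for \<gamma>
  proof -
    have "scoeff S x \<gamma> \<in> \<nat>" "scoeff S y \<gamma> \<in> \<nat>"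
      using x y that by simp_all
    then obtain m n where "scoeff S x \<gamma> = real m" "scoeff S y \<gamma> = real n"
      by (elim Nats_cases)
    then show ?thesis
      by (simp add: of_nat_diff_in_Nats_iff)
  qed
  then show ?thesis
    using x y ind
    unfolding root_le_def simple_roots_nat_combinations_iff[OF \<Phi>]
    by (simp add: span_diff real_vector.representation_diff)
qed

lemma finite_antichain_complex: "finite \<Phi> \<Longrightarrow> finite (antichain_complex \<Phi> S)"
  by (rule finite_subset[of _ "Pow \<Phi>"]) (auto simp: antichain_complex_def positive_roots_def)

lemma simple_roots_antichain:
  assumes "finite \<Phi>" "simple_roots \<Phi> S"
  shows "S \<in> antichain_complex \<Phi> S"
proof -
  have ind: "independent S" and pos: "S \<subseteq> positive_roots \<Phi> S"
    using assms simple_roots_finite[OF assms] nat_combinations_base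
    by (auto simp: simple_roots_def positive_roots_def)
  have "\<alpha> = \<beta>" if "\<alpha> \<in> S" "\<beta> \<in> S" "root_le S \<alpha> \<beta>" for \<alpha> \<beta>
    using that pos simple_root_le_iff[OF assms, of \<alpha> \<beta>] real_vector.representation_basis[OF ind]
    by (force split: if_splits)
  then show ?thesis
    using pos by (simp add: antichain_complex_def)
qed

lemma two_le_card_obtain:
  assumes "2 \<le> card A"
  obtains x y where "x \<in> A" "y \<in> A" "x \<noteq> y"
proof -
  have "finite A"
    using assms by (intro card_ge_0_finite) simp
  then have "\<not> (\<forall>x\<in>A. \<forall>y\<in>A. x = y)"
    using assms card_le_Suc0_iff_eq[of A] by simp
  then show ?thesis
    using that by blast
qed

lemma (in root_sys) shellable_simple_roots:
  assumes "simple_roots \<Phi> T" "shellable (antichain_complex \<Phi> T)" "simple_roots \<Phi> S"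
  shows "shellable (antichain_complex \<Phi> S)"
proof -
  obtain w where w: "linear w" "inj w" "w ` \<Phi> = \<Phi>" "w ` T = S"
    using simple_roots_conjugate[OF assms(1,3)] by blast
  have "antichain_complex \<Phi> S = (`) w ` antichain_complex \<Phi> T"
    using antichain_complex_image[OF w(1,2), of \<Phi> T] w by simp
  then show ?thesis
    using shellable_image[OF inj_on_subset[OF w(2) subset_UNIV] assms(2)] by simp
qed

section \<open>The obstruction in type \<open>D\<^sub>4\<close>\<close>

text \<open>
  \<open>p\<close>, \<open>q\<close>, \<open>r\<close> are the coefficients of the leaves and \<open>c\<close> is the coefficient of the centre of a
  vector of norm 2 in the root lattice of type \<open>D\<^sub>4\<close>.
\<close>

lemma D4_norm_bounds:
  fixes p q r c :: nat
  assumes "p\<^sup>2 + q\<^sup>2 + r\<^sup>2 + c\<^sup>2 = 1 + c * (p + q + r)"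
  shows "c \<le> 2" "p \<le> 2" "q \<le> 2" "r \<le> 2"
proof -
  have "real (p\<^sup>2 + q\<^sup>2 + r\<^sup>2 + c\<^sup>2) = real (1 + c * (p + q + r))"
    using assms by simp
  \<comment> \<open>Completing three squares uses up 3/4 of the square of \<open>c\<close>; the
    remaining quarter is the last term.\<close>
  then have eq: "(real p - c / 2)\<^sup>2 + (real q - c / 2)\<^sup>2 + (real r - c / 2)\<^sup>2 + (c / 2)\<^sup>2 = 1"
    by (simp add: power2_eq_square algebra_simps)
  have sq: "\<bar>x\<bar> \<le> 1" if "x\<^sup>2 \<le> 1" for x :: real
    using that abs_square_le_1 by blast
  have nn: "0 \<le> (real p - c / 2)\<^sup>2" "0 \<le> (real q - c / 2)\<^sup>2" "0 \<le> (real r - c / 2)\<^sup>2" "0 \<le> (real c / 2)\<^sup>2"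
    by simp_all
  have "\<bar>real c / 2\<bar> \<le> 1" "\<bar>real p - c / 2\<bar> \<le> 1" "\<bar>real q - c / 2\<bar> \<le> 1" "\<bar>real r - c / 2\<bar> \<le> 1"
    by (rule sq; use eq nn in linarith)+
  then show "c \<le> 2" "p \<le> 2" "q \<le> 2" "r \<le> 2"
    by linarith+
qed

text \<open>The four inequalities say that the vector is neither below nor above the two roots of
  height three supported on the centre together with \<open>p\<close>, \<open>q\<close> and with
  \<open>p\<close>, \<open>r\<close>. The bounds leave finitely many cases, and only the third root
  of height three survives.\<close>

lemma D4_norm_incomparable:
  fixes p q r c :: nat
  assumes norm: "p\<^sup>2 + q\<^sup>2 + r\<^sup>2 + c\<^sup>2 = 1 + c * (p + q + r)"
    and "2 \<le> p \<or> 2 \<le> q \<or> 1 \<le> r \<or> 2 \<le> c" "2 \<le> p \<or> 1 \<le> q \<or> 2 \<le> r \<or> 2 \<le> c"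
    and "p = 0 \<or> q = 0 \<or> c = 0" "p = 0 \<or> r = 0 \<or> c = 0"
  shows "p = 0 \<and> q = 1 \<and> r = 1 \<and> c = 1"
proof -
  have "c \<in> {0, 1, 2}" "p \<in> {0, 1, 2}" "q \<in> {0, 1, 2}" "r \<in> {0, 1, 2}"
    using D4_norm_bounds[OF norm] by auto
  then show ?thesis
    using assms by (elim insertE emptyE; simp)
qed

text \<open>
  With \<open>c\<close> the centre of a \<open>D\<^sub>4\<close> subdiagram, the link of the remaining simple roots is the complex
  of type \<open>D\<^sub>4\<close>. There the triangle of roots of height three is a facet none of whose edges lies in
  another triangle.
\<close>

theorem (in root_sys) not_shellable_D4:
  assumes norm2: "\<And>\<alpha>. \<alpha> \<in> \<Phi> \<Longrightarrow> ip \<alpha> \<alpha> = 2" and S: "simple_roots \<Phi> S"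
    and mem: "a \<in> S" "b \<in> S" "c \<in> S" "d \<in> S"
    and edges: "ip a c = -1" "ip b c = -1" "ip d c = -1"
    and non_edges: "ip a b = 0" "ip a d = 0" "ip b d = 0"
  shows "\<not> shellable (antichain_complex \<Phi> S)"
proof -
  let ?\<Delta> = "antichain_complex \<Phi> S"
  have ind: "independent S" and fin: "finite S" and sub: "S \<subseteq> \<Phi>"
    using S simple_roots_finite[OF finite_roots S] by (auto simp: simple_roots_def)
  have norms: "ip a a = 2" "ip b b = 2" "ip c c = 2" "ip d d = 2"
    using norm2 mem sub by auto
  have edges': "ip c a = -1" "ip c b = -1" "ip c d = -1" "ip b a = 0" "ip d a = 0" "ip d b = 0"
    using edges non_edges by (simp_all add: ip_commute)
  note ips = norms edges edges' non_edges
  have dist: "a \<noteq> b" "a \<noteq> c" "a \<noteq> d" "b \<noteq> c" "b \<noteq> d" "c \<noteq> d"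
    using norms(1,4) edges non_edges by auto
  \<comment> \<open>The roots of height three, each named after the leaf that it omits.\<close>
  define wa wb wd where "wa = b + d + c" and "wb = a + d + c" and "wd = a + b + c"
  define W where "W = {wa, wb, wd}"
  \<comment> \<open>For inner product -1 and norm 2 the sum is the reflection of \<open>y\<close> in
    \<open>x\<close>.\<close>
  have add: "x + y \<in> \<Phi>" if "x \<in> \<Phi>" "y \<in> \<Phi>" "ip y x = -1" for x y
    using reflect_root[OF that(1,2)] norm2[OF that(1)] that(3) by (simp add: reflect_def add.commute)
  have "d + c \<in> \<Phi>" "b + c \<in> \<Phi>"
    using add[of d c] add[of b c] mem sub ips by auto
  then have "b + (d + c) \<in> \<Phi>" "a + (d + c) \<in> \<Phi>" "a + (b + c) \<in> \<Phi>"
    using add[of b "d + c"] add[of a "d + c"] add[of a "b + c"] mem sub ips by (auto simp: ip_add_left)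
  then have W\<Phi>: "W \<subseteq> \<Phi>"
    by (simp add: W_def wa_def wb_def wd_def add.assoc)
  have "W \<subseteq> nat_combinations S"
    unfolding W_def wa_def wb_def wd_def
    using mem fin by (auto intro: nat_combinations_add nat_combinations_base)
  then have Wpos: "W \<subseteq> positive_roots \<Phi> S"
    using W\<Phi> by (simp add: positive_roots_def)
  have Spos: "S \<subseteq> positive_roots \<Phi> S"
    using sub fin nat_combinations_base by (auto simp: positive_roots_def)
  have basis: "scoeff S x y = (if y = x then 1 else 0)" if "x \<in> S" for x y
    using real_vector.representation_basis[OF ind that] by simp
  have Wcoeff: "scoeff S wa x = (if x \<in> {b, d, c} then 1 else 0)"
    "scoeff S wb x = (if x \<in> {a, d, c} then 1 else 0)"
    "scoeff S wd x = (if x \<in> {a, b, c} then 1 else 0)" for x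
    unfolding wa_def wb_def wd_def using mem dist
    by (auto simp: real_vector.representation_add ind span_base span_add basis)
  define \<rho> where "\<rho> = S - {a, b, c, d}"
  have le: "root_le S x y \<longleftrightarrow> (\<forall>\<gamma>\<in>S. scoeff S x \<gamma> \<le> scoeff S y \<gamma>)"
    if "x \<in> positive_roots \<Phi> S" "y \<in> positive_roots \<Phi> S" for x y
    using simple_root_le_iff[OF finite_roots S that] .
  have Wdist: "wa \<noteq> wb" "wa \<noteq> wd" "wb \<noteq> wd"
    using dist by (auto simp: wa_def wb_def wd_def)
  have W_not_S: "W \<inter> S = {}"
  proof -
    have "\<exists>x y. x \<noteq> y \<and> scoeff S w x = 1 \<and> scoeff S w y = 1" if "w \<in> W" for w
    proof -
      consider "w = wa" | "w = wb" | "w = wd"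
        using \<open>w \<in> W\<close> by (auto simp: W_def)
      then show ?thesis
      proof cases
        case 1
        then show ?thesis
          using dist Wcoeff by (intro exI[of _ b] exI[of _ d]) simp
      next
        case 2
        then show ?thesis
          using dist Wcoeff by (intro exI[of _ a] exI[of _ d]) simp
      next
        case 3
        then show ?thesis
          using dist Wcoeff by (intro exI[of _ a] exI[of _ b]) simp
      qed
    qed
    moreover have "x = s" if "s \<in> S" "scoeff S s x = 1" for s x
      using basis[OF that(1), of x] that(2) by (simp split: if_splits)
    ultimately show ?thesis
      by (metis disjoint_iff)
  qed
  have anti: "\<rho> \<union> W \<in> ?\<Delta>"
  proof -
    have "x = y" if "x \<in> \<rho> \<union> W" "y \<in> \<rho> \<union> W" "root_le S x y" for x y
    proof -
      have "x \<in> positive_roots \<Phi> S" "y \<in> positive_roots \<Phi> S"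
        using that Wpos Spos by (auto simp: \<rho>_def)
      then have coeffs: "\<forall>\<gamma>\<in>S. scoeff S x \<gamma> \<le> scoeff S y \<gamma>"
        using le \<open>root_le S x y\<close> by simp
      have \<rho>c: "scoeff S z \<gamma> = 0" if "z \<in> \<rho>" "\<gamma> \<in> {a, b, c, d}" for z \<gamma>
        using basis[of z \<gamma>] that by (auto simp: \<rho>_def)
      show ?thesis
      proof (cases "x \<in> \<rho>")
        case True
        then have "x \<in> S"
          by (simp add: \<rho>_def)
        then have "scoeff S x x = 1" "scoeff S x x \<le> scoeff S y x"
          using basis[of x x] coeffs by (simp, blast)
        moreover have "scoeff S w x = 0" if "w \<in> W" for w
          using that True Wcoeff[of x] by (auto simp: W_def \<rho>_def)
        moreover have "y \<in> \<rho> \<Longrightarrow> scoeff S y x = (if x = y then 1 else 0)"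
          using basis[of y x] by (simp add: \<rho>_def)
        ultimately show ?thesis
          using \<open>y \<in> \<rho> \<union> W\<close> by (force split: if_splits)
      next
        case False
        then have "x \<in> W"
          using \<open>x \<in> \<rho> \<union> W\<close> by simp
        then have "scoeff S x c = 1"
          using Wcoeff by (auto simp: W_def)
        moreover have ge: "scoeff S x a \<le> scoeff S y a" "scoeff S x b \<le> scoeff S y b"
          "scoeff S x c \<le> scoeff S y c" "scoeff S x d \<le> scoeff S y d"
          using coeffs mem by auto
        ultimately have "y \<notin> \<rho>"
          using \<rho>c[of y c] by auto
        then have "y \<in> W"
          using \<open>y \<in> \<rho> \<union> W\<close> by simp
        with \<open>x \<in> W\<close> ge show ?thesis
          using dist unfolding W_def by (elim insertE emptyE) (simp_all add: Wcoeff)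
      qed
    qed
    moreover have "\<rho> \<union> W \<subseteq> positive_roots \<Phi> S"
      using Wpos Spos by (auto simp: \<rho>_def)
    ultimately show ?thesis
      unfolding antichain_complex_def by simp
  qed
  show ?thesis
  proof (rule not_shellable_if_split[where \<rho> = \<rho> and W = W and A\<^sub>1 = "\<rho> \<union> W" and A\<^sub>2 = S])
    show "finite ?\<Delta>"
      using finite_roots by (rule finite_antichain_complex)
    show "finite A" if "A \<in> ?\<Delta>" for A
    proof (rule finite_subset[OF _ finite_roots])
      show "A \<subseteq> \<Phi>"
        using that by (auto simp: antichain_complex_def positive_roots_def)
    qed
    have "(\<rho> \<union> W) - \<rho> = W"
      using W_not_S by (auto simp: \<rho>_def)
    moreover have "card W = 3"
      using Wdist by (simp add: W_def)
    ultimately show "3 \<le> card (\<rho> \<union> W - \<rho>)"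
      by simp
    show "S \<in> ?\<Delta>"
      using finite_roots S by (rule simple_roots_antichain)
    have "S - \<rho> = {a, b, c, d}"
      using mem by (auto simp: \<rho>_def)
    then show "3 \<le> card (S - \<rho>)"
      using dist by simp
    show "\<not> S \<subseteq> \<rho> \<union> W"
      using mem W_not_S by (auto simp: \<rho>_def)
  next
    fix A assume A: "A \<in> ?\<Delta>" "\<rho> \<subseteq> A" "2 \<le> card (A \<inter> W)"
    then obtain w\<^sub>1 w\<^sub>2 where w: "w\<^sub>1 \<in> A \<inter> W" "w\<^sub>2 \<in> A \<inter> W" "w\<^sub>1 \<noteq> w\<^sub>2"
      by (elim two_le_card_obtain)
    have Apos: "x \<in> positive_roots \<Phi> S" if "x \<in> A" for x
      using A that by (auto simp: antichain_complex_def)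
    have incomp: "\<exists>\<gamma>\<in>S. scoeff S y \<gamma> < scoeff S x \<gamma>" if "x \<in> A" "y \<in> A" "x \<noteq> y" for x y
    proof -
      have "\<not> root_le S x y"
        using A that by (auto simp: antichain_complex_def)
      then show ?thesis
        using le[OF Apos[OF that(1)] Apos[OF that(2)]] by (meson not_le)
    qed
    show "A \<subseteq> \<rho> \<union> W"
    proof
      fix z assume "z \<in> A"
      show "z \<in> \<rho> \<union> W"
      proof (cases "z \<in> \<rho>")
        case False
        have z: "z \<in> \<Phi>" "z \<in> span S" "\<forall>\<gamma>\<in>S. scoeff S z \<gamma> \<in> \<nat>"
          using Apos[OF \<open>z \<in> A\<close>]
          by (auto simp: positive_roots_def simple_roots_nat_combinations_iff[OF finite_roots S])
        then have "\<forall>\<gamma>\<in>S. \<exists>n. scoeff S z \<gamma> = real n"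
          by (auto simp: Nats_def)
        from bchoice[OF this] obtain n where "\<forall>\<gamma>\<in>S. scoeff S z \<gamma> = real (n \<gamma>)" ..
        then have n: "scoeff S z \<gamma> = real (n \<gamma>)" if "\<gamma> \<in> S" for \<gamma>
          using that by simp
        \<comment> \<open>A root that is not above a simple root has coefficient zero there. So the
          vertices of the link are combinations of the four nodes of the D4.\<close>
        have zero: "n \<gamma> = 0" if "\<gamma> \<in> \<rho>" for \<gamma>
        proof -
          have "\<gamma> \<in> S" "\<gamma> \<in> A" "\<gamma> \<noteq> z"
            using that A False by (auto simp: \<rho>_def)
          then obtain \<delta> where "\<delta> \<in> S" "scoeff S z \<delta> < scoeff S \<gamma> \<delta>"
            using incomp[of \<gamma> z] \<open>z \<in> A\<close> by blast
          then show ?thesis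
            using n[of \<delta>] basis[OF \<open>\<gamma> \<in> S\<close>, of \<delta>] by (auto split: if_splits)
        qed
        have "z = (\<Sum>\<gamma>\<in>S. scoeff S z \<gamma> *\<^sub>R \<gamma>)"
          using real_vector.sum_representation_eq[OF ind z(2) fin] by simp
        also have "\<dots> = (\<Sum>\<gamma>\<in>{a, b, c, d}. scoeff S z \<gamma> *\<^sub>R \<gamma>)"
          by (rule sum.mono_neutral_right) (use mem fin n zero in \<open>auto simp: \<rho>_def\<close>)
        finally have z_eq: "z = n a *\<^sub>R a + (n b *\<^sub>R b + (n c *\<^sub>R c + n d *\<^sub>R d))"
          using dist mem n by simp
        \<comment> \<open>In terms of the coefficients, norm 2 is twice the equation required by
          \<open>D4_norm_incomparable\<close>.\<close>
        have "2 = ip z z"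
          using norm2 z by simp
        then have "real (1 + n c * (n a + n b + n d)) = real ((n a)\<^sup>2 + (n b)\<^sup>2 + (n d)\<^sup>2 + (n c)\<^sup>2)"
          unfolding z_eq by (simp add: ip_bilinear ips power2_eq_square algebra_simps)
        then have norm: "(n a)\<^sup>2 + (n b)\<^sup>2 + (n d)\<^sup>2 + (n c)\<^sup>2 = 1 + n c * (n a + n b + n d)"
          by (simp only: of_nat_eq_iff)
        \<comment> \<open>The first conjunct says that \<open>z\<close> is not below
          \<open>w\<close>, the second that it is not above \<open>w\<close>, using that the
          coefficients of \<open>w\<close> are 0 or 1.\<close>
        have not_le: "(2 \<le> n a \<or> 2 \<le> n b \<or> 2 \<le> n c \<or> 2 \<le> n d \<or> (\<exists>\<gamma>\<in>{a, b, c, d}. scoeff S w \<gamma> = 0 \<and> 1 \<le> n \<gamma>)) \<and>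
            (\<exists>\<gamma>\<in>{a, b, c, d}. scoeff S w \<gamma> = 1 \<and> n \<gamma> = 0)"
          if wA: "w \<in> A" and wW: "w \<in> W" and zw: "z \<noteq> w" for w
        proof
          have w01: "scoeff S w \<gamma> = 0 \<or> scoeff S w \<gamma> = 1 \<and> \<gamma> \<in> {a, b, c, d}" for \<gamma>
            using wW by (auto simp: W_def Wcoeff split: if_splits)
          obtain \<gamma> where \<gamma>: "\<gamma> \<in> S" "scoeff S w \<gamma> < scoeff S z \<gamma>"
            using incomp[OF \<open>z \<in> A\<close> wA zw] by blast
          have "\<gamma> \<notin> \<rho>"
            using \<gamma> zero[of \<gamma>] n[of \<gamma>] w01[of \<gamma>] by force
          then have "\<gamma> \<in> {a, b, c, d}"
            using \<gamma>(1) unfolding \<rho>_def by blast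
          moreover have "1 \<le> n \<gamma>" "2 \<le> n \<gamma> \<or> scoeff S w \<gamma> = 0"
            using \<gamma> n[of \<gamma>] w01[of \<gamma>] by auto
          ultimately show "2 \<le> n a \<or> 2 \<le> n b \<or> 2 \<le> n c \<or> 2 \<le> n d \<or> (\<exists>\<gamma>\<in>{a, b, c, d}. scoeff S w \<gamma> = 0 \<and> 1 \<le> n \<gamma>)"
            by blast
          obtain \<gamma> where \<gamma>: "\<gamma> \<in> S" "scoeff S z \<gamma> < scoeff S w \<gamma>"
            using incomp[OF wA \<open>z \<in> A\<close>] zw by blast
          then have "n \<gamma> = 0" "\<gamma> \<in> {a, b, c, d}" "scoeff S w \<gamma> = 1"
            using n[of \<gamma>] w01[of \<gamma>] by auto
          then show "\<exists>\<gamma>\<in>{a, b, c, d}. scoeff S w \<gamma> = 1 \<and> n \<gamma> = 0"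
            by blast
        qed
        have a: "(1 \<le> n a \<or> 2 \<le> n b \<or> 2 \<le> n c \<or> 2 \<le> n d) \<and> (n b = 0 \<or> n c = 0 \<or> n d = 0)" if "wa \<in> A" "z \<noteq> wa"
          using not_le[OF that(1) _ that(2)] dist by (auto simp: W_def Wcoeff)
        have b: "(2 \<le> n a \<or> 1 \<le> n b \<or> 2 \<le> n c \<or> 2 \<le> n d) \<and> (n a = 0 \<or> n c = 0 \<or> n d = 0)" if "wb \<in> A" "z \<noteq> wb"
          using not_le[OF that(1) _ that(2)] dist by (auto simp: W_def Wcoeff)
        have d: "(2 \<le> n a \<or> 2 \<le> n b \<or> 2 \<le> n c \<or> 1 \<le> n d) \<and> (n a = 0 \<or> n b = 0 \<or> n c = 0)" if "wd \<in> A" "z \<noteq> wd"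
          using not_le[OF that(1) _ that(2)] dist by (auto simp: W_def Wcoeff)
        have "z \<in> W"
        proof (rule ccontr)
          assume "z \<notin> W"
          then have ne: "z \<noteq> wa" "z \<noteq> wb" "z \<noteq> wd"
            by (auto simp: W_def)
          have zW: "z = wa" if "n a = 0 \<and> n b = 1 \<and> n d = 1 \<and> n c = 1"
            unfolding z_eq wa_def using that by (simp add: algebra_simps)
          have zW': "z = wb" if "n b = 0 \<and> n a = 1 \<and> n d = 1 \<and> n c = 1"
            unfolding z_eq wb_def using that by (simp add: algebra_simps)
          have zW'': "z = wd" if "n d = 0 \<and> n a = 1 \<and> n b = 1 \<and> n c = 1"
            unfolding z_eq wd_def using that by (simp add: algebra_simps)
          \<comment> \<open>The leaf shared by the two given roots takes the role of
            \<open>p\<close>, and the conclusion identifies \<open>z\<close> with the third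
            root.\<close>
          consider "wa \<in> A" "wb \<in> A" | "wa \<in> A" "wd \<in> A" | "wb \<in> A" "wd \<in> A"
            using w by (auto simp: W_def)
          then show False
          proof cases
            case 1
            have "n d = 0 \<and> n a = 1 \<and> n b = 1 \<and> n c = 1"
              by (rule D4_norm_incomparable) (use norm a[OF 1(1) ne(1)] b[OF 1(2) ne(2)] in \<open>auto simp: algebra_simps\<close>)
            then show ?thesis
              using zW'' ne by blast
          next
            case 2
            have "n b = 0 \<and> n a = 1 \<and> n d = 1 \<and> n c = 1"
              by (rule D4_norm_incomparable) (use norm a[OF 2(1) ne(1)] d[OF 2(2) ne(3)] in \<open>auto simp: algebra_simps\<close>)
            then show ?thesis
              using zW' ne by blast
          next
            case 3
            have "n a = 0 \<and> n b = 1 \<and> n d = 1 \<and> n c = 1"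
              by (rule D4_norm_incomparable) (use norm b[OF 3(1) ne(2)] d[OF 3(2) ne(3)] in \<open>auto simp: algebra_simps\<close>)
            then show ?thesis
              using zW ne by blast
          qed
        qed
        then show ?thesis ..
      qed simp
    qed
  qed (use anti \<rho>_def in auto)
qed

section \<open>Simple systems with dual functionals\<close>

text \<open>The functionals \<open>\<psi>\<close> read off coefficients, which gives independence at
  once and turns the root order into a comparison of numbers.\<close>

locale dual_basis =
  fixes I :: "nat set" and \<alpha> :: "nat \<Rightarrow> vec" and \<psi> :: "nat \<Rightarrow> vec \<Rightarrow> real"
  assumes finite_I: "finite I"
    and linear_\<psi>: "i \<in> I \<Longrightarrow> linear (\<psi> i)"
    and dual: "i \<in> I \<Longrightarrow> j \<in> I \<Longrightarrow> \<psi> i (\<alpha> j) = (if i = j then 1 else 0)"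
begin

lemma inj_\<alpha>: "inj_on \<alpha> I"
  using dual by (metis inj_onI zero_neq_one)

lemma \<psi>_sum: "i \<in> I \<Longrightarrow> \<psi> i (\<Sum>j\<in>I. c j *\<^sub>R \<alpha> j) = c i"
proof -
  assume i: "i \<in> I"
  have "\<psi> i (\<Sum>j\<in>I. c j *\<^sub>R \<alpha> j) = (\<Sum>j\<in>I. c j * \<psi> i (\<alpha> j))"
    using i by (simp add: linear_sum[OF linear_\<psi>] linear_scale[OF linear_\<psi>])
  also have "\<dots> = (\<Sum>j\<in>I. if i = j then c j else 0)"
    by (rule sum.cong) (simp_all add: i dual)
  finally show ?thesis
    using i finite_I by simp
qed

lemma independent_\<alpha>: "independent (\<alpha> ` I)"
proof (rule real_vector.independent_if_scalars_zero)
  fix f x assume sum: "(\<Sum>x\<in>\<alpha> ` I. f x *\<^sub>R x) = 0" and "x \<in> \<alpha> ` I"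
  then obtain i where "i \<in> I" "x = \<alpha> i"
    by blast
  then show "f x = 0"
    using sum \<psi>_sum[of i "\<lambda>j. f (\<alpha> j)"] linear_0[OF linear_\<psi>] by (simp add: sum.reindex[OF inj_\<alpha>])
qed (simp add: finite_I)

lemma nat_combinations_\<alpha>:
  "x \<in> nat_combinations (\<alpha> ` I) \<longleftrightarrow> x = (\<Sum>i\<in>I. \<psi> i x *\<^sub>R \<alpha> i) \<and> (\<forall>i\<in>I. \<psi> i x \<in> \<nat>)"
proof
  assume "x \<in> nat_combinations (\<alpha> ` I)"
  then obtain c where x: "x = (\<Sum>i\<in>I. real (c (\<alpha> i)) *\<^sub>R \<alpha> i)"
    by (auto simp: nat_combinations_def sum.reindex[OF inj_\<alpha>])
  have "\<psi> i x = real (c (\<alpha> i))" if "i \<in> I" for i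
    unfolding x using \<psi>_sum[OF that] .
  then show "x = (\<Sum>i\<in>I. \<psi> i x *\<^sub>R \<alpha> i) \<and> (\<forall>i\<in>I. \<psi> i x \<in> \<nat>)"
    using x by simp
next
  assume *: "x = (\<Sum>i\<in>I. \<psi> i x *\<^sub>R \<alpha> i) \<and> (\<forall>i\<in>I. \<psi> i x \<in> \<nat>)"
  have "\<psi> i x *\<^sub>R \<alpha> i \<in> nat_combinations (\<alpha> ` I)" if i: "i \<in> I" for i
  proof -
    have "\<psi> i x \<in> \<nat>"
      using * i by simp
    then obtain n where "\<psi> i x = real n"
      by (rule Nats_cases)
    then show ?thesis
      using i finite_I by (auto intro: nat_combinations_scale nat_combinations_base)
  qed
  then show "x \<in> nat_combinations (\<alpha> ` I)"
    using * nat_combinations_sum[of I "\<lambda>i. \<psi> i x *\<^sub>R \<alpha> i"] by simp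
qed

lemma simple_roots_\<alpha>:
  assumes "\<alpha> ` I \<subseteq> \<Phi>"
    and "\<And>\<beta>. \<beta> \<in> \<Phi> \<Longrightarrow> \<beta> = (\<Sum>i\<in>I. \<psi> i \<beta> *\<^sub>R \<alpha> i)"
    and "\<And>\<beta>. \<beta> \<in> \<Phi> \<Longrightarrow> (\<forall>i\<in>I. \<psi> i \<beta> \<in> \<nat>) \<or> (\<forall>i\<in>I. - \<psi> i \<beta> \<in> \<nat>)"
  shows "simple_roots \<Phi> (\<alpha> ` I)"
proof -
  have "\<beta> \<in> nat_combinations (\<alpha> ` I) \<or> - \<beta> \<in> nat_combinations (\<alpha> ` I)" if "\<beta> \<in> \<Phi>" for \<beta>
  proof -
    have neg: "\<psi> i (- \<beta>) = - \<psi> i \<beta>" if "i \<in> I" for i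
      using that by (simp add: linear_neg[OF linear_\<psi>])
    have "(\<Sum>i\<in>I. \<psi> i (- \<beta>) *\<^sub>R \<alpha> i) = - (\<Sum>i\<in>I. \<psi> i \<beta> *\<^sub>R \<alpha> i)"
      by (simp add: neg sum_negf)
    then have "- \<beta> = (\<Sum>i\<in>I. \<psi> i (- \<beta>) *\<^sub>R \<alpha> i)"
      using assms(2)[OF that] by simp
    then show ?thesis
      using assms(2,3)[OF that] neg unfolding nat_combinations_\<alpha> by metis
  qed
  then show ?thesis
    using assms(1) independent_\<alpha> by (simp add: simple_roots_def)
qed

text \<open>The positive roots are parametrised by \<open>Q\<close>, and \<open>F k q\<close> is the
  coefficient of \<open>\<alpha> k\<close> in the root at \<open>q\<close>. Excluding zero vectors
  ensures that no root is positive together with its negative.\<close>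

context
  fixes \<Phi> :: "vec set" and Q :: "'q set" and \<beta> :: "'q \<Rightarrow> vec" and F :: "nat \<Rightarrow> 'q \<Rightarrow> nat"
  assumes \<beta>: "\<And>q. q \<in> Q \<Longrightarrow> \<beta> q = (\<Sum>k\<in>I. real (F k q) *\<^sub>R \<alpha> k)"
    and nonzero: "\<And>q. q \<in> Q \<Longrightarrow> \<exists>k\<in>I. F k q \<noteq> 0"
    and \<Phi>: "\<Phi> = \<beta> ` Q \<union> uminus ` \<beta> ` Q"
begin

lemma \<psi>_root: "k \<in> I \<Longrightarrow> q \<in> Q \<Longrightarrow> \<psi> k (\<beta> q) = real (F k q)"
  using \<psi>_sum \<beta> by simp

lemma root_nat_combination: "q \<in> Q \<Longrightarrow> \<beta> q \<in> nat_combinations (\<alpha> ` I)"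
  unfolding nat_combinations_\<alpha> using \<beta> \<psi>_root by simp

lemma simple_roots_coordinates: "\<alpha> ` I \<subseteq> \<Phi> \<Longrightarrow> simple_roots \<Phi> (\<alpha> ` I)"
  using independent_\<alpha> root_nat_combination by (auto simp: simple_roots_def \<Phi>)

lemma positive_roots_coordinates: "positive_roots \<Phi> (\<alpha> ` I) = \<beta> ` Q"
proof -
  have "- \<beta> q \<notin> nat_combinations (\<alpha> ` I)" if q: "q \<in> Q" for q
  proof
    assume "- \<beta> q \<in> nat_combinations (\<alpha> ` I)"
    moreover obtain k where "k \<in> I" "F k q \<noteq> 0"
      using nonzero[OF q] by blast
    ultimately have "- real (F k q) \<in> \<nat>"
      unfolding nat_combinations_\<alpha> using \<psi>_root q by (simp add: linear_neg[OF linear_\<psi>])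
    then have "0 \<le> - real (F k q)"
      by (auto elim!: Nats_cases)
    then show False
      using \<open>F k q \<noteq> 0\<close> by simp
  qed
  then show ?thesis
    using root_nat_combination by (auto simp: positive_roots_def \<Phi>)
qed

lemma root_le_coordinates:
  assumes "p \<in> Q" "q \<in> Q"
  shows "root_le (\<alpha> ` I) (\<beta> p) (\<beta> q) \<longleftrightarrow> (\<forall>k\<in>I. F k p \<le> F k q)"
proof -
  have \<psi>_diff: "\<psi> k (\<beta> q - \<beta> p) = real (F k q) - real (F k p)" if "k \<in> I" for k
    using \<psi>_root that assms by (simp add: linear_diff[OF linear_\<psi>])
  have "(\<Sum>k\<in>I. \<psi> k (\<beta> q - \<beta> p) *\<^sub>R \<alpha> k) = (\<Sum>k\<in>I. real (F k q) *\<^sub>R \<alpha> k - real (F k p) *\<^sub>R \<alpha> k)"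
    by (rule sum.cong) (simp_all add: \<psi>_diff scaleR_left_diff_distrib)
  then have "\<beta> q - \<beta> p = (\<Sum>k\<in>I. \<psi> k (\<beta> q - \<beta> p) *\<^sub>R \<alpha> k)"
    using \<beta> assms by (simp add: sum_subtractf)
  then show ?thesis
    unfolding root_le_def nat_combinations_\<alpha> using \<psi>_diff by (simp add: of_nat_diff_in_Nats_iff)
qed

end

text \<open>Reduces a type to a placement of its positive roots in the plane under which comparison
  of coefficients becomes inclusion of intervals.\<close>

lemma planar:
  assumes \<beta>: "\<And>q. q \<in> Q \<Longrightarrow> \<beta> q = (\<Sum>k\<in>I. real (F k q) *\<^sub>R \<alpha> k)"
    and nonzero: "\<And>q. q \<in> Q \<Longrightarrow> \<exists>k\<in>I. F k q \<noteq> 0"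
    and \<Phi>: "\<Phi> = \<beta> ` Q \<union> uminus ` \<beta> ` Q" and base: "\<alpha> ` I \<subseteq> \<Phi>"
    and order: "\<And>p q. p \<in> Q \<Longrightarrow> q \<in> Q \<Longrightarrow> (\<forall>k\<in>I. F k p \<le> F k q) \<longleftrightarrow> fst q \<le> fst p \<and> snd p \<le> snd q"
    and shell: "shellable (planar_antichains Q)"
  shows "simple_roots \<Phi> (\<alpha> ` I)" "shellable (antichain_complex \<Phi> (\<alpha> ` I))"
proof -
  note coords = \<beta> nonzero \<Phi>
  show "simple_roots \<Phi> (\<alpha> ` I)"
    by (rule simple_roots_coordinates[OF coords base])
  have positive: "positive_roots \<Phi> (\<alpha> ` I) = \<beta> ` Q"
    by (rule positive_roots_coordinates[OF coords])
  have le: "root_le (\<alpha> ` I) (\<beta> p) (\<beta> q) \<longleftrightarrow> fst q \<le> fst p \<and> snd p \<le> snd q" if "p \<in> Q" "q \<in> Q" for p q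
    using root_le_coordinates[OF coords that] order that by simp
  \<comment> \<open>Roots that coincide are comparable both ways, and the planar order is
    antisymmetric.\<close>
  have inj: "inj_on \<beta> Q"
  proof (rule inj_onI)
    fix p q assume pq: "p \<in> Q" "q \<in> Q" "\<beta> p = \<beta> q"
    then have "root_le (\<alpha> ` I) (\<beta> p) (\<beta> q)" "root_le (\<alpha> ` I) (\<beta> q) (\<beta> p)"
      using nat_combinations_0 by (simp_all add: root_le_def)
    then show "p = q"
      using le pq(1,2) by (metis order_antisym prod.expand)
  qed
  have "antichain_complex \<Phi> (\<alpha> ` I) = (`) \<beta> ` planar_antichains Q"
  proof (intro set_eqI iffI)
    fix A assume A: "A \<in> antichain_complex \<Phi> (\<alpha> ` I)"
    then obtain B where B: "A = \<beta> ` B" "B \<subseteq> Q"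
      by (auto simp: antichain_complex_def positive elim: subset_imageE)
    have "p = q" if "p \<in> B" "q \<in> B" "fst q \<le> fst p \<and> snd p \<le> snd q" for p q
    proof -
      have "p \<in> Q" "q \<in> Q"
        using that B by auto
      then have "\<beta> p = \<beta> q"
        using A that B(1) le by (simp add: antichain_complex_def)
      then show ?thesis
        using inj \<open>p \<in> Q\<close> \<open>q \<in> Q\<close> by (simp add: inj_on_eq_iff)
    qed
    then show "A \<in> (`) \<beta> ` planar_antichains Q"
      using B by (auto simp: planar_antichains_def)
  next
    fix A assume "A \<in> (`) \<beta> ` planar_antichains Q"
    then obtain B where "A = \<beta> ` B" "B \<subseteq> Q" "\<forall>p\<in>B. \<forall>q\<in>B. fst q \<le> fst p \<and> snd p \<le> snd q \<longrightarrow> p = q"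
      by (auto simp: planar_antichains_def)
    then show "A \<in> antichain_complex \<Phi> (\<alpha> ` I)"
      using le by (auto simp: antichain_complex_def positive subset_iff)
  qed
  moreover have "inj_on \<beta> (\<Union>(planar_antichains Q))"
    by (rule inj_on_subset[OF inj]) (auto simp: planar_antichains_def)
  ultimately show "shellable (antichain_complex \<Phi> (\<alpha> ` I))"
    using shellable_image shell by simp
qed

end

section \<open>Root systems from lattices\<close>

lemma lookup_e [simp]: "coord (e i) k = (if i = k then 1 else 0)"
  by (simp add: lookup_single when_def)

lemmas lookup_simps = lookup_add lookup_minus lookup_uminus lookup_sum

lemma signs_simps [simp]: "1 \<in> signs" "-1 \<in> signs" "- s \<in> signs \<longleftrightarrow> s \<in> signs" "finite signs"
  by (auto simp: signs_def)

lemma signs_square: "s \<in> signs \<Longrightarrow> s * s = 1"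
  by (auto simp: signs_def)

lemma Ints_signs: "s \<in> signs \<Longrightarrow> s \<in> \<int>"
  by (auto simp: signs_def)

section \<open>Integral vectors of small norm\<close>

definition Zvec :: "nat \<Rightarrow> vec set" where
  "Zvec n = {x. (\<forall>i. coord x i \<in> \<int>) \<and> (\<forall>i. i \<notin> {1..n} \<longrightarrow> coord x i = 0)}"

lemma Zvec_diff: "x \<in> Zvec n \<Longrightarrow> y \<in> Zvec n \<Longrightarrow> x - of_int k *\<^sub>R y \<in> Zvec n"
  by (simp add: Zvec_def lookup_simps)

lemma ip_Zvec: "x \<in> Zvec n \<Longrightarrow> y \<in> Zvec m \<Longrightarrow> ip x y \<in> \<int>"
  by (auto simp: Zvec_def ip_def intro!: Ints_sum Ints_mult)

lemma ip_sum: "x \<in> Zvec n \<Longrightarrow> ip x y = (\<Sum>i=1..n. coord x i * coord y i)"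
  by (rule ip_eq_sum) (auto simp: Zvec_def in_keys_iff)

lemma int_abs_lt_2:
  fixes c :: real
  assumes "c \<in> \<int>" "c \<noteq> 0" "c * c < 4"
  shows "c \<in> signs"
proof -
  obtain m where m: "c = of_int m"
    using assms(1) by (rule Ints_cases)
  have "c\<^sup>2 < 2\<^sup>2"
    using assms(3) by (simp add: power2_eq_square)
  then have "\<bar>c\<bar> < 2"
    using abs_square_less_1 power2_less_imp_less[of "\<bar>c\<bar>" 2] by simp
  then have "\<bar>m\<bar> < 2" "m \<noteq> 0"
    using m assms(2) by linarith+
  then have "m = 1 \<or> m = -1"
    by linarith
  then show ?thesis
    using m by (auto simp: signs_def)
qed

lemma square_le_ip: "coord x i * coord x i \<le> ip x x"
proof (cases "i \<in> Poly_Mapping.keys x")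
  case True
  then show ?thesis
    unfolding ip_def
    by (intro member_le_sum[of i _ "\<lambda>i. coord x i * coord x i"]) auto
qed (simp add: in_keys_iff ip_self_nonneg)

text \<open>Norm below 4 confines all coordinates to -1, 0 and 1, so clearing a non-zero one lowers
  the norm by exactly one. One or two such steps classify the vectors of norm 1 and 2.\<close>

lemma Zvec_peel:
  assumes "x \<in> Zvec n" "ip x x < 4" "x \<noteq> 0"
  obtains i s where "i \<in> {1..n}" "s \<in> signs" "coord x i = s"
    "x - s *\<^sub>R e i \<in> Zvec n" "ip (x - s *\<^sub>R e i) (x - s *\<^sub>R e i) = ip x x - 1"
proof -
  obtain i where i: "coord x i \<noteq> 0"
    using assms(3) by (metis lookup_zero poly_mapping_eqI)
  let ?s = "coord x i"
  have "?s * ?s < 4"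
    using square_le_ip[of x i] assms(2) by linarith
  then have s: "?s \<in> signs"
    using int_abs_lt_2 i assms(1) by (simp add: Zvec_def)
  show ?thesis
  proof (rule that[OF _ s refl])
    show "i \<in> {1..n}"
      using assms(1) i by (auto simp: Zvec_def)
    then show "x - ?s *\<^sub>R e i \<in> Zvec n"
      using assms(1) by (auto simp: Zvec_def lookup_simps)
    show "ip (x - ?s *\<^sub>R e i) (x - ?s *\<^sub>R e i) = ip x x - 1"
      using signs_square[OF s] by (simp add: ip_bilinear lookup_simps)
  qed
qed

lemma Zvec_norm_1:
  assumes "x \<in> Zvec n" "ip x x = 1"
  shows "\<exists>s i. x = s *\<^sub>R e i \<and> s \<in> signs \<and> i \<in> {1..n}"
proof -
  have "x \<noteq> 0" "ip x x < 4"
    using assms(2) by auto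
  from Zvec_peel[OF assms(1) this(2,1)] obtain i s where *: "i \<in> {1..n}" "s \<in> signs"
    "ip (x - s *\<^sub>R e i) (x - s *\<^sub>R e i) = ip x x - 1"
    by metis
  then have "x = s *\<^sub>R e i"
    using assms(2) by simp
  then show ?thesis
    using * by blast
qed

lemma signed_unit_iff: "x \<in> {s *\<^sub>R e i |s i. s \<in> signs \<and> i \<in> {1..n}} \<longleftrightarrow> x \<in> Zvec n \<and> ip x x = 1"
proof
  assume "x \<in> {s *\<^sub>R e i |s i. s \<in> signs \<and> i \<in> {1..n}}"
  then show "x \<in> Zvec n \<and> ip x x = 1"
    by (auto simp: Zvec_def Ints_signs signs_square)
next
  assume "x \<in> Zvec n \<and> ip x x = 1"
  then show "x \<in> {s *\<^sub>R e i |s i. s \<in> signs \<and> i \<in> {1..n}}"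
    using Zvec_norm_1[of x n] by simp
qed

lemma finite_signed_units: "finite {s *\<^sub>R e i |s i. s \<in> signs \<and> i \<in> {1..n}}"
proof (rule finite_subset)
  show "{s *\<^sub>R e i |s i. s \<in> signs \<and> i \<in> {1..n}} \<subseteq> (\<lambda>(s, i). s *\<^sub>R e i) ` (signs \<times> {1..n})"
    by auto
qed simp

lemma Zvec_norm_2:
  assumes "x \<in> Zvec n" "ip x x = 2"
  shows "x \<in> roots_D n"
proof -
  have "x \<noteq> 0" "ip x x < 4"
    using assms(2) by auto
  from Zvec_peel[OF assms(1) this(2,1)] obtain i s where i: "i \<in> {1..n}" "s \<in> signs"
    "coord x i = s" "x - s *\<^sub>R e i \<in> Zvec n" "ip (x - s *\<^sub>R e i) (x - s *\<^sub>R e i) = ip x x - 1"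
    by metis
  from Zvec_norm_1[OF i(4)] obtain j t where j: "j \<in> {1..n}" "t \<in> signs" "x - s *\<^sub>R e i = t *\<^sub>R e j"
    using i(5) assms(2) by fastforce
  have x: "x = s *\<^sub>R e i + t *\<^sub>R e j"
    using j(3) by (simp add: algebra_simps)
  \<comment> \<open>The first step has already cleared coordinate \<open>i\<close>, so a second step
    at the same place would have \<open>t = 0\<close>.\<close>
  have "i \<noteq> j"
  proof
    assume "i = j"
    then have "t = 0"
      using arg_cong[OF x, of "\<lambda>x. coord x i"] i(3) by (simp add: lookup_simps)
    then show False
      using j(2) by (simp add: signs_def)
  qed
  then consider "i < j" | "j < i"
    by linarith
  then show ?thesis
  proof cases
    case 1
    then show ?thesis
      using x i j unfolding roots_D_def by auto
  next
    case 2
    have "x = t *\<^sub>R e j + s *\<^sub>R e i"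
      using x by (simp add: add.commute)
    then show ?thesis
      using 2 i j unfolding roots_D_def by auto
  qed
qed

lemma roots_D_iff: "x \<in> roots_D n \<longleftrightarrow> x \<in> Zvec n \<and> ip x x = 2"
proof
  assume "x \<in> roots_D n"
  then obtain s t i j where x: "x = s *\<^sub>R e i + t *\<^sub>R e j" "s \<in> signs" "t \<in> signs" "1 \<le> i" "i < j" "j \<le> n"
    unfolding roots_D_def by auto
  then have "ip x x = 2"
    using signs_square[of s] signs_square[of t] by (simp add: ip_bilinear lookup_simps)
  moreover have "x \<in> Zvec n"
    using x by (auto simp: Zvec_def lookup_simps Ints_signs)
  ultimately show "x \<in> Zvec n \<and> ip x x = 2"
    by simp
qed (use Zvec_norm_2 in blast)

lemma finite_roots_D: "finite (roots_D n)"
proof (rule finite_subset)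
  show "roots_D n \<subseteq> (\<lambda>(s, t, i, j). s *\<^sub>R e i + t *\<^sub>R e j) ` (signs \<times> signs \<times> {1..n} \<times> {1..n})"
    unfolding roots_D_def by force
qed simp

text \<open>A reflection subtracts an integral multiple of a lattice vector and preserves the norm,
  so a set cut out of a lattice by its norms is closed under reflections.\<close>

lemma root_sys_lattice:
  assumes "finite \<Phi>" and \<Phi>: "\<And>x. x \<in> \<Phi> \<longleftrightarrow> x \<in> L \<and> ip x x \<in> N"
    and L: "\<And>x y k. x \<in> L \<Longrightarrow> y \<in> L \<Longrightarrow> x - of_int k *\<^sub>R y \<in> L"
    and cartan: "\<And>\<alpha> \<beta>. \<alpha> \<in> \<Phi> \<Longrightarrow> \<beta> \<in> \<Phi> \<Longrightarrow> 2 * ip \<beta> \<alpha> / ip \<alpha> \<alpha> \<in> \<int>"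
    and N: "\<And>a b. a \<in> N \<Longrightarrow> b \<in> N \<Longrightarrow> b < 4 * a"
  shows "root_sys \<Phi>"
proof
  fix \<alpha> \<beta> assume *: "\<alpha> \<in> \<Phi>" "\<beta> \<in> \<Phi>"
  show "ip \<beta> \<beta> < 4 * ip \<alpha> \<alpha>"
    using * N \<Phi> by blast
  have "ip \<alpha> \<alpha> \<noteq> 0"
    using N[of "ip \<alpha> \<alpha>" "ip \<alpha> \<alpha>"] * \<Phi> by auto
  moreover obtain k where "2 * ip \<beta> \<alpha> / ip \<alpha> \<alpha> = of_int k"
    using cartan[OF *] by (rule Ints_cases)
  ultimately show "reflect \<alpha> \<beta> \<in> \<Phi>"
    using * L[of \<beta> \<alpha> k] ip_reflect[of \<alpha> \<beta>] unfolding \<Phi> by (simp add: reflect_def)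
qed fact

text \<open>The reflected vector is a combination of the two roots and stays in the subspace. This
  yields E7 and E6 from E8.\<close>

lemma root_sys_inter_subspace:
  assumes "root_sys \<Phi>" "subspace U"
  shows "root_sys (\<Phi> \<inter> U)"
proof -
  interpret root_sys \<Phi> by fact
  show ?thesis
    using finite_roots reflect_root norm_bound assms(2)
    by unfold_locales (auto simp: reflect_def subspace_diff subspace_scale)
qed

section \<open>The root systems of types D, B, A and G2\<close>

lemma root_sys_D: "root_sys (roots_D n)"
proof (rule root_sys_lattice[where L = "Zvec n" and N = "{2}"])
  show "2 * ip \<beta> \<alpha> / ip \<alpha> \<alpha> \<in> \<int>" if "\<alpha> \<in> roots_D n" "\<beta> \<in> roots_D n" for \<alpha> \<beta>
    using that ip_Zvec by (auto simp: roots_D_iff)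
qed (auto simp: roots_D_iff finite_roots_D Zvec_diff)

lemma root_sys_B: "root_sys (root_system (Type_B n))"
proof -
  have iff: "x \<in> root_system (Type_B n) \<longleftrightarrow> x \<in> Zvec n \<and> ip x x \<in> {1, 2}" for x
    using signed_unit_iff[of x n] roots_D_iff[of x n] unfolding root_system.simps by blast
  show ?thesis
  proof (rule root_sys_lattice[where L = "Zvec n" and N = "{1, 2}"])
    show "finite (root_system (Type_B n))"
      using finite_roots_D finite_signed_units by simp
    show "2 * ip \<beta> \<alpha> / ip \<alpha> \<alpha> \<in> \<int>" if "\<alpha> \<in> root_system (Type_B n)" "\<beta> \<in> root_system (Type_B n)" for \<alpha> \<beta>
      using that ip_Zvec[of \<beta> n \<alpha> n] unfolding iff by auto
  qed (auto simp: iff Zvec_diff simp del: root_system.simps)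
qed

text \<open>The root lattice of type A of rank n - 1. For n = 3 its vectors of norm 2 and 6 are the
  roots of G2.\<close>

definition Zvec0 :: "nat \<Rightarrow> vec set" where
  "Zvec0 n = {x \<in> Zvec n. (\<Sum>i=1..n. coord x i) = 0}"

lemma Zvec0_diff: "x \<in> Zvec0 n \<Longrightarrow> y \<in> Zvec0 n \<Longrightarrow> x - of_int k *\<^sub>R y \<in> Zvec0 n"
  by (auto simp: Zvec0_def Zvec_diff lookup_simps sum_subtractf sum_distrib_left[symmetric])

lemma sum_lookup_e: "i \<in> {1..n} \<Longrightarrow> (\<Sum>k=1..n. coord (c *\<^sub>R e i) k) = c"
  by (simp add: if_distrib cong: if_cong)

lemma difference_roots_iff:
  "x \<in> {e i - e j | i j. i \<in> {1..n} \<and> j \<in> {1..n} \<and> i \<noteq> j} \<longleftrightarrow> x \<in> Zvec0 n \<and> ip x x = 2"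
proof
  assume "x \<in> {e i - e j | i j. i \<in> {1..n} \<and> j \<in> {1..n} \<and> i \<noteq> j}"
  then obtain i j where *: "x = e i - e j" "i \<in> {1..n}" "j \<in> {1..n}" "i \<noteq> j"
    by blast
  then show "x \<in> Zvec0 n \<and> ip x x = 2"
    by (auto simp: Zvec0_def Zvec_def lookup_simps ip_bilinear sum_subtractf)
next
  assume *: "x \<in> Zvec0 n \<and> ip x x = 2"
  then have "x \<in> roots_D n"
    by (simp add: roots_D_iff Zvec0_def)
  then obtain s t i j where x: "x = s *\<^sub>R e i + t *\<^sub>R e j" "s \<in> signs" "t \<in> signs" "1 \<le> i" "i < j" "j \<le> n"
    unfolding roots_D_def by auto
  have "(\<Sum>k=1..n. coord x k) = s + t"
    unfolding x(1) lookup_add sum.distrib using x by (subst (1 2) sum_lookup_e) auto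
  then have "t = - s"
    using * by (simp add: Zvec0_def)
  moreover have "s = 1 \<or> s = -1"
    using x by (auto simp: signs_def)
  ultimately have "x = e i - e j \<or> x = e j - e i"
    using x by auto
  then show "x \<in> {e i - e j | i j. i \<in> {1..n} \<and> j \<in> {1..n} \<and> i \<noteq> j}"
    using x by fastforce
qed

lemma finite_difference_roots: "finite {e i - e j | i j. i \<in> {1..n} \<and> j \<in> {1..n} \<and> i \<noteq> j}"
proof (rule finite_subset)
  show "{e i - e j | i j. i \<in> {1..n} \<and> j \<in> {1..n} \<and> i \<noteq> j} \<subseteq> (\<lambda>(i, j). e i - e j) ` ({1..n} \<times> {1..n})"
    by auto
qed simp

lemma root_sys_A: "root_sys (root_system (Type_A n))"
proof -
  have iff: "x \<in> root_system (Type_A n) \<longleftrightarrow> x \<in> Zvec0 (n + 1) \<and> ip x x \<in> {2}" for x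
    using difference_roots_iff[of x "n + 1"] unfolding root_system.simps by simp
  show ?thesis
  proof (rule root_sys_lattice[where L = "Zvec0 (n + 1)" and N = "{2}"])
    show "finite (root_system (Type_A n))"
      using finite_difference_roots[of "n + 1"] by simp
    show "2 * ip \<beta> \<alpha> / ip \<alpha> \<alpha> \<in> \<int>" if "\<alpha> \<in> root_system (Type_A n)" "\<beta> \<in> root_system (Type_A n)" for \<alpha> \<beta>
      using that ip_Zvec[of \<beta> "n + 1" \<alpha> "n + 1"] unfolding iff Zvec0_def by auto
  qed (auto simp: iff Zvec0_diff simp del: root_system.simps)
qed

lemma atLeastAtMost_1_3: "{1..3::nat} = {1, 2, 3}"
  by auto

lemma Zvec_eqI:
  assumes "x \<in> Zvec n" "y \<in> Zvec n" "\<And>i. i \<in> {1..n} \<Longrightarrow> coord x i = coord y i"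
  shows "x = y"
proof (rule poly_mapping_eqI)
  fix i
  show "coord x i = coord y i"
    by (cases "i \<in> {1..n}") (use assms in \<open>simp_all add: Zvec_def\<close>)
qed

text \<open>As the coordinates sum to zero, two of them determine the vector. Norm 6 bounds them by
  2 in absolute value, and six pairs remain.\<close>

lemma G2_long_iff:
  "x \<in> {s *\<^sub>R (2 *\<^sub>R e i - e j - e k) | s i j k. s \<in> signs \<and> {i, j, k} = {1..3}} \<longleftrightarrow> x \<in> Zvec0 3 \<and> ip x x = 6"
    (is "x \<in> ?L \<longleftrightarrow> _")
proof
  assume "x \<in> ?L"
  then obtain s i j k where x: "x = s *\<^sub>R (2 *\<^sub>R e i - e j - e k)" "s \<in> signs" "{i, j, k} = {1..3}"
    by blast
  have "card {i, j, k} = 3"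
    using x(3) by simp
  then have dist: "i \<noteq> j" "i \<noteq> k" "j \<noteq> k"
    by (auto simp: card_insert_if split: if_splits)
  have range: "i \<in> {1..3}" "j \<in> {1..3}" "k \<in> {1..3}"
    unfolding x(3)[symmetric] by simp_all
  have "ip x x = (s * s) * 6"
    using dist by (simp add: x(1) ip_bilinear lookup_simps)
  moreover have "x \<in> Zvec 3"
    using dist range x(2) by (auto simp: x(1) Zvec_def lookup_simps Ints_signs)
  moreover have "(\<Sum>i=1..3. coord x i) = 0"
    using dist unfolding x(3)[symmetric] by (simp add: x(1) lookup_simps)
  ultimately show "x \<in> Zvec0 3 \<and> ip x x = 6"
    using signs_square[OF x(2)] by (simp add: Zvec0_def)
next
  assume *: "x \<in> Zvec0 3 \<and> ip x x = 6"
  then have x: "x \<in> Zvec 3" "coord x 1 + coord x 2 + coord x 3 = 0"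
    unfolding Zvec0_def atLeastAtMost_1_3 by (simp_all add: add.assoc)
  obtain m1 m2 where m: "coord x 1 = of_int m1" "coord x 2 = of_int m2"
    using x(1) by (auto simp: Zvec_def elim!: Ints_cases) (metis Ints_cases)
  then have m3: "coord x 3 = of_int (- m1 - m2)"
    using x(2) by simp
  have "ip x x = real_of_int (m1 * m1 + m2 * m2 + (- m1 - m2) * (- m1 - m2))"
    unfolding ip_sum[OF x(1)] atLeastAtMost_1_3 by (simp add: m[simplified] m3[simplified])
  then have norm: "m1 * m1 + m2 * m2 + (- m1 - m2) * (- m1 - m2) = 6"
    using * by (metis of_int_eq_iff of_int_numeral)
  have bound: "c \<in> {-2, -1, 0, 1, 2}" if "c * c \<le> 6" for c :: int
  proof -
    have "\<bar>c\<bar> < 3"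
    proof (rule ccontr)
      assume "\<not> \<bar>c\<bar> < 3"
      then have "3 * 3 \<le> \<bar>c\<bar> * \<bar>c\<bar>"
        by (intro mult_mono) auto
      then show False
        using that by simp
    qed
    then show ?thesis
      by auto
  qed
  have "0 \<le> m1 * m1" "0 \<le> m2 * m2" "0 \<le> (- m1 - m2) * (- m1 - m2)"
    by simp_all
  then have "m1 \<in> {-2, -1, 0, 1, 2}" "m2 \<in> {-2, -1, 0, 1, 2}"
    using norm by (intro bound; linarith)+
  then have "(m1, m2) \<in> {(2, -1), (-2, 1), (1, 1), (-1, -1), (1, -2), (-1, 2)}"
    using norm by (elim insertE emptyE; simp)
  moreover have "x \<in> ?L" if "s \<in> signs" "{i, j, k} = {1..3}"
    "\<forall>l\<in>{1, 2, 3}. coord x l = s * (2 * (if i = l then 1 else 0) - (if j = l then 1 else 0) - (if k = l then 1 else 0))" for s i j k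
  proof -
    have range: "i \<in> {1..3}" "j \<in> {1..3}" "k \<in> {1..3}"
      unfolding that(2)[symmetric] by simp_all
    let ?y = "s *\<^sub>R (2 *\<^sub>R e i - e j - e k)"
    have "x = ?y"
    proof (rule Zvec_eqI[OF x(1)])
      show "?y \<in> Zvec 3"
        using range that(1) by (auto simp: Zvec_def lookup_simps Ints_signs)
      fix l assume "l \<in> {1..3::nat}"
      then have "l \<in> {1, 2, 3}"
        unfolding atLeastAtMost_1_3 .
      from that(3)[rule_format, OF this] show "coord x l = coord ?y l"
        by (simp only: lookup_simps lookup_scaleR lookup_e real_scaleR_def)
    qed
    then show ?thesis
      using that(1,2) by blast
  qed
  note this[of 1 1 2 3] this[of "-1" 1 2 3] this[of 1 2 1 3] this[of "-1" 2 1 3] this[of 1 3 1 2] this[of "-1" 3 1 2]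
  ultimately show "x \<in> ?L"
    unfolding atLeastAtMost_1_3 by (elim insertE emptyE) (use m m3 in \<open>auto simp: insert_commute\<close>)
qed

lemma root_sys_G2: "root_sys (root_system Type_G2)"
proof -
  have iff: "x \<in> root_system Type_G2 \<longleftrightarrow> x \<in> Zvec0 3 \<and> ip x x \<in> {2, 6}" for x
    using difference_roots_iff[of x 3] G2_long_iff[of x] unfolding root_system.simps by blast
  show ?thesis
  proof (rule root_sys_lattice[where L = "Zvec0 3" and N = "{2, 6}"])
    have "{s *\<^sub>R (2 *\<^sub>R e i - e j - e k) | s i j k. s \<in> signs \<and> {i, j, k} = {1..3}} \<subseteq>
      (\<lambda>(s, i, j, k). s *\<^sub>R (2 *\<^sub>R e i - e j - e k)) ` (signs \<times> {1..3} \<times> {1..3} \<times> {1..3})"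
    proof
      fix x assume "x \<in> {s *\<^sub>R (2 *\<^sub>R e i - e j - e k) | s i j k. s \<in> signs \<and> {i, j, k} = {1..3}}"
      then obtain s i j k where x: "x = s *\<^sub>R (2 *\<^sub>R e i - e j - e k)" "s \<in> signs" "{i, j, k} = {1..3}"
        by blast
      have "i \<in> {1..3}" "j \<in> {1..3}" "k \<in> {1..3}"
        unfolding x(3)[symmetric] by simp_all
      then show "x \<in> (\<lambda>(s, i, j, k). s *\<^sub>R (2 *\<^sub>R e i - e j - e k)) ` (signs \<times> {1..3} \<times> {1..3} \<times> {1..3})"
        using x by (intro image_eqI[of _ _ "(s, i, j, k)"]) simp_all
    qed
    then have "finite {s *\<^sub>R (2 *\<^sub>R e i - e j - e k) | s i j k. s \<in> signs \<and> {i, j, k} = {1..3}}"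
      by (rule finite_subset) simp
    then show "finite (root_system Type_G2)"
      using finite_difference_roots[of 3] by simp
    show "2 * ip \<beta> \<alpha> / ip \<alpha> \<alpha> \<in> \<int>"
      if mem: "\<alpha> \<in> root_system Type_G2" "\<beta> \<in> root_system Type_G2" for \<alpha> \<beta>
    proof (cases "ip \<alpha> \<alpha> = 2")
      case True
      then show ?thesis
        using mem ip_Zvec[of \<beta> 3 \<alpha> 3] unfolding iff Zvec0_def by auto
    next
      case False
      then obtain s i j k where \<alpha>: "\<alpha> = s *\<^sub>R (2 *\<^sub>R e i - e j - e k)" "s \<in> signs" "{i, j, k} = {1..3}"
        using mem(1) G2_long_iff[of \<alpha>] iff[of \<alpha>] by blast
      have "card {i, j, k} = 3"
        using \<alpha>(3) by simp
      then have dist: "i \<noteq> j" "i \<noteq> k" "j \<noteq> k"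
        by (auto simp: card_insert_if split: if_splits)
      have \<beta>: "\<beta> \<in> Zvec 3" "(\<Sum>l\<in>{i, j, k}. coord \<beta> l) = 0"
        using mem(2) unfolding iff Zvec0_def \<alpha>(3) by simp_all
      \<comment> \<open>With coordinate sum zero the product with a long root is 3 times a signed
        coordinate of \<open>\<beta>\<close>, so twice it is divisible by the norm 6.\<close>
      then have k: "coord \<beta> k = - coord \<beta> i - coord \<beta> j"
        using dist by (simp add: algebra_simps)
      have "ip \<beta> \<alpha> = 3 * (s * coord \<beta> i)"
        by (simp add: \<alpha>(1) ip_bilinear k algebra_simps)
      moreover have "ip \<alpha> \<alpha> = 6"
        using False mem(1) iff by auto
      moreover have "s * coord \<beta> i \<in> \<int>"
        using \<beta>(1) Ints_signs[OF \<alpha>(2)] by (simp add: Zvec_def)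
      ultimately show ?thesis
        by simp
    qed
  qed (auto simp: iff Zvec0_diff simp del: root_system.simps)
qed

section \<open>The shellable types\<close>

text \<open>Finitely supported functions form a ring under convolution, and simplification may
  collect equal summands into a product with a numeral. Such a product is still a scalar
  multiple.\<close>

lemma lookup_numeral_mult: "coord (numeral m * x) k = numeral m * coord (x::vec) k"
proof -
  have "coord (of_nat n * x) k = of_nat n * coord x k" for n
    by (induction n) (simp_all add: distrib_right lookup_add)
  from this[of "numeral m"] show ?thesis
    by simp
qed

text \<open>The partial sums are the functionals dual to the differences of consecutive unit
  vectors.\<close>

definition psum :: "nat \<Rightarrow> vec \<Rightarrow> real" where
  "psum k x = (\<Sum>i=1..k. coord x i)"

lemma linear_psum: "linear (psum k)"
  by (rule linearI) (simp_all add: psum_def lookup_simps sum.distrib sum_distrib_left)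

lemma psum_simps [simp]:
  "psum k (x + y) = psum k x + psum k y" "psum k (x - y) = psum k x - psum k y"
  "psum k (c *\<^sub>R x) = c * psum k x" "psum k (- x) = - psum k x" "psum k 0 = 0"
  using linear_psum[of k]
  by (simp_all add: linear_add linear_diff linear_scale linear_neg linear_0)

lemma psum_e [simp]: "psum k (e i) = (if 1 \<le> i \<and> i \<le> k then 1 else 0)"
  by (simp add: psum_def)

lemma sum_Icc_telescope:
  fixes f :: "nat \<Rightarrow> 'a::ab_group_add"
  shows "i \<le> Suc m \<Longrightarrow> (\<Sum>k=i..m. f k - f (Suc k)) = f i - f (Suc m)"
proof (induction m)
  case 0
  then show ?case
    by (cases "i = 0") (auto simp: le_Suc_eq)
next
  case (Suc m)
  then show ?case
    by (cases "i \<le> Suc m") (auto simp: le_Suc_eq)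
qed

text \<open>
  Coefficients of the positive root at the point \<open>(i, J)\<close>: for \<open>J \<le> n\<close> it is the sum of the simple
  roots from \<open>i\<close> to \<open>J\<close>, and for \<open>J > n\<close> (type B only) those from \<open>2n + 1 - J\<close> onwards count twice.
\<close>

definition Bcoeff :: "nat \<Rightarrow> nat \<Rightarrow> nat \<times> nat \<Rightarrow> nat" where
  "Bcoeff n k q = of_bool (fst q \<le> k \<and> k \<le> snd q) + of_bool (2 * n + 1 \<le> k + snd q)"

text \<open>Each end of the interval is detected at one index: the left end at \<open>fst p\<close>,
  the right end at \<open>snd p\<close> if that is at most \<open>n\<close>, and otherwise at
  \<open>2 * n + 1 - snd p\<close>, the first index where the coefficient is two.\<close>

lemma Bcoeff_order:
  assumes p: "1 \<le> fst p" "fst p \<le> snd p" "fst p + snd p \<le> 2 * n"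
    and q: "1 \<le> fst q" "fst q \<le> snd q" "fst q + snd q \<le> 2 * n"
  shows "(\<forall>k\<in>{1..n}. Bcoeff n k p \<le> Bcoeff n k q) \<longleftrightarrow> fst q \<le> fst p \<and> snd p \<le> snd q"
proof
  assume *: "\<forall>k\<in>{1..n}. Bcoeff n k p \<le> Bcoeff n k q"
  have "Bcoeff n (fst p) p \<le> Bcoeff n (fst p) q"
    using * p by auto
  then have 1: "fst q \<le> fst p"
    using p q by (auto simp: Bcoeff_def of_bool_def split: if_splits)
  have 2: "snd p \<le> snd q"
  proof (cases "snd p \<le> n")
    case True
    then have "Bcoeff n (snd p) p \<le> Bcoeff n (snd p) q"
      using * p by auto
    then show ?thesis
      using p q True by (auto simp: Bcoeff_def of_bool_def split: if_splits)
  next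
    case False
    then have "2 * n + 1 - snd p \<in> {1..n}"
      using p by auto
    with * have "Bcoeff n (2 * n + 1 - snd p) p \<le> Bcoeff n (2 * n + 1 - snd p) q"
      by blast
    moreover have "Bcoeff n (2 * n + 1 - snd p) p = 2"
      using p False by (auto simp: Bcoeff_def)
    ultimately have "2 * n + 1 \<le> (2 * n + 1 - snd p) + snd q"
      by (auto simp: Bcoeff_def of_bool_def split: if_splits)
    then show ?thesis
      using p by linarith
  qed
  show "fst q \<le> fst p \<and> snd p \<le> snd q"
    using 1 2 ..
qed (auto simp: Bcoeff_def)

text \<open>The indices with coefficient at least one and those with coefficient two form two
  intervals, and each sum telescopes. \<open>E\<close> is left open because types A and B differ
  only in whether \<open>E (Suc n)\<close> is a unit vector or zero.\<close>

lemma Bcoeff_sum: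
  fixes E :: "nat \<Rightarrow> vec"
  assumes "1 \<le> i" "i \<le> J" "i + J \<le> 2 * n"
  shows "(\<Sum>k\<in>{1..n}. real (Bcoeff n k (i, J)) *\<^sub>R (E k - E (Suc k))) =
    E i - E (Suc (min J n)) + (if J \<le> n then 0 else E (2 * n + 1 - J) - E (Suc n))"
proof -
  let ?\<alpha> = "\<lambda>k. E k - E (Suc k)"
  have "(\<Sum>k\<in>{1..n}. real (Bcoeff n k (i, J)) *\<^sub>R ?\<alpha> k) =
      (\<Sum>k\<in>{1..n}. (if k \<in> {i..min J n} then ?\<alpha> k else 0)) +
      (\<Sum>k\<in>{1..n}. (if k \<in> {2 * n + 1 - J..n} then ?\<alpha> k else 0))"
    unfolding sum.distrib[symmetric]
    by (rule sum.cong) (use assms in \<open>auto simp: Bcoeff_def scaleR_2\<close>)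
  also have "(\<Sum>k\<in>{1..n}. (if k \<in> {i..min J n} then ?\<alpha> k else 0)) = (\<Sum>k=i..min J n. ?\<alpha> k)"
    using assms by (subst sum.inter_restrict[symmetric]) (auto intro!: sum.cong)
  also have "\<dots> = E i - E (Suc (min J n))"
    using assms by (intro sum_Icc_telescope) auto
  also have "(\<Sum>k\<in>{1..n}. (if k \<in> {2 * n + 1 - J..n} then ?\<alpha> k else 0)) = (\<Sum>k=2 * n + 1 - J..n. ?\<alpha> k)"
    using assms by (subst sum.inter_restrict[symmetric]) (auto intro!: sum.cong)
  also have "\<dots> = (if J \<le> n then 0 else E (2 * n + 1 - J) - E (Suc n))"
    using assms by (auto intro: sum_Icc_telescope)
  finally show ?thesis .
qed

lemma shellable_A:
  "simple_roots (root_system (Type_A n)) ((\<lambda>k. e k - e (Suc k)) ` {1..n})"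
  "shellable (antichain_complex (root_system (Type_A n)) ((\<lambda>k. e k - e (Suc k)) ` {1..n}))"
proof -
  interpret dual_basis "{1..n}" "\<lambda>k. e k - e (Suc k)" psum
    by unfold_locales (auto simp: linear_psum)
  define Q where "Q = {(i, j). 1 \<le> i \<and> i \<le> j \<and> j \<le> n}"
  define \<beta> :: "nat \<times> nat \<Rightarrow> vec" where "\<beta> q = e (fst q) - e (Suc (snd q))" for q
  have eq: "\<beta> q = (\<Sum>k\<in>{1..n}. real (Bcoeff n k q) *\<^sub>R (e k - e (Suc k)))" if "q \<in> Q" for q
    using that Bcoeff_sum[of "fst q" "snd q" n e] by (auto simp: Q_def \<beta>_def min_def)
  have nonzero: "\<exists>k\<in>{1..n}. Bcoeff n k q \<noteq> 0" if "q \<in> Q" for q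
    using that by (intro bexI[of _ "fst q"]) (auto simp: Q_def Bcoeff_def)
  have \<Phi>: "root_system (Type_A n) = \<beta> ` Q \<union> uminus ` \<beta> ` Q"
  proof (intro set_eqI iffI)
    fix x assume "x \<in> root_system (Type_A n)"
    then obtain i j where x: "x = e i - e j" "i \<in> {1..n+1}" "j \<in> {1..n+1}" "i \<noteq> j"
      by auto
    then consider "i < j" | "j < i"
      by linarith
    then show "x \<in> \<beta> ` Q \<union> uminus ` \<beta> ` Q"
    proof cases
      case 1
      then have "x = \<beta> (i, j - 1)" "(i, j - 1) \<in> Q"
        using x by (auto simp: \<beta>_def Q_def)
      then show ?thesis
        by blast
    next
      case 2
      then have "x = - \<beta> (j, i - 1)" "(j, i - 1) \<in> Q"
        using x by (auto simp: \<beta>_def Q_def)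
      then show ?thesis
        by blast
    qed
  next
    fix x assume "x \<in> \<beta> ` Q \<union> uminus ` \<beta> ` Q"
    then obtain i j where "(i, j) \<in> Q" "x = e i - e (Suc j) \<or> x = e (Suc j) - e i"
      by (auto simp: \<beta>_def)
    then show "x \<in> root_system (Type_A n)"
      by (auto simp: Q_def) force+
  qed
  have base: "(\<lambda>k. e k - e (Suc k)) ` {1..n} \<subseteq> root_system (Type_A n)"
    by force
  have order: "(\<forall>k\<in>{1..n}. Bcoeff n k p \<le> Bcoeff n k q) \<longleftrightarrow> fst q \<le> fst p \<and> snd p \<le> snd q"
    if "p \<in> Q" "q \<in> Q" for p q
    using that by (intro Bcoeff_order) (auto simp: Q_def)
  have "finite Q"
    by (rule finite_subset[of _ "{1..n} \<times> {1..n}"]) (auto simp: Q_def)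
  then have shell: "shellable (planar_antichains Q)"
    by (rule planar_shellable) (auto simp: Q_def)
  note pl = planar[where \<beta> = \<beta> and Q = Q and F = "Bcoeff n", OF eq nonzero \<Phi> base order shell]
  show "simple_roots (root_system (Type_A n)) ((\<lambda>k. e k - e (Suc k)) ` {1..n})"
    by (rule pl(1))
  show "shellable (antichain_complex (root_system (Type_A n)) ((\<lambda>k. e k - e (Suc k)) ` {1..n}))"
    by (rule pl(2))
qed

text \<open>Truncating the unit vectors beyond \<open>n\<close> writes the last simple root
  \<open>e n\<close> as a difference too, so the telescoping of type A applies.\<close>

lemma shellable_B:
  defines "E \<equiv> \<lambda>n k. if k \<le> n then e k else 0"
  shows "simple_roots (root_system (Type_B n)) ((\<lambda>k. E n k - E n (Suc k)) ` {1..n})"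
  "shellable (antichain_complex (root_system (Type_B n)) ((\<lambda>k. E n k - E n (Suc k)) ` {1..n}))"
proof -
  let ?\<alpha> = "\<lambda>k. E n k - E n (Suc k)"
  interpret dual_basis "{1..n}" ?\<alpha> psum
    by unfold_locales (auto simp: linear_psum E_def)
  \<comment> \<open>One interval from each orbit of the flip k -> 2n - k on the intervals in 1, ...,
    2n - 1.\<close>
  define Q where "Q = {(i, j). 1 \<le> i \<and> i \<le> j \<and> i + j \<le> 2 * n}"
  define \<beta> :: "nat \<times> nat \<Rightarrow> vec" where
    "\<beta> q = e (fst q) + (if snd q < n then - e (Suc (snd q)) else if snd q = n then 0 else e (2 * n + 1 - snd q))" for q
  have eq: "\<beta> q = (\<Sum>k\<in>{1..n}. real (Bcoeff n k q) *\<^sub>R ?\<alpha> k)" if "q \<in> Q" for q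
    using that Bcoeff_sum[of "fst q" "snd q" n "E n"] by (auto simp: Q_def \<beta>_def min_def E_def)
  have nonzero: "\<exists>k\<in>{1..n}. Bcoeff n k q \<noteq> 0" if "q \<in> Q" for q
    using that by (intro bexI[of _ "fst q"]) (auto simp: Q_def Bcoeff_def)
  have cases: "x \<in> \<beta> ` Q \<union> uminus ` \<beta> ` Q" if "q \<in> Q" "x = \<beta> q \<or> x = - \<beta> q" for x q
    using that by blast
  have \<Phi>: "root_system (Type_B n) = \<beta> ` Q \<union> uminus ` \<beta> ` Q"
  proof (intro set_eqI iffI)
    fix x assume "x \<in> root_system (Type_B n)"
    then consider (D) s t i j where "x = s *\<^sub>R e i + t *\<^sub>R e j" "s \<in> signs" "t \<in> signs" "1 \<le> i" "i < j" "j \<le> n"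
      | (unit) s i where "x = s *\<^sub>R e i" "s \<in> signs" "1 \<le> i" "i \<le> n"
      by (auto simp: roots_D_def)
    then show "x \<in> \<beta> ` Q \<union> uminus ` \<beta> ` Q"
    proof cases
      case D
      show ?thesis
      proof (cases "s = t")
        case True
        then show ?thesis
          using D by (intro cases[of "(i, 2 * n + 1 - j)"]) (auto simp: Q_def \<beta>_def signs_def)
      next
        case False
        then show ?thesis
          using D by (intro cases[of "(i, j - 1)"]) (auto simp: Q_def \<beta>_def signs_def)
      qed
    next
      case unit
      then show ?thesis
        by (intro cases[of "(i, n)"]) (auto simp: Q_def \<beta>_def signs_def)
    qed
  next
    have neg: "- x \<in> root_system (Type_B n)" if "x \<in> root_system (Type_B n)" for x
      using root_sys.neg_root[OF root_sys_B that] .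
    have D: "s *\<^sub>R e i + t *\<^sub>R e j \<in> root_system (Type_B n)"
      if "s \<in> signs" "t \<in> signs" "1 \<le> i" "i < j" "j \<le> n" for s t i j
      using that by (auto simp: roots_D_def)
    have "\<beta> q \<in> root_system (Type_B n)" if "q \<in> Q" for q
    proof -
      obtain i j where q: "q = (i, j)" "1 \<le> i" "i \<le> j" "i + j \<le> 2 * n"
        using \<open>q \<in> Q\<close> by (auto simp: Q_def)
      consider "j < n" | "j = n" | "n < j"
        by linarith
      then show ?thesis
      proof cases
        case 1
        then show ?thesis
          using D[of 1 "-1" i "Suc j"] q by (simp add: \<beta>_def)
      next
        case 2
        then have "\<beta> q = 1 *\<^sub>R e i" "i \<in> {1..n}"
          using q by (auto simp: \<beta>_def)
        then show ?thesis
          unfolding root_system.simps using signs_simps(1) by blast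
      next
        case 3
        then show ?thesis
          using D[of 1 1 i "2 * n + 1 - j"] q by (simp add: \<beta>_def)
      qed
    qed
    then show "x \<in> root_system (Type_B n)" if "x \<in> \<beta> ` Q \<union> uminus ` \<beta> ` Q" for x
      using that neg by blast
  qed
  have base: "?\<alpha> ` {1..n} \<subseteq> root_system (Type_B n)"
  proof
    fix x assume "x \<in> ?\<alpha> ` {1..n}"
    then obtain k where k: "k \<in> {1..n}" "x = ?\<alpha> k"
      by blast
    have "x = \<beta> (k, k)" "(k, k) \<in> Q"
      using k by (auto simp: E_def \<beta>_def Q_def)
    then show "x \<in> root_system (Type_B n)"
      unfolding \<Phi> by blast
  qed
  have order: "(\<forall>k\<in>{1..n}. Bcoeff n k p \<le> Bcoeff n k q) \<longleftrightarrow> fst q \<le> fst p \<and> snd p \<le> snd q"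
    if "p \<in> Q" "q \<in> Q" for p q
    using that by (intro Bcoeff_order) (auto simp: Q_def)
  have "finite Q"
    by (rule finite_subset[of _ "{..2 * n} \<times> {..2 * n}"]) (auto simp: Q_def)
  then have shell: "shellable (planar_antichains Q)"
    by (rule planar_shellable) (auto simp: Q_def)
  note pl = planar[where \<beta> = \<beta> and Q = Q and F = "Bcoeff n", OF eq nonzero \<Phi> base order shell]
  show "simple_roots (root_system (Type_B n)) (?\<alpha> ` {1..n})"
    by (rule pl(1))
  show "shellable (antichain_complex (root_system (Type_B n)) (?\<alpha> ` {1..n}))"
    by (rule pl(2))
qed

text \<open>The diagram is the path of A3 with \<open>e 1 - e 2\<close> in the middle. The numbering
  follows the path, so the positive roots are again sums over intervals of simple roots.\<close>

lemma shellable_D3: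
  defines "\<alpha> \<equiv> \<lambda>k::nat. if k = 1 then e 2 - e 3 else if k = 2 then e 1 - e 2 else e 2 + e 3"
  shows "simple_roots (root_system (Type_D 3)) (\<alpha> ` {1, 2, 3})"
  "shellable (antichain_complex (root_system (Type_D 3)) (\<alpha> ` {1, 2, 3}))"
proof -
  let ?x = coord
  define \<psi> where "\<psi> = (\<lambda>k::nat. \<lambda>x. if k = 1 then (?x x 1 + ?x x 2 - ?x x 3) / 2 else if k = 2 then ?x x 1
    else (?x x 1 + ?x x 2 + ?x x 3) / 2)"
  interpret dual_basis "{1, 2, 3}" \<alpha> \<psi>
    by unfold_locales (auto simp: \<psi>_def \<alpha>_def lookup_simps add_divide_distrib diff_divide_distrib
        right_diff_distrib distrib_left intro!: linearI)
  define Q :: "(nat \<times> nat) set" where "Q = {(1, 1), (2, 2), (3, 3), (1, 2), (2, 3), (1, 3)}"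
  define F where "F k q = (of_bool (fst q \<le> k \<and> k \<le> snd q) :: nat)" for k :: nat and q
  define \<beta> where "\<beta> q = (\<Sum>k\<in>{1, 2, 3}. real (F k q) *\<^sub>R \<alpha> k)" for q
  have \<beta>s: "\<beta> (1, 1) = e 2 - e 3" "\<beta> (2, 2) = e 1 - e 2" "\<beta> (3, 3) = e 2 + e 3"
    "\<beta> (1, 2) = e 1 - e 3" "\<beta> (2, 3) = e 1 + e 3" "\<beta> (1, 3) = e 1 + e 2"
    by (simp_all add: \<beta>_def F_def \<alpha>_def)
  have \<beta>Q: "\<beta> ` Q = {e 2 - e 3, e 1 - e 2, e 2 + e 3, e 1 - e 3, e 1 + e 3, e 1 + e 2}"
    by (simp only: Q_def image_insert \<beta>s image_empty)
  have \<Phi>: "root_system (Type_D 3) = \<beta> ` Q \<union> uminus ` \<beta> ` Q"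
  proof (intro set_eqI iffI)
    fix x assume "x \<in> root_system (Type_D 3)"
    then obtain s t i j where x: "x = s *\<^sub>R e i + t *\<^sub>R e j" "s \<in> signs" "t \<in> signs" "1 \<le> i" "i < j" "j \<le> 3"
      by (auto simp: roots_D_def)
    then have "i = 1 \<and> j = 2 \<or> i = 1 \<and> j = 3 \<or> i = 2 \<and> j = 3" "s = 1 \<or> s = -1" "t = 1 \<or> t = -1"
      by (auto simp: signs_def)
    then show "x \<in> \<beta> ` Q \<union> uminus ` \<beta> ` Q"
      unfolding \<beta>Q x(1) by (elim disjE conjE) simp_all
  next
    have D: "s *\<^sub>R e i + t *\<^sub>R e j \<in> root_system (Type_D 3)"
      if "s \<in> signs" "t \<in> signs" "1 \<le> i" "i < j" "j \<le> 3" for s t i j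
      using that by (auto simp: roots_D_def)
    have "\<beta> ` Q \<subseteq> root_system (Type_D 3)"
      unfolding \<beta>Q using D[of 1 1 1 2] D[of 1 "-1" 1 2] D[of 1 1 1 3] D[of 1 "-1" 1 3] D[of 1 1 2 3] D[of 1 "-1" 2 3]
      by simp
    then show "x \<in> root_system (Type_D 3)" if "x \<in> \<beta> ` Q \<union> uminus ` \<beta> ` Q" for x
      using that root_sys.neg_root[OF root_sys_D, of _ 3] by auto
  qed
  have base: "\<alpha> ` {1, 2, 3} \<subseteq> root_system (Type_D 3)"
    unfolding \<Phi> \<beta>Q by (simp add: \<alpha>_def)
  have nonzero: "\<exists>k\<in>{1, 2, 3}. F k q \<noteq> 0" if "q \<in> Q" for q
    using that by (auto simp: Q_def F_def)
  have order: "(\<forall>k\<in>{1, 2, 3}. F k p \<le> F k q) \<longleftrightarrow> fst q \<le> fst p \<and> snd p \<le> snd q"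
    if "p \<in> Q" "q \<in> Q" for p q
    using that unfolding Q_def by (elim insertE emptyE) (simp_all add: F_def)
  have shell: "shellable (planar_antichains Q)"
    by (rule planar_shellable) (auto simp: Q_def)
  note pl = planar[where \<beta> = \<beta> and Q = Q and F = F, OF \<beta>_def nonzero \<Phi> base order shell]
  show "simple_roots (root_system (Type_D 3)) (\<alpha> ` {1, 2, 3})"
    by (rule pl(1))
  show "shellable (antichain_complex (root_system (Type_D 3)) (\<alpha> ` {1, 2, 3}))"
    by (rule pl(2))
qed

lemma shellable_G2:
  defines "\<alpha> \<equiv> \<lambda>k::nat. if k = 1 then e 1 - e 2 else - 2 *\<^sub>R e 1 + e 2 + e 3"
  shows "simple_roots (root_system Type_G2) (\<alpha> ` {1, 2})"
  "shellable (antichain_complex (root_system Type_G2) (\<alpha> ` {1, 2}))"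
proof -
  let ?x = coord
  define \<psi> where "\<psi> = (\<lambda>k::nat. \<lambda>x. if k = 1 then ?x x 1 + 2 * ?x x 3 else ?x x 3)"
  interpret dual_basis "{1, 2}" \<alpha> \<psi>
    by unfold_locales (auto simp: \<psi>_def \<alpha>_def lookup_simps right_diff_distrib distrib_left intro!: linearI)
  \<comment> \<open>Two minimal points \<open>(1, 1)\<close> and \<open>(2, 2)\<close> below the
    chain from \<open>(1, 2)\<close> to \<open>(1, 5)\<close>.\<close>
  define Q :: "(nat \<times> nat) set" where "Q = {(1, 1), (2, 2), (1, 2), (1, 3), (1, 4), (1, 5)}"
  \<comment> \<open>In the order listed in \<open>Q\<close>, the coefficients of the short and the
    long simple root are (1,0), (0,1), (1,1), (2,1), (3,1), (3,2).\<close>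
  define F :: "nat \<Rightarrow> nat \<times> nat \<Rightarrow> nat" where
    "F k q = (if k = 1 then if fst q = 2 then 0 else min 3 (max 1 (snd q - 1)) else if snd q = 1 then 0 else if snd q = 5 then 2 else 1)" for k q
  define \<beta> where "\<beta> q = (\<Sum>k\<in>{1, 2}. real (F k q) *\<^sub>R \<alpha> k)" for q
  have \<beta>s: "\<beta> (1, 1) = e 1 - e 2" "\<beta> (2, 2) = - 1 *\<^sub>R (2 *\<^sub>R e 1 - e 2 - e 3)" "\<beta> (1, 2) = e 3 - e 1"
    "\<beta> (1, 3) = e 3 - e 2" "\<beta> (1, 4) = - 1 *\<^sub>R (2 *\<^sub>R e 2 - e 1 - e 3)" "\<beta> (1, 5) = 1 *\<^sub>R (2 *\<^sub>R e 3 - e 1 - e 2)"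
    by (auto simp: \<beta>_def F_def \<alpha>_def lookup_simps lookup_numeral_mult intro!: poly_mapping_eqI)
  have \<beta>Q: "\<beta> ` Q = {e 1 - e 2, - 1 *\<^sub>R (2 *\<^sub>R e 1 - e 2 - e 3), e 3 - e 1, e 3 - e 2,
      - 1 *\<^sub>R (2 *\<^sub>R e 2 - e 1 - e 3), 1 *\<^sub>R (2 *\<^sub>R e 3 - e 1 - e 2)}"
    by (simp only: Q_def image_insert \<beta>s image_empty)
  have \<Phi>: "root_system Type_G2 = \<beta> ` Q \<union> uminus ` \<beta> ` Q"
  proof (intro set_eqI iffI)
    fix x assume "x \<in> root_system Type_G2"
    then consider (short) i j where "x = e i - e j" "i \<in> {1..3}" "j \<in> {1..3}" "i \<noteq> j"
      | (long) s i j k where "x = s *\<^sub>R (2 *\<^sub>R e i - e j - e k)" "s \<in> signs" "{i, j, k} = {1..3}"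
      by auto
    then show "x \<in> \<beta> ` Q \<union> uminus ` \<beta> ` Q"
    proof cases
      case short
      then have "i \<in> {1, 2, 3}" "j \<in> {1, 2, 3}"
        unfolding atLeastAtMost_1_3 by blast+
      then show ?thesis
        using short(4) unfolding \<beta>Q short(1) by (elim insertE emptyE) simp_all
    next
      case long
      have "i \<in> {1..3}" "j \<in> {1..3}" "k \<in> {1..3}"
        unfolding long(3)[symmetric] by simp_all
      then have ijk: "i \<in> {1, 2, 3}" "j \<in> {1, 2, 3}" "k \<in> {1, 2, 3}"
        unfolding atLeastAtMost_1_3 by blast+
      have "card {i, j, k} = 3"
        using long(3) by simp
      then have dist: "i \<noteq> j" "i \<noteq> k" "j \<noteq> k"
        by (auto simp: card_insert_if split: if_splits)
      have "s = 1 \<or> s = -1"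
        using long(2) by (auto simp: signs_def)
      then show ?thesis
        using ijk dist unfolding \<beta>Q long(1) by (elim insertE emptyE disjE) (simp_all add: algebra_simps)
    qed
  next
    have short: "e i - e j \<in> root_system Type_G2" if "i \<in> {1..3}" "j \<in> {1..3}" "i \<noteq> j" for i j
      using that by auto
    have long: "s *\<^sub>R (2 *\<^sub>R e i - e j - e k) \<in> root_system Type_G2" if "s \<in> signs" "{i, j, k} = {1..3}" for s i j k
      using that by auto
    have perm: "{1, 2, 3} = {1..3::nat}" "{2, 1, 3} = {1..3::nat}" "{3, 1, 2} = {1..3::nat}"
      by auto
    have "e 1 - e 2 \<in> root_system Type_G2" "e 3 - e 1 \<in> root_system Type_G2" "e 3 - e 2 \<in> root_system Type_G2"
      by (rule short; simp)+
    moreover have "- 1 *\<^sub>R (2 *\<^sub>R e 1 - e 2 - e 3) \<in> root_system Type_G2"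
      "- 1 *\<^sub>R (2 *\<^sub>R e 2 - e 1 - e 3) \<in> root_system Type_G2"
      "1 *\<^sub>R (2 *\<^sub>R e 3 - e 1 - e 2) \<in> root_system Type_G2"
      by (rule long; use perm in simp)+
    ultimately have "\<beta> ` Q \<subseteq> root_system Type_G2"
      unfolding \<beta>Q by (simp only: insert_subset empty_subsetI simp_thms)
    then show "x \<in> root_system Type_G2" if "x \<in> \<beta> ` Q \<union> uminus ` \<beta> ` Q" for x
      using that root_sys.neg_root[OF root_sys_G2] by blast
  qed
  have base: "\<alpha> ` {1, 2} \<subseteq> root_system Type_G2"
    unfolding \<Phi> \<beta>Q by (simp add: \<alpha>_def)
  have nonzero: "\<exists>k\<in>{1, 2}. F k q \<noteq> 0" if "q \<in> Q" for q
    using that by (auto simp: Q_def F_def)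
  have order: "(\<forall>k\<in>{1, 2}. F k p \<le> F k q) \<longleftrightarrow> fst q \<le> fst p \<and> snd p \<le> snd q"
    if "p \<in> Q" "q \<in> Q" for p q
    using that unfolding Q_def by (elim insertE emptyE) (simp_all add: F_def)
  have shell: "shellable (planar_antichains Q)"
    by (rule planar_shellable) (auto simp: Q_def)
  note pl = planar[where \<beta> = \<beta> and Q = Q and F = F, OF \<beta>_def nonzero \<Phi> base order shell]
  show "simple_roots (root_system Type_G2) (\<alpha> ` {1, 2})"
    by (rule pl(1))
  show "shellable (antichain_complex (root_system Type_G2) (\<alpha> ` {1, 2}))"
    by (rule pl(2))
qed

section \<open>The types \<open>D\<^sub>n\<close>\<close>

lemma (in root_sys) not_shellable_simple_roots:
  assumes "simple_roots \<Phi> T" "\<not> shellable (antichain_complex \<Phi> T)" "simple_roots \<Phi> S"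
  shows "\<not> shellable (antichain_complex \<Phi> S)"
  using shellable_simple_roots assms by blast

theorem not_shellable_D:
  assumes n: "4 \<le> n" and S: "simple_roots (root_system (Type_D n)) S"
  shows "\<not> shellable (antichain_complex (root_system (Type_D n)) S)"
proof -
  define \<alpha> where "\<alpha> k = (if k < n then e k - e (Suc k) else e (n - 1) + e n)" for k
  \<comment> \<open>The fundamental weights: partial sums along the path, and half-sums (the spin
    weights) at the two ends \<open>n - 1\<close> and \<open>n\<close> of the fork.\<close>
  define \<psi> where "\<psi> k x = (if k + 2 \<le> n then psum k x
    else if k = n - 1 then (1 / 2) * (psum (n - 1) x - coord x n) else (1 / 2) * psum n x)" for k x
  interpret root_sys "roots_D n"
    by (rule root_sys_D)
  interpret dual_basis "{1..n}" \<alpha> \<psi>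
  proof (rule dual_basis.intro)
    show "linear (\<psi> i)" if "i \<in> {1..n}" for i
      unfolding \<psi>_def by (rule linearI) (simp_all add: lookup_simps algebra_simps)
    show "\<psi> i (\<alpha> j) = (if i = j then 1 else 0)" if "i \<in> {1..n}" "j \<in> {1..n}" for i j
      using that n by (auto simp: \<psi>_def \<alpha>_def lookup_simps)
  qed simp
  let ?N = "nat_combinations (\<alpha> ` {1..n})"
  have \<alpha>N: "\<alpha> k \<in> ?N" if "k \<in> {1..n}" for k
    using that by (intro nat_combinations_base) auto
  have diff: "e i - e j \<in> ?N" if "1 \<le> i" "i \<le> j" "j \<le> n" for i j
  proof (cases "i = j")
    case False
    then have "e i - e j = (\<Sum>k=i..j-1. e k - e (Suc k))"
      using that by (subst sum_Icc_telescope) auto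
    also have "\<dots> = (\<Sum>k=i..j-1. \<alpha> k)"
      by (rule sum.cong) (use that False in \<open>auto simp: \<alpha>_def\<close>)
    also have "\<dots> \<in> ?N"
      by (rule nat_combinations_sum, rule \<alpha>N) (use that False in auto)
    finally show ?thesis .
  qed (simp add: nat_combinations_0)
  have sum: "e i + e j \<in> ?N" if "1 \<le> i" "i < j" "j \<le> n" for i j
  proof -
    have "e i + e j = (e i - e (n - 1)) + ((e j - e n) + \<alpha> n)"
      by (simp add: \<alpha>_def)
    also have "\<dots> \<in> ?N"
      using that n by (intro nat_combinations_add diff \<alpha>N) auto
    finally show ?thesis .
  qed
  have simple: "simple_roots (roots_D n) (\<alpha> ` {1..n})"
    unfolding simple_roots_def
  proof (intro conjI ballI)
    have D: "s *\<^sub>R e i + t *\<^sub>R e j \<in> roots_D n"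
      if "s \<in> signs" "t \<in> signs" "1 \<le> i" "i < j" "j \<le> n" for s t i j
      using that by (auto simp: roots_D_def)
    have "\<alpha> k \<in> roots_D n" if "k \<in> {1..n}" for k
      using that n D[of 1 "-1" k "Suc k"] D[of 1 1 "n - 1" n] by (simp add: \<alpha>_def)
    then show "\<alpha> ` {1..n} \<subseteq> roots_D n"
      by blast
    show "independent (\<alpha> ` {1..n})"
      by (rule independent_\<alpha>)
    fix \<beta> assume "\<beta> \<in> roots_D n"
    then obtain s t i j where \<beta>: "\<beta> = s *\<^sub>R e i + t *\<^sub>R e j" "s \<in> signs" "t \<in> signs" "1 \<le> i" "i < j" "j \<le> n"
      unfolding roots_D_def by auto
    have "s = 1 \<or> s = -1" "t = 1 \<or> t = -1"
      using \<beta> by (auto simp: signs_def)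
    then have "\<beta> = e i + e j \<or> \<beta> = e i - e j \<or> - \<beta> = e i - e j \<or> - \<beta> = e i + e j"
      using \<beta>(1) by auto
    then show "\<beta> \<in> ?N \<or> - \<beta> \<in> ?N"
      using diff[of i j] sum[of i j] \<beta> by auto
  qed
  obtain m where m: "n = m + 4"
    using n by (metis add.commute le_Suc_ex)
  have "\<not> shellable (antichain_complex (roots_D n) (\<alpha> ` {1..n}))"
  \<comment> \<open>The last four nodes form a D4 with centre \<open>n - 2\<close>, here
    \<open>m + 2\<close>.\<close>
  proof (rule not_shellable_D4[where a = "\<alpha> (m + 1)" and b = "\<alpha> (m + 3)" and c = "\<alpha> (m + 2)" and d = "\<alpha> (m + 4)",
        OF _ simple])
    show "ip x x = 2" if "x \<in> roots_D n" for x
      using that by (simp add: roots_D_iff)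
    show "\<alpha> (m + 1) \<in> \<alpha> ` {1..n}" "\<alpha> (m + 3) \<in> \<alpha> ` {1..n}" "\<alpha> (m + 2) \<in> \<alpha> ` {1..n}" "\<alpha> (m + 4) \<in> \<alpha> ` {1..n}"
      using m by auto
  qed (simp_all add: \<alpha>_def m ip_bilinear lookup_simps)
  then show ?thesis
    using not_shellable_simple_roots[OF simple] S by simp
qed

section \<open>The types \<open>E\<^sub>6\<close>, \<open>E\<^sub>7\<close> and \<open>E\<^sub>8\<close>\<close>

lemma lookup_sum_e: "coord (\<Sum>i=1..n. s i *\<^sub>R e i) k = (if k \<in> {1..n} then s k else 0)"
proof -
  have "coord (\<Sum>i=1..n. s i *\<^sub>R e i) k = (\<Sum>i=1..n. if k = i then s k else 0)"
    unfolding lookup_sum by (rule sum.cong) auto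
  then show ?thesis
    by simp
qed

text \<open>The number \<open>k\<close> counts the negative signs.\<close>

lemma sum_prod_signs:
  assumes "finite A" "\<forall>i\<in>A. s i \<in> signs"
  shows "\<exists>k. (\<Sum>i\<in>A. s i) = real (card A) - 2 * real k \<and> (\<Prod>i\<in>A. s i) = (-1) ^ k"
  using assms
proof (induction A rule: finite_induct)
  case empty
  then show ?case
    by (intro exI[of _ 0]) simp
next
  case (insert a A)
  then obtain k where k: "(\<Sum>i\<in>A. s i) = real (card A) - 2 * real k" "(\<Prod>i\<in>A. s i) = (-1) ^ k"
    by auto
  have "s a = 1 \<or> s a = -1"
    using insert.prems by (auto simp: signs_def)
  then show ?case
  proof
    assume "s a = 1"
    then show ?thesis
      using insert.hyps k by (intro exI[of _ k]) simp
  next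
    assume "s a = -1"
    then show ?thesis
      using insert.hyps k by (intro exI[of _ "Suc k"]) simp
  qed
qed

text \<open>With k negative signs the sum is 8 - 2k, divisible by 4 exactly for even k. The product
  condition on half-integral roots thus becomes a linear congruence, as needed for a
  lattice.\<close>

lemma signs_product_8:
  assumes "\<forall>i\<in>{1..8::nat}. s i \<in> signs"
  shows "(\<Prod>i=1..8. s i) = 1 \<longleftrightarrow> (\<Sum>i=1..8. s i) / 4 \<in> \<int>"
proof -
  obtain k where k: "(\<Sum>i=1..8. s i) = 8 - 2 * real k" "(\<Prod>i=1..8. s i) = (-1) ^ k"
    using sum_prod_signs[OF _ assms] by auto
  have "(8 - 2 * real k) / 4 \<in> \<int> \<longleftrightarrow> even k"
  proof
    assume "(8 - 2 * real k) / 4 \<in> \<int>"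
    then obtain z where "(8 - 2 * real k) / 4 = of_int z"
      by (rule Ints_cases)
    then have "real_of_int (int k) = of_int (4 - 2 * z)"
      by simp
    then have "int k = 4 - 2 * z"
      by (simp only: of_int_eq_iff)
    then show "even k"
      by presburger
  next
    assume "even k"
    then obtain l where "k = 2 * l" ..
    then have "(8 - 2 * real k) / 4 = of_int (2 - int l)"
      by simp
    then show "(8 - 2 * real k) / 4 \<in> \<int>"
      by (metis Ints_of_int)
  qed
  moreover have "(-1) ^ k = (1::real) \<longleftrightarrow> even k"
    by (cases "even k") simp_all
  ultimately show ?thesis
    using k by simp
qed

text \<open>Coordinates all integral or all half-integral, with even sum. Integrality of the
  differences to coordinate 8 expresses the alternative linearly, so that closure under subtraction
  requires no case split.\<close>

definition E8_lattice :: "vec set" where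
  "E8_lattice = {x. (\<forall>i. i \<notin> {1..8} \<longrightarrow> coord x i = 0) \<and>
     (\<forall>i. 2 * coord x i \<in> \<int>) \<and>
     (\<forall>i\<in>{1..8}. coord x i - coord x 8 \<in> \<int>) \<and>
     (\<Sum>i=1..8. coord x i) / 2 \<in> \<int>}"

lemma E8_latticeD:
  assumes "x \<in> E8_lattice"
  shows "i \<notin> {1..8} \<Longrightarrow> coord x i = 0" "2 * coord x i \<in> \<int>"
    "i \<in> {1..8} \<Longrightarrow> coord x i - coord x 8 \<in> \<int>"
    "(\<Sum>i=1..8. coord x i) / 2 \<in> \<int>"
  using assms by (simp_all add: E8_lattice_def)

lemma E8_lattice_diff:
  assumes x: "x \<in> E8_lattice" and y: "y \<in> E8_lattice"
  shows "x - of_int k *\<^sub>R y \<in> E8_lattice"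
proof -
  let ?x = "coord x" and ?y = "coord y"
  note X = E8_latticeD[OF x] and Y = E8_latticeD[OF y]
  show ?thesis
    unfolding E8_lattice_def mem_Collect_eq lookup_minus lookup_scaleR real_scaleR_def
  proof (intro conjI allI ballI impI)
    show "?x i - of_int k * ?y i = 0" if "i \<notin> {1..8}" for i
      using X(1)[OF that] Y(1)[OF that] by simp
    show "2 * (?x i - of_int k * ?y i) \<in> \<int>" for i
    proof -
      have "2 * (?x i - of_int k * ?y i) = 2 * ?x i - of_int k * (2 * ?y i)"
        by simp
      also have "\<dots> \<in> \<int>"
        by (intro Ints_diff Ints_mult[OF Ints_of_int] X Y)
      finally show ?thesis .
    qed
    show "?x i - of_int k * ?y i - (?x 8 - of_int k * ?y 8) \<in> \<int>" if "i \<in> {1..8}" for i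
    proof -
      have "?x i - of_int k * ?y i - (?x 8 - of_int k * ?y 8) = (?x i - ?x 8) - of_int k * (?y i - ?y 8)"
        by (simp add: algebra_simps)
      also have "\<dots> \<in> \<int>"
        by (rule Ints_diff[OF X(3)[OF that] Ints_mult[OF Ints_of_int Y(3)[OF that]]])
      finally show ?thesis .
    qed
    have "(\<Sum>i=1..8. ?x i - of_int k * ?y i) / 2 = (\<Sum>i=1..8. ?x i) / 2 - of_int k * ((\<Sum>i=1..8. ?y i) / 2)"
      by (simp add: sum_subtractf sum_distrib_left diff_divide_distrib)
    also have "\<dots> \<in> \<int>"
      by (rule Ints_diff[OF X(4) Ints_mult[OF Ints_of_int Y(4)]])
    finally show "(\<Sum>i=1..8. ?x i - of_int k * ?y i) / 2 \<in> \<int>" .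
  qed
qed

lemma ip_E8_sum: "x \<in> E8_lattice \<Longrightarrow> ip x y = (\<Sum>i=1..8. coord x i * coord y i)"
  by (rule ip_eq_sum) (auto simp: E8_lattice_def in_keys_iff)

text \<open>Shifting all coordinates by the eighth makes them integral. The correction terms are
  products of doubled coordinates and halved coordinate sums, integral as well.\<close>

lemma ip_E8_lattice:
  assumes x: "x \<in> E8_lattice" and y: "y \<in> E8_lattice"
  shows "ip x y \<in> \<int>"
proof -
  let ?x = "coord x" and ?y = "coord y"
  have "(\<Sum>i=1..8. (?x i - ?x 8) * (?y i - ?y 8)) =
      (\<Sum>i=1..8. ?x i * ?y i) - ?y 8 * (\<Sum>i=1..8. ?x i) - ?x 8 * (\<Sum>i=1..8. ?y i) + 8 * (?x 8 * ?y 8)"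
    by (simp add: algebra_simps sum.distrib sum_subtractf sum_distrib_left)
  then have "ip x y = (\<Sum>i=1..8. (?x i - ?x 8) * (?y i - ?y 8)) + (2 * ?y 8) * ((\<Sum>i=1..8. ?x i) / 2) +
      (2 * ?x 8) * ((\<Sum>i=1..8. ?y i) / 2) - 2 * ((2 * ?x 8) * (2 * ?y 8))"
    by (simp add: ip_E8_sum[OF x])
  also have "\<dots> \<in> \<int>"
  proof -
    note X = E8_latticeD[OF x] and Y = E8_latticeD[OF y]
    have "(\<Sum>i=1..8. (?x i - ?x 8) * (?y i - ?y 8)) \<in> \<int>"
      by (rule Ints_sum) (rule Ints_mult[OF X(3) Y(3)])
    from Ints_diff[OF Ints_add[OF Ints_add[OF this Ints_mult[OF Y(2) X(4)]] Ints_mult[OF X(2) Y(4)]]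
        Ints_mult[OF Ints_numeral Ints_mult[OF X(2) Y(2)]]]
    show ?thesis .
  qed
  finally show ?thesis .
qed

lemma half_sign_cases: "s \<in> signs \<Longrightarrow> t \<in> signs \<Longrightarrow> s / 2 - t / 2 \<in> \<int>"
  by (auto simp: signs_def)

lemma half_integer_square:
  fixes x :: real
  assumes "2 * x \<in> \<int>" "x \<notin> \<int>"
  shows "1 / 4 \<le> x * x" "x * x = 1 / 4 \<Longrightarrow> 2 * x \<in> signs"
proof -
  obtain z where z: "2 * x = of_int z"
    using assms(1) by (rule Ints_cases)
  have "z \<noteq> 0"
  proof
    assume "z = 0"
    then have "x = 0"
      using z by simp
    then show False
      using assms(2) by simp
  qed
  then have "1 \<le> \<bar>z\<bar>"
    by linarith
  then have "1 * 1 \<le> \<bar>z\<bar> * \<bar>z\<bar>"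
    by (intro mult_mono) auto
  then have "1 \<le> z * z"
    by simp
  then have "1 \<le> real_of_int (z * z)"
    by (simp only: of_int_1_le_iff)
  also have "real_of_int (z * z) = (2 * x) * (2 * x)"
    by (simp add: z)
  finally show "1 / 4 \<le> x * x"
    by simp
  assume "x * x = 1 / 4"
  moreover have "x \<noteq> 0"
    using assms(2) by auto
  ultimately show "2 * x \<in> signs"
    using assms(1) by (intro int_abs_lt_2) auto
qed

lemma roots_E8_iff: "x \<in> roots_E8 \<longleftrightarrow> x \<in> E8_lattice \<and> ip x x = 2"
proof
  assume "x \<in> roots_E8"
  then consider "x \<in> roots_D 8"
    | s where "x = (1/2) *\<^sub>R (\<Sum>i=1..8. s i *\<^sub>R e i)" "\<forall>i\<in>{1..8}. s i \<in> signs" "(\<Prod>i=1..8. s i) = 1"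
    unfolding roots_E8_def by blast
  then show "x \<in> E8_lattice \<and> ip x x = 2"
  proof cases
    case 1
    then have Z: "x \<in> Zvec 8" "ip x x = 2"
      by (simp_all add: roots_D_iff)
    obtain s t i j where x: "x = s *\<^sub>R e i + t *\<^sub>R e j" "s \<in> signs" "t \<in> signs" "1 \<le> i" "i < j" "j \<le> 8"
      using 1 unfolding roots_D_def by auto
    have "(\<Sum>k=1..8. coord x k) = s + t"
      unfolding x(1) lookup_add sum.distrib using x by (subst (1 2) sum_lookup_e) auto
    moreover have "(s + t) / 2 \<in> \<int>"
      using x by (auto simp: signs_def)
    ultimately show ?thesis
      using Z by (simp add: E8_lattice_def Zvec_def)
  next
    case 2
    have lookup: "coord x k = (if k \<in> {1..8} then s k / 2 else 0)" for k
      unfolding 2(1) lookup_scaleR lookup_sum_e by simp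
    have sum: "(\<Sum>i=1..8. coord x i) / 2 = (\<Sum>i=1..8. s i) / 4"
      by (simp add: lookup sum_divide_distrib)
    have lat: "x \<in> E8_lattice"
      unfolding E8_lattice_def mem_Collect_eq sum
      using 2(2,3) signs_product_8[OF 2(2)] half_sign_cases Ints_signs by (auto simp: lookup)
    have "ip x x = (\<Sum>i=1..8::nat. 1 / 4)"
      unfolding ip_E8_sum[OF lat] by (rule sum.cong) (use 2(2) signs_square in \<open>auto simp: lookup\<close>)
    then show ?thesis
      using lat by simp
  qed
next
  assume *: "x \<in> E8_lattice \<and> ip x x = 2"
  note lat = E8_latticeD[OF conjunct1[OF *]]
  let ?x = "coord x"
  show "x \<in> roots_E8"
  proof (cases "?x 8 \<in> \<int>")
    case True
    have "?x i \<in> \<int>" for i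
    proof (cases "i \<in> {1..8}")
      case i: True
      from Ints_add[OF lat(3)[OF i] True] show ?thesis
        by simp
    qed (simp add: lat(1))
    then have "x \<in> Zvec 8"
      using lat(1) by (simp add: Zvec_def)
    then show ?thesis
      using * Zvec_norm_2 by (simp add: roots_E8_def)
  next
    case False
    have not_int: "?x i \<notin> \<int>" if "i \<in> {1..8}" for i
    proof
      assume "?x i \<in> \<int>"
      from Ints_diff[OF this lat(3)[OF that]] show False
        using False by simp
    qed
    \<comment> \<open>Each of the eight half-integral coordinates contributes at least 1/4 to the
      norm. Norm 2 leaves no slack, so all of them are 1/2 or -1/2.\<close>
    have "(\<Sum>i=1..8. ?x i * ?x i - 1 / 4) = 0"
      using * ip_E8_sum[of x x] by (simp add: sum_subtractf)
    then have "\<forall>i\<in>{1..8}. ?x i * ?x i - 1 / 4 = 0"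
      using half_integer_square(1)[OF lat(2) not_int] by (subst (asm) sum_nonneg_eq_0_iff) auto
    then have signs: "\<forall>i\<in>{1..8}. 2 * ?x i \<in> signs"
      using half_integer_square(2)[OF lat(2) not_int] by simp
    moreover have "(\<Prod>i=1..8. 2 * ?x i) = 1"
    proof -
      have "(\<Sum>i=1..8. 2 * ?x i) / 4 = (\<Sum>i=1..8. ?x i) / 2"
        by (simp add: sum_distrib_left[symmetric])
      then show ?thesis
        using signs_product_8[OF signs] lat(4) by simp
    qed
    moreover have "x = (1/2) *\<^sub>R (\<Sum>i=1..8. (2 * ?x i) *\<^sub>R e i)"
      by (rule poly_mapping_eqI) (simp only: lookup_scaleR lookup_sum_e, use lat(1) in simp)
    ultimately show ?thesis
      unfolding roots_E8_def by (intro UnI2 CollectI exI[of _ "\<lambda>i. 2 * ?x i"] conjI)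
  qed
qed

lemma finite_sign_sums: "finite {c *\<^sub>R (\<Sum>i=1..n. s i *\<^sub>R e i) | s. \<forall>i\<in>{1..n}. s i \<in> signs}"
proof (rule finite_subset)
  show "{c *\<^sub>R (\<Sum>i=1..n. s i *\<^sub>R e i) | s. \<forall>i\<in>{1..n}. s i \<in> signs} \<subseteq>
    (\<lambda>s. c *\<^sub>R (\<Sum>i=1..n. s i *\<^sub>R e i)) ` (PiE {1..n} (\<lambda>_. signs))"
  proof
    fix x assume "x \<in> {c *\<^sub>R (\<Sum>i=1..n. s i *\<^sub>R e i) | s. \<forall>i\<in>{1..n}. s i \<in> signs}"
    then obtain s where "x = c *\<^sub>R (\<Sum>i=1..n. s i *\<^sub>R e i)" "\<forall>i\<in>{1..n}. s i \<in> signs"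
      by blast
    then show "x \<in> (\<lambda>s. c *\<^sub>R (\<Sum>i=1..n. s i *\<^sub>R e i)) ` (PiE {1..n} (\<lambda>_. signs))"
      by (intro image_eqI[of _ _ "restrict s {1..n}"]) auto
  qed
qed (simp add: finite_PiE)

lemma root_sys_E8: "root_sys roots_E8"
proof (rule root_sys_lattice[where L = E8_lattice and N = "{2}"])
  have "roots_E8 \<subseteq> roots_D 8 \<union> {(1/2) *\<^sub>R (\<Sum>i=1..8. s i *\<^sub>R e i) | s. \<forall>i\<in>{1..8}. s i \<in> signs}"
    unfolding roots_E8_def by blast
  then show "finite roots_E8"
    by (rule finite_subset) (intro finite_UnI finite_roots_D finite_sign_sums)
  show "2 * ip \<beta> \<alpha> / ip \<alpha> \<alpha> \<in> \<int>" if "\<alpha> \<in> roots_E8" "\<beta> \<in> roots_E8" for \<alpha> \<beta>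
    using that ip_E8_lattice by (auto simp: roots_E8_iff)
qed (auto simp: roots_E8_iff E8_lattice_diff)

section \<open>Simple roots of E8 and their coefficients\<close>

lemma atLeastAtMost_1_8: "{1..8::nat} = {1, 2, 3, 4, 5, 6, 7, 8}"
  by auto

text \<open>Bourbaki's numbering: node 4 is the branch, with neighbours 2, 3 and 5, and the first
  six or seven vectors are simple roots of E6 or E7.\<close>

definition E8_simple :: "nat \<Rightarrow> vec" where
  "E8_simple k =
    (if k = 1 then (1/2) *\<^sub>R (e 1 + e 8 - (e 2 + e 3 + e 4 + e 5 + e 6 + e 7))
     else if k = 2 then e 1 + e 2 else e (k - 1) - e (k - 2))"

text \<open>Inner products with the fundamental weights.\<close>

definition E8_coeff :: "nat \<Rightarrow> vec \<Rightarrow> real" where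
  "E8_coeff k v = (let x = coord v in
    if k = 1 then 2 * x 8
    else if k = 2 then (x 1 + x 2 + x 3 + x 4 + x 5 + x 6 + x 7 + 5 * x 8) / 2
    else if k = 3 then (- x 1 + x 2 + x 3 + x 4 + x 5 + x 6 + x 7 + 7 * x 8) / 2
    else if k = 4 then x 3 + x 4 + x 5 + x 6 + x 7 + 5 * x 8
    else if k = 5 then x 4 + x 5 + x 6 + x 7 + 4 * x 8
    else if k = 6 then x 5 + x 6 + x 7 + 3 * x 8
    else if k = 7 then x 6 + x 7 + 2 * x 8
    else x 7 + x 8)"

lemma linear_E8_coeff: "linear (E8_coeff k)"
  by (rule linearI) (simp_all add: E8_coeff_def Let_def lookup_simps field_simps)

lemma E8_coeff_simple:
  assumes "i \<in> {1..8}" "j \<in> {1..8}"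
  shows "E8_coeff i (E8_simple j) = (if i = j then 1 else 0)"
  using assms unfolding atLeastAtMost_1_8
  by (elim insertE emptyE) (simp_all add: E8_coeff_def E8_simple_def Let_def lookup_simps)

lemma E8_expand:
  assumes "\<And>i. i \<notin> {1..8} \<Longrightarrow> coord x i = 0"
  shows "x = (\<Sum>k=1..8. E8_coeff k x *\<^sub>R E8_simple k)"
proof (rule poly_mapping_eqI)
  fix i
  show "coord x i = coord (\<Sum>k=1..8. E8_coeff k x *\<^sub>R E8_simple k) i"
  proof (cases "i \<in> {1..8}")
    case True
    then show ?thesis
      unfolding atLeastAtMost_1_8
      by (elim insertE emptyE) (simp_all add: E8_coeff_def E8_simple_def Let_def lookup_simps lookup_numeral_mult field_simps)
  next
    case False
    then have "i \<notin> {1, 2, 3, 4, 5, 6, 7, 8}"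
      unfolding atLeastAtMost_1_8 .
    then show ?thesis
      using assms[OF False] unfolding atLeastAtMost_1_8
      by (simp add: E8_simple_def lookup_simps)
  qed
qed

lemma E8_coeff_Ints:
  assumes x: "x \<in> E8_lattice" and k: "k \<in> {1..8}"
  shows "E8_coeff k x \<in> \<int>"
proof -
  let ?x = "coord x"
  have d: "?x i - ?x 8 \<in> \<int>" if "i \<in> {1, 2, 3, 4, 5, 6, 7, 8}" for i
    using E8_latticeD(3)[OF x] that unfolding atLeastAtMost_1_8 by blast
  have t: "2 * ?x 8 \<in> \<int>"
    by (rule E8_latticeD(2)[OF x])
  have s: "(?x 1 + ?x 2 + ?x 3 + ?x 4 + ?x 5 + ?x 6 + ?x 7 + ?x 8) / 2 \<in> \<int>"
    using E8_latticeD(4)[OF x] unfolding atLeastAtMost_1_8 by (simp add: add.assoc)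
  have n: "of_nat m * (2 * ?x 8) \<in> \<int>" for m
    by (rule Ints_mult[OF Ints_of_nat t])
  \<comment> \<open>Each functional is expressed through the quantities that are integral by
    definition of the lattice: differences to coordinate 8, its double, and half the coordinate
    sum.\<close>
  have eqs: "E8_coeff 1 x = of_nat 1 * (2 * ?x 8)"
    "E8_coeff 2 x = (?x 1 + ?x 2 + ?x 3 + ?x 4 + ?x 5 + ?x 6 + ?x 7 + ?x 8) / 2 + of_nat 1 * (2 * ?x 8)"
    "E8_coeff 3 x = (?x 1 + ?x 2 + ?x 3 + ?x 4 + ?x 5 + ?x 6 + ?x 7 + ?x 8) / 2 - (?x 1 - ?x 8) + of_nat 1 * (2 * ?x 8)"
    "E8_coeff 4 x = (?x 3 - ?x 8) + (?x 4 - ?x 8) + (?x 5 - ?x 8) + (?x 6 - ?x 8) + (?x 7 - ?x 8) + of_nat 5 * (2 * ?x 8)"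
    "E8_coeff 5 x = (?x 4 - ?x 8) + (?x 5 - ?x 8) + (?x 6 - ?x 8) + (?x 7 - ?x 8) + of_nat 4 * (2 * ?x 8)"
    "E8_coeff 6 x = (?x 5 - ?x 8) + (?x 6 - ?x 8) + (?x 7 - ?x 8) + of_nat 3 * (2 * ?x 8)"
    "E8_coeff 7 x = (?x 6 - ?x 8) + (?x 7 - ?x 8) + of_nat 2 * (2 * ?x 8)"
    "E8_coeff 8 x = (?x 7 - ?x 8) + of_nat 1 * (2 * ?x 8)"
    by (simp_all add: E8_coeff_def Let_def field_simps)
  show ?thesis
    using k unfolding atLeastAtMost_1_8
    by (elim insertE emptyE; simp only: eqs; intro Ints_add Ints_diff[OF s d] d n s; simp)
qed

lemma E8_coeff_uminus: "E8_coeff k (- x) = - E8_coeff k x"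
  using linear_neg[OF linear_E8_coeff] .

text \<open>Every functional gives a later coordinate a non-negative weight at least the absolute
  weight of an earlier one, so the later coordinate decides the sign.\<close>

lemma E8_coeff_nonneg_integer:
  assumes j: "i < j" "1 \<le> i" "j \<le> 8" and s: "s \<in> signs" and k: "k \<in> {1..8}"
  shows "0 \<le> E8_coeff k (s *\<^sub>R e i + e j)"
proof -
  have le: "\<bar>E8_coeff k (e i)\<bar> \<le> E8_coeff k (e j)"
  proof -
    have "i \<in> {1, 2, 3, 4, 5, 6, 7, 8}" "j \<in> {1, 2, 3, 4, 5, 6, 7, 8}" "k \<in> {1, 2, 3, 4, 5, 6, 7, 8}"
      using j k by auto
    then show ?thesis
      using j(1) by (elim insertE emptyE) (simp_all add: E8_coeff_def Let_def)
  qed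
  have "E8_coeff k (s *\<^sub>R e i + e j) = s * E8_coeff k (e i) + E8_coeff k (e j)"
    by (simp add: linear_add[OF linear_E8_coeff] linear_scale[OF linear_E8_coeff])
  moreover have "s = 1 \<or> s = -1"
    using s by (auto simp: signs_def)
  ultimately show ?thesis
    using le by auto
qed

text \<open>The bounds on the coordinates alone give only -1/2, as for the second functional;
  integrality of the coefficient then raises this to 0.\<close>

lemma E8_coeff_nonneg_half:
  assumes lat: "x \<in> E8_lattice" and x8: "coord x 8 = 1 / 2"
    and ge: "\<And>i. i \<in> {1..8} \<Longrightarrow> - 1 / 2 \<le> coord x i"
    and le: "coord x 1 \<le> 1 / 2" and k: "k \<in> {1..8}"
  shows "0 \<le> E8_coeff k x"
proof -
  have g: "- 1 / 2 \<le> coord x 1" "- 1 / 2 \<le> coord x 2" "- 1 / 2 \<le> coord x 3"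
    "- 1 / 2 \<le> coord x 4" "- 1 / 2 \<le> coord x 5" "- 1 / 2 \<le> coord x 6"
    "- 1 / 2 \<le> coord x 7"
    by (rule ge; simp)+
  have "- 1 / 2 \<le> E8_coeff k x"
    using k g le x8 unfolding atLeastAtMost_1_8
    by (elim insertE emptyE) (simp_all add: E8_coeff_def Let_def)
  moreover obtain z where "E8_coeff k x = of_int z"
    using E8_coeff_Ints[OF lat k] by (rule Ints_cases)
  ultimately have "real_of_int (-1) < real_of_int z"
    by simp
  then have "0 \<le> z"
    by (simp only: of_int_less_iff)
  then show ?thesis
    using \<open>E8_coeff k x = of_int z\<close> by simp
qed

text \<open>The last non-zero coordinate decides whether a root is positive: \<open>t\<close> for
  integral roots, \<open>s 8\<close> for half-integral ones.\<close>

lemma E8_root_sign: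
  assumes "\<beta> \<in> roots_E8"
  shows "(\<forall>k\<in>{1..8}. 0 \<le> E8_coeff k \<beta>) \<or> (\<forall>k\<in>{1..8}. 0 \<le> E8_coeff k (- \<beta>))"
proof -
  have neg: "- x \<in> E8_lattice" if "x \<in> E8_lattice" for x
    using root_sys.neg_root[OF root_sys_E8] E8_lattice_diff[of 0 x 1] that by (simp add: E8_lattice_def)
  from assms consider "\<beta> \<in> roots_D 8"
    | s where "\<beta> = (1/2) *\<^sub>R (\<Sum>i=1..8. s i *\<^sub>R e i)" "\<forall>i\<in>{1..8}. s i \<in> signs"
    unfolding roots_E8_def by blast
  then show ?thesis
  proof cases
    case 1
    then obtain s t i j where x: "\<beta> = s *\<^sub>R e i + t *\<^sub>R e j" "s \<in> signs" "t \<in> signs" "1 \<le> i" "i < j" "j \<le> 8"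
      unfolding roots_D_def by auto
    have "t = 1 \<or> t = -1"
      using x by (auto simp: signs_def)
    then have "\<beta> = s *\<^sub>R e i + e j \<or> - \<beta> = (- s) *\<^sub>R e i + e j"
      using x(1) by auto
    then show ?thesis
      using E8_coeff_nonneg_integer x by (metis signs_simps(3))
  next
    case 2
    have lookup: "coord \<beta> k = s k / 2" if "k \<in> {1..8}" for k
      unfolding 2(1) lookup_scaleR lookup_sum_e using that by simp
    have lat: "\<beta> \<in> E8_lattice" "- \<beta> \<in> E8_lattice"
      using assms neg by (auto simp: roots_E8_iff)
    have bounds: "- 1 / 2 \<le> coord \<beta> i" "coord \<beta> i \<le> 1 / 2" if "i \<in> {1..8}" for i
      using bspec[OF 2(2) that] lookup[OF that] by (auto simp: signs_def)
    have b1: "- 1 / 2 \<le> coord \<beta> 1" "coord \<beta> 1 \<le> 1 / 2"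
      by (rule bounds; simp)+
    have "s 8 = 1 \<or> s 8 = -1"
      using bspec[OF 2(2), of 8] by (auto simp: signs_def)
    then show ?thesis
    proof
      assume "s 8 = 1"
      then have "\<forall>k\<in>{1..8}. 0 \<le> E8_coeff k \<beta>"
        using lookup[of 8] bounds b1 by (intro ballI E8_coeff_nonneg_half[OF lat(1)]) auto
      then show ?thesis ..
    next
      assume "s 8 = -1"
      have "0 \<le> E8_coeff k (- \<beta>)" if "k \<in> {1..8}" for k
      proof (rule E8_coeff_nonneg_half[OF lat(2) _ _ _ that])
        show "coord (- \<beta>) 8 = 1 / 2"
          using lookup[of 8] \<open>s 8 = -1\<close> by (simp add: lookup_uminus)
        show "- 1 / 2 \<le> coord (- \<beta>) i" if "i \<in> {1..8}" for i
          using bounds(2)[OF that] by (simp add: lookup_uminus)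
        show "coord (- \<beta>) 1 \<le> 1 / 2"
          using b1(1) by (simp add: lookup_uminus)
      qed
      then show ?thesis
        by blast
    qed
  qed
qed

lemma Ints_nonneg_Nats: "x \<in> \<int> \<Longrightarrow> 0 \<le> x \<Longrightarrow> (x::real) \<in> \<nat>"
  by (auto elim!: Ints_cases simp: Nats_altdef1)

text \<open>Treats E6, E7 and E8 at once. The hypothesis \<open>vanish\<close> cuts the expansion in
  all eight simple roots of E8 down to the first \<open>m\<close>.\<close>

lemma simple_roots_E:
  assumes m: "m \<le> 8" and \<Phi>: "\<Phi> \<subseteq> roots_E8" and base: "E8_simple ` {1..m} \<subseteq> \<Phi>"
    and vanish: "\<And>k \<beta>. \<beta> \<in> \<Phi> \<Longrightarrow> m < k \<Longrightarrow> k \<le> 8 \<Longrightarrow> E8_coeff k \<beta> = 0"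
  shows "simple_roots \<Phi> (E8_simple ` {1..m})"
proof -
  interpret dual_basis "{1..m}" E8_simple E8_coeff
    by (rule dual_basis.intro) (use m in \<open>auto simp: linear_E8_coeff E8_coeff_simple\<close>)
  show ?thesis
  proof (rule simple_roots_\<alpha>[OF base])
    fix \<beta> assume \<beta>: "\<beta> \<in> \<Phi>"
    then have lat: "\<beta> \<in> E8_lattice" "- \<beta> \<in> E8_lattice"
      using \<Phi> roots_E8_iff root_sys.neg_root[OF root_sys_E8] by blast+
    have "\<beta> = (\<Sum>k=1..8. E8_coeff k \<beta> *\<^sub>R E8_simple k)"
      by (rule E8_expand) (rule E8_latticeD(1)[OF lat(1)])
    also have "\<dots> = (\<Sum>k=1..m. E8_coeff k \<beta> *\<^sub>R E8_simple k)"
      by (rule sum.mono_neutral_right) (use m vanish[OF \<beta>] in auto)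
    finally show "\<beta> = (\<Sum>k=1..m. E8_coeff k \<beta> *\<^sub>R E8_simple k)" .
    have "E8_coeff k \<beta> \<in> \<int>" "- E8_coeff k \<beta> \<in> \<int>" if "k \<in> {1..8}" for k
      using E8_coeff_Ints[OF lat(1) that] by simp_all
    moreover have "{1..m} \<subseteq> {1..8}"
      using m by auto
    moreover have "(\<forall>k\<in>{1..8}. 0 \<le> E8_coeff k \<beta>) \<or> (\<forall>k\<in>{1..8}. 0 \<le> - E8_coeff k \<beta>)"
      using E8_root_sign \<beta> \<Phi> unfolding E8_coeff_uminus by blast
    ultimately show "(\<forall>k\<in>{1..m}. E8_coeff k \<beta> \<in> \<nat>) \<or> (\<forall>k\<in>{1..m}. - E8_coeff k \<beta> \<in> \<nat>)"
      using Ints_nonneg_Nats by (meson subset_iff)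
  qed
qed

lemma E8_simple_root: "k \<in> {1..8} \<Longrightarrow> E8_simple k \<in> roots_E8"
proof -
  assume k: "k \<in> {1..8}"
  have D: "s *\<^sub>R e i + t *\<^sub>R e j \<in> roots_E8"
    if "s \<in> signs" "t \<in> signs" "1 \<le> i" "i < j" "j \<le> 8" for s t i j
    using that by (auto simp: roots_D_def roots_E8_def)
  consider "k = 1" | "k = 2" | "3 \<le> k"
    using k by fastforce
  then show ?thesis
  proof cases
    case 1
    have sum: "(\<Sum>i=1..8. coord (E8_simple 1) i * coord (E8_simple 1) i) = 2"
      "(\<Sum>i=1..8. coord (E8_simple 1) i) = -2"
      unfolding atLeastAtMost_1_8 by (simp_all add: E8_simple_def lookup_simps)
    have lat: "E8_simple 1 \<in> E8_lattice"
      unfolding E8_lattice_def mem_Collect_eq sum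
      unfolding atLeastAtMost_1_8
      by (auto simp: E8_simple_def lookup_simps)
    then show ?thesis
      using sum 1 by (simp add: roots_E8_iff ip_E8_sum)
  next
    case 2
    then show ?thesis
      using D[of 1 1 1 2] by (simp add: E8_simple_def)
  next
    case 3
    then show ?thesis
      using D[of "-1" 1 "k - 2" "k - 1"] k by (simp add: E8_simple_def)
  qed
qed

lemma not_shellable_E:
  assumes "root_sys \<Phi>" and m: "5 \<le> m" "m \<le> 8" and \<Phi>: "\<Phi> \<subseteq> roots_E8" and base: "E8_simple ` {1..m} \<subseteq> \<Phi>"
    and vanish: "\<And>k \<beta>. \<beta> \<in> \<Phi> \<Longrightarrow> m < k \<Longrightarrow> k \<le> 8 \<Longrightarrow> E8_coeff k \<beta> = 0"
    and S: "simple_roots \<Phi> S"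
  shows "\<not> shellable (antichain_complex \<Phi> S)"
proof -
  interpret root_sys \<Phi> by fact
  have simple: "simple_roots \<Phi> (E8_simple ` {1..m})"
    using simple_roots_E[OF m(2) \<Phi> base vanish] .
  have "\<not> shellable (antichain_complex \<Phi> (E8_simple ` {1..m}))"
  \<comment> \<open>The branch node 4 and its neighbours 2, 3, 5, all present once \<open>m\<close>
    is at least 5.\<close>
  proof (rule not_shellable_D4[where a = "E8_simple 2" and b = "E8_simple 3" and c = "E8_simple 4" and d = "E8_simple 5",
        OF _ simple])
    show "ip x x = 2" if "x \<in> \<Phi>" for x
      using that \<Phi> roots_E8_iff by blast
    show "E8_simple 2 \<in> E8_simple ` {1..m}" "E8_simple 3 \<in> E8_simple ` {1..m}"
      "E8_simple 4 \<in> E8_simple ` {1..m}" "E8_simple 5 \<in> E8_simple ` {1..m}"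
      using m by (auto intro!: imageI)
  qed (simp_all add: E8_simple_def ip_bilinear lookup_simps)
  then show ?thesis
    using not_shellable_simple_roots[OF simple] S by blast
qed

theorem not_shellable_E8:
  "simple_roots (root_system Type_E8) S \<Longrightarrow> \<not> shellable (antichain_complex (root_system Type_E8) S)"
  unfolding root_system.simps
  by (rule not_shellable_E[OF root_sys_E8, of 8]) (auto intro: E8_simple_root)

theorem not_shellable_E7:
  assumes "simple_roots (root_system Type_E7) S"
  shows "\<not> shellable (antichain_complex (root_system Type_E7) S)"
proof -
  let ?U = "{x::vec. coord x 7 = - coord x 8}"
  have eq: "root_system Type_E7 = roots_E8 \<inter> ?U"
    by auto
  have "subspace ?U"
    by (auto simp: subspace_def lookup_simps)
  then have sys: "root_sys (roots_E8 \<inter> ?U)"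
    by (rule root_sys_inter_subspace[OF root_sys_E8])
  have base: "E8_simple ` {1..7} \<subseteq> roots_E8 \<inter> ?U"
  proof
    fix x assume "x \<in> E8_simple ` {1..7}"
    then obtain k where k: "k \<in> {1..7}" "x = E8_simple k"
      by blast
    then show "x \<in> roots_E8 \<inter> ?U"
      using E8_simple_root[of k] by (auto simp: E8_simple_def lookup_simps)
  qed
  \<comment> \<open>The eighth functional is the sum of coordinates 7 and 8, which is the equation
    cutting out E7.\<close>
  have vanish: "E8_coeff k \<beta> = 0" if "\<beta> \<in> roots_E8 \<inter> ?U" "7 < k" "k \<le> 8" for k \<beta>
    using that by (auto simp: E8_coeff_def)
  show ?thesis
    using not_shellable_E[OF sys _ _ _ base vanish] assms unfolding eq by simp
qed

theorem not_shellable_E6: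
  assumes "simple_roots (root_system Type_E6) S"
  shows "\<not> shellable (antichain_complex (root_system Type_E6) S)"
proof -
  let ?U = "{x::vec. coord x 6 = coord x 7 \<and>
    coord x 7 = - coord x 8}"
  have eq: "root_system Type_E6 = roots_E8 \<inter> ?U"
    by auto
  have "subspace ?U"
    by (auto simp: subspace_def lookup_simps)
  then have sys: "root_sys (roots_E8 \<inter> ?U)"
    by (rule root_sys_inter_subspace[OF root_sys_E8])
  have base: "E8_simple ` {1..6} \<subseteq> roots_E8 \<inter> ?U"
  proof
    fix x assume "x \<in> E8_simple ` {1..6}"
    then obtain k where k: "k \<in> {1..6}" "x = E8_simple k"
      by blast
    then show "x \<in> roots_E8 \<inter> ?U"
      using E8_simple_root[of k] by (auto simp: E8_simple_def lookup_simps)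
  qed
  \<comment> \<open>The seventh functional, x6 + x7 + 2 x8, vanishes too once x6 = x7 = -x8.\<close>
  have vanish: "E8_coeff k \<beta> = 0" if "\<beta> \<in> roots_E8 \<inter> ?U" "6 < k" "k \<le> 8" for k \<beta>
  proof -
    have "k = 7 \<or> k = 8"
      using that(2,3) by linarith
    then show ?thesis
      using that(1) by (auto simp: E8_coeff_def)
  qed
  show ?thesis
    using not_shellable_E[OF sys _ _ _ base vanish] assms unfolding eq by simp
qed

section \<open>The type \<open>F\<^sub>4\<close>\<close>

lemma atLeastAtMost_1_4: "{1..4::nat} = {1, 2, 3, 4}"
  by auto

text \<open>The lattice of Hurwitz quaternions: coordinates all integral or all half-integral, with
  no parity condition on their sum.\<close>

definition F4_lattice :: "vec set" where
  "F4_lattice = {x. (\<forall>i. i \<notin> {1..4} \<longrightarrow> coord x i = 0) \<and>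
     (\<forall>i. 2 * coord x i \<in> \<int>) \<and>
     (\<forall>i\<in>{1..4}. coord x i - coord x 4 \<in> \<int>)}"

lemma F4_latticeD:
  assumes "x \<in> F4_lattice"
  shows "i \<notin> {1..4} \<Longrightarrow> coord x i = 0" "2 * coord x i \<in> \<int>"
    "i \<in> {1..4} \<Longrightarrow> coord x i - coord x 4 \<in> \<int>"
  using assms by (simp_all add: F4_lattice_def)

lemma F4_lattice_diff:
  assumes x: "x \<in> F4_lattice" and y: "y \<in> F4_lattice"
  shows "x - of_int k *\<^sub>R y \<in> F4_lattice"
proof -
  let ?x = "coord x" and ?y = "coord y"
  note X = F4_latticeD[OF x] and Y = F4_latticeD[OF y]
  show ?thesis
    unfolding F4_lattice_def mem_Collect_eq lookup_minus lookup_scaleR real_scaleR_def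
  proof (intro conjI allI ballI impI)
    show "?x i - of_int k * ?y i = 0" if "i \<notin> {1..4}" for i
      using X(1)[OF that] Y(1)[OF that] by simp
    show "2 * (?x i - of_int k * ?y i) \<in> \<int>" for i
    proof -
      have "2 * (?x i - of_int k * ?y i) = 2 * ?x i - of_int k * (2 * ?y i)"
        by simp
      also have "\<dots> \<in> \<int>"
        by (intro Ints_diff Ints_mult[OF Ints_of_int] X Y)
      finally show ?thesis .
    qed
    show "?x i - of_int k * ?y i - (?x 4 - of_int k * ?y 4) \<in> \<int>" if "i \<in> {1..4}" for i
    proof -
      have "?x i - of_int k * ?y i - (?x 4 - of_int k * ?y 4) = (?x i - ?x 4) - of_int k * (?y i - ?y 4)"
        by (simp add: algebra_simps)
      also have "\<dots> \<in> \<int>"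
        by (rule Ints_diff[OF X(3)[OF that] Ints_mult[OF Ints_of_int Y(3)[OF that]]])
      finally show ?thesis .
    qed
  qed
qed

lemma ip_F4_sum: "x \<in> F4_lattice \<Longrightarrow> ip x y = (\<Sum>i=1..4. coord x i * coord y i)"
  by (rule ip_eq_sum) (auto simp: F4_lattice_def in_keys_iff)

lemma Zvec_F4_lattice: "x \<in> Zvec 4 \<Longrightarrow> x \<in> F4_lattice"
  by (simp add: Zvec_def F4_lattice_def)

lemma half_sign_sum_F4:
  assumes x: "x = (1/2) *\<^sub>R (\<Sum>i=1..4. s i *\<^sub>R e i)" and s: "\<forall>i\<in>{1..4}. s i \<in> signs"
  shows "x \<in> F4_lattice" "ip x x = 1"
proof -
  have lookup: "coord x k = (if k \<in> {1..4} then s k / 2 else 0)" for k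
    unfolding x lookup_scaleR lookup_sum_e by simp
  show lat: "x \<in> F4_lattice"
    unfolding F4_lattice_def mem_Collect_eq using s half_sign_cases Ints_signs by (auto simp: lookup)
  have "ip x x = (\<Sum>i=1..4::nat. 1 / 4)"
    unfolding ip_F4_sum[OF lat] by (rule sum.cong) (use s signs_square in \<open>auto simp: lookup\<close>)
  then show "ip x x = 1"
    by simp
qed

text \<open>For x = n + 1/2 the difference is n (n + 1), an even number. Summed over four
  coordinates this makes the norm of a half-integral vector odd, which excludes norm 2 in
  \<open>roots_F4_iff\<close>.\<close>

lemma half_integer_square_even:
  fixes x :: real
  assumes "2 * x \<in> \<int>" "x \<notin> \<int>"
  shows "(x * x - 1 / 4) / 2 \<in> \<int>"
proof -
  obtain z where z: "2 * x = of_int z"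
    using assms(1) by (rule Ints_cases)
  have "odd z"
  proof
    assume "even z"
    then obtain n where "z = 2 * n" ..
    then have "x = of_int n"
      using z by simp
    then show False
      using assms(2) by simp
  qed
  then obtain n where n: "z = 2 * n + 1"
    by (rule oddE)
  have "even (n * (n + 1))"
    by simp
  then obtain m where m: "n * (n + 1) = 2 * m" ..
  have "x = of_int n + 1 / 2"
    using z n by simp
  then have "(x * x - 1 / 4) / 2 = of_int (n * (n + 1)) / 2"
    by (simp add: algebra_simps)
  also have "\<dots> = of_int m"
    unfolding m by simp
  finally show ?thesis
    by simp
qed

lemma roots_F4_iff: "x \<in> root_system Type_F4 \<longleftrightarrow> x \<in> F4_lattice \<and> ip x x \<in> {1, 2}"
proof
  assume "x \<in> root_system Type_F4"
  then consider "x \<in> roots_D 4" | "x \<in> {s *\<^sub>R e i | s i. s \<in> signs \<and> i \<in> {1..4}}"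
    | s where "x = (1/2) *\<^sub>R (\<Sum>i=1..4. s i *\<^sub>R e i)" "\<forall>i\<in>{1..4}. s i \<in> signs"
    unfolding root_system.simps by blast
  then show "x \<in> F4_lattice \<and> ip x x \<in> {1, 2}"
  proof cases
    case 1
    then show ?thesis
      by (simp add: roots_D_iff Zvec_F4_lattice)
  next
    case 2
    then show ?thesis
      unfolding signed_unit_iff by (simp add: Zvec_F4_lattice)
  next
    case 3
    then show ?thesis
      using half_sign_sum_F4 by simp
  qed
next
  assume *: "x \<in> F4_lattice \<and> ip x x \<in> {1, 2}"
  note lat = F4_latticeD[OF conjunct1[OF *]]
  let ?x = "coord x"
  show "x \<in> root_system Type_F4"
  proof (cases "?x 4 \<in> \<int>")
    case True
    have "?x i \<in> \<int>" for i
    proof (cases "i \<in> {1..4}")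
      case i: True
      from Ints_add[OF lat(3)[OF i] True] show ?thesis
        by simp
    qed (simp add: lat(1))
    then have Z: "x \<in> Zvec 4"
      using lat(1) by (simp add: Zvec_def)
    then have "x \<in> roots_D 4 \<or> x \<in> {s *\<^sub>R e i | s i. s \<in> signs \<and> i \<in> {1..4}}"
      unfolding signed_unit_iff roots_D_iff using * by auto
    then show ?thesis
      unfolding root_system.simps by blast
  next
    case False
    have not_int: "?x i \<notin> \<int>" if "i \<in> {1..4}" for i
    proof
      assume "?x i \<in> \<int>"
      from Ints_diff[OF this lat(3)[OF that]] show False
        using False by simp
    qed
    have sum: "(\<Sum>i=1..4. ?x i * ?x i - 1 / 4) = ip x x - 1"
      using * ip_F4_sum[of x x] by (simp add: sum_subtractf)
    have "(\<Sum>i=1..4. (?x i * ?x i - 1 / 4) / 2) \<in> \<int>"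
      by (rule Ints_sum) (rule half_integer_square_even[OF lat(2) not_int])
    then have "(ip x x - 1) / 2 \<in> \<int>"
      unfolding sum_divide_distrib[symmetric] sum .
    then obtain z where z: "(ip x x - 1) / 2 = of_int z"
      by (rule Ints_cases)
    have "ip x x \<noteq> 2"
    proof
      assume "ip x x = 2"
      then have "real_of_int (2 * z) = real_of_int 1"
        using z by simp
      then have "2 * z = 1"
        by (simp only: of_int_eq_iff)
      then show False
        by presburger
    qed
    then have "(\<Sum>i=1..4. ?x i * ?x i - 1 / 4) = 0"
      using * sum by simp
    then have "\<forall>i\<in>{1..4}. ?x i * ?x i - 1 / 4 = 0"
      using half_integer_square(1)[OF lat(2) not_int] by (subst (asm) sum_nonneg_eq_0_iff) auto
    then have "\<forall>i\<in>{1..4}. 2 * ?x i \<in> signs"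
      using half_integer_square(2)[OF lat(2) not_int] by simp
    moreover have "x = (1/2) *\<^sub>R (\<Sum>i=1..4. (2 * ?x i) *\<^sub>R e i)"
      by (rule poly_mapping_eqI) (simp only: lookup_scaleR lookup_sum_e, use lat(1) in simp)
    ultimately show ?thesis
      unfolding root_system.simps by (intro UnI2 CollectI exI[of _ "\<lambda>i. 2 * ?x i"] conjI)
  qed
qed

lemma root_sys_F4: "root_sys (root_system Type_F4)"
proof (rule root_sys_lattice[where L = F4_lattice and N = "{1, 2}"])
  show "finite (root_system Type_F4)"
    unfolding root_system.simps by (intro finite_UnI finite_roots_D finite_signed_units finite_sign_sums)
  fix \<alpha> \<beta> assume mem: "\<alpha> \<in> root_system Type_F4" "\<beta> \<in> root_system Type_F4"
  let ?x = "coord \<alpha>" and ?y = "coord \<beta>"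
  have lat: "\<alpha> \<in> F4_lattice" "\<beta> \<in> F4_lattice" and norm: "ip \<alpha> \<alpha> = 1 \<or> ip \<alpha> \<alpha> = 2"
    using mem unfolding roots_F4_iff by auto
  note X = F4_latticeD[OF lat(1)] and Y = F4_latticeD[OF lat(2)]
  from norm show "2 * ip \<beta> \<alpha> / ip \<alpha> \<alpha> \<in> \<int>"
  proof
    assume n1: "ip \<alpha> \<alpha> = 1"
    \<comment> \<open>For a short root only twice the product has to be integral; shifting by the
      fourth coordinate writes it through integral quantities.\<close>
    have "(\<Sum>i=1..4. (?x i - ?x 4) * (2 * ?y i)) = 2 * (\<Sum>i=1..4. ?x i * ?y i) - 2 * ?x 4 * (\<Sum>i=1..4. ?y i)"
      by (simp add: algebra_simps sum_subtractf sum_distrib_left)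
    moreover have "(\<Sum>i=1..4. ?y i - ?y 4) = (\<Sum>i=1..4. ?y i) - 4 * ?y 4"
      by (simp add: sum_subtractf)
    ultimately have "2 * ip \<beta> \<alpha> = (\<Sum>i=1..4. (?x i - ?x 4) * (2 * ?y i)) +
        (2 * ?x 4) * ((\<Sum>i=1..4. ?y i - ?y 4) + 2 * (2 * ?y 4))"
      using ip_F4_sum[OF lat(1), of \<beta>] by (simp add: ip_commute[of \<beta>] algebra_simps)
    also have "\<dots> \<in> \<int>"
    proof -
      have "(\<Sum>i=1..4. (?x i - ?x 4) * (2 * ?y i)) \<in> \<int>"
        by (rule Ints_sum) (rule Ints_mult[OF X(3) Y(2)])
      moreover have "(\<Sum>i=1..4. ?y i - ?y 4) \<in> \<int>"
        by (rule Ints_sum) (rule Y(3))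
      ultimately show ?thesis
        using Ints_add[OF _ Ints_mult[OF X(2) Ints_add[OF _ Ints_mult[OF Ints_numeral Y(2)]]]] by blast
    qed
    finally show ?thesis
      using n1 by simp
  next
    assume n2: "ip \<alpha> \<alpha> = 2"
    have "\<alpha> \<in> roots_D 4"
      using mem(1) n2 half_sign_sum_F4 signed_unit_iff[of \<alpha> 4] unfolding root_system.simps by fastforce
    then obtain s t i j where \<alpha>: "\<alpha> = s *\<^sub>R e i + t *\<^sub>R e j" "s \<in> signs" "t \<in> signs" "1 \<le> i" "i < j" "j \<le> 4"
      unfolding roots_D_def by auto
    have ij: "?y i - ?y 4 \<in> \<int>" "?y j - ?y 4 \<in> \<int>"
      using \<alpha> by (auto intro: Y(3))
    \<comment> \<open>For a long root the product itself has to be integral. Long roots are integral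
      vectors, and their two signs have an even sum, which absorbs a half-integral
      \<open>?y 4\<close>.\<close>
    have "ip \<beta> \<alpha> = s * (?y i - ?y 4) + t * (?y j - ?y 4) + ((s + t) / 2) * (2 * ?y 4)"
      by (simp add: \<alpha>(1) ip_bilinear algebra_simps)
    also have "\<dots> \<in> \<int>"
    proof -
      have "(s + t) / 2 \<in> \<int>"
        using \<alpha> by (auto simp: signs_def)
      from Ints_add[OF Ints_add[OF Ints_mult[OF Ints_signs[OF \<alpha>(2)] ij(1)] Ints_mult[OF Ints_signs[OF \<alpha>(3)] ij(2)]]
          Ints_mult[OF this Y(2)]]
      show ?thesis .
    qed
    finally show ?thesis
      using n2 by simp
  qed
qed (use roots_F4_iff F4_lattice_diff in auto)

section \<open>The positive roots of F4 in coordinates\<close>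

definition F4_simple :: "nat \<Rightarrow> vec" where
  "F4_simple k = (if k = 1 then e 2 - e 3 else if k = 2 then e 3 - e 4 else if k = 3 then e 4
     else (1/2) *\<^sub>R (e 1 - e 2 - e 3 - e 4))"

text \<open>The functionals dual to \<open>F4_simple\<close>.\<close>

definition F4_coeff :: "nat \<Rightarrow> vec \<Rightarrow> real" where
  "F4_coeff k v = (let x = coord v in
    if k = 1 then x 1 + x 2 else if k = 2 then 2 * x 1 + x 2 + x 3
    else if k = 3 then 3 * x 1 + x 2 + x 3 + x 4 else 2 * x 1)"

type_synonym coords4 = "nat \<times> nat \<times> nat \<times> nat"

definition coord4 :: "nat \<Rightarrow> coords4 \<Rightarrow> nat" where
  "coord4 k q = (case q of (a, b, c, d) \<Rightarrow> if k = 1 then a else if k = 2 then b else if k = 3 then c else d)"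

text \<open>Coefficients of the 24 positive roots with respect to \<open>F4_simple\<close>, sorted
  by height.\<close>

definition F4_positive :: "coords4 set" where
  "F4_positive = {(0, 0, 0, 1), (0, 0, 1, 0), (0, 1, 0, 0), (1, 0, 0, 0), (0, 0, 1, 1), (0, 1, 1, 0),
     (1, 1, 0, 0), (0, 1, 1, 1), (0, 1, 2, 0), (1, 1, 1, 0), (0, 1, 2, 1), (1, 1, 1, 1), (1, 1, 2, 0),
     (0, 1, 2, 2), (1, 1, 2, 1), (1, 2, 2, 0), (1, 1, 2, 2), (1, 2, 2, 1), (1, 2, 2, 2), (1, 2, 3, 1),
     (1, 2, 3, 2), (1, 2, 4, 2), (1, 3, 4, 2), (2, 3, 4, 2)}"

text \<open>The roots of heights four and five.\<close>

definition F4_middle :: "coords4 set" where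
  "F4_middle = {(0, 1, 2, 1), (1, 1, 1, 1), (1, 1, 2, 0), (0, 1, 2, 2), (1, 1, 2, 1), (1, 2, 2, 0)}"

definition le4 :: "coords4 \<Rightarrow> coords4 \<Rightarrow> bool" where
  "le4 p q \<longleftrightarrow> (case p of (a, b, c, d) \<Rightarrow> case q of (a', b', c', d') \<Rightarrow> a \<le> a' \<and> b \<le> b' \<and> c \<le> c' \<and> d \<le> d')"

text \<open>A finite check that a positive root incomparable to two incomparable middle roots is a
  middle root itself. This is the separation property required by
  \<open>not_shellable_if_split\<close>.\<close>

lemma F4_middle_closed:
  "\<forall>p\<in>F4_positive. \<forall>u\<in>F4_middle. \<forall>v\<in>F4_middle.
    le4 u v \<or> le4 v u \<or> le4 p u \<or> le4 u p \<or> le4 p v \<or> le4 v p \<or> p \<in> F4_middle"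
  by (simp add: F4_positive_def F4_middle_def le4_def)

lemma linear_F4_coeff: "linear (F4_coeff k)"
  by (rule linearI) (simp_all add: F4_coeff_def Let_def lookup_simps algebra_simps)

lemma F4_expand:
  assumes "\<And>i. i \<notin> {1..4} \<Longrightarrow> coord x i = 0"
  shows "x = (\<Sum>k\<in>{1, 2, 3, 4}. F4_coeff k x *\<^sub>R F4_simple k)"
proof (rule poly_mapping_eqI)
  fix i
  show "coord x i = coord (\<Sum>k\<in>{1, 2, 3, 4}. F4_coeff k x *\<^sub>R F4_simple k) i"
  proof (cases "i \<in> {1, 2, 3, 4}")
    case True
    then show ?thesis
      by (elim insertE emptyE) (simp_all add: F4_coeff_def F4_simple_def Let_def lookup_simps lookup_numeral_mult field_simps)
  next
    case False
    then have "coord x i = 0"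
      using assms unfolding atLeastAtMost_1_4 by blast
    then show ?thesis
      using False by (simp add: F4_simple_def lookup_simps)
  qed
qed

text \<open>Evaluation of the functionals on the finitely many shapes of roots; this gives one
  inclusion of the description of the system by \<open>F4_positive\<close>.\<close>

lemma F4_root_coords:
  assumes "x \<in> root_system Type_F4"
  shows "\<exists>q\<in>F4_positive. (\<forall>k\<in>{1, 2, 3, 4}. F4_coeff k x = real (coord4 k q)) \<or>
    (\<forall>k\<in>{1, 2, 3, 4}. F4_coeff k x = - real (coord4 k q))"
proof -
  from assms consider (D) "x \<in> roots_D 4" | (unit) s i where "x = s *\<^sub>R e i" "s \<in> signs" "i \<in> {1..4}"
    | (half) s where "x = (1/2) *\<^sub>R (\<Sum>i=1..4. s i *\<^sub>R e i)" "\<forall>i\<in>{1..4}. s i \<in> signs"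
    unfolding root_system.simps by blast
  then show ?thesis
  proof cases
    case D
    then obtain s t i j where x: "x = s *\<^sub>R e i + t *\<^sub>R e j" "s \<in> signs" "t \<in> signs" "1 \<le> i" "i < j" "j \<le> 4"
      unfolding roots_D_def by auto
    have "i = 1 \<and> j = 2 \<or> i = 1 \<and> j = 3 \<or> i = 1 \<and> j = 4 \<or> i = 2 \<and> j = 3 \<or> i = 2 \<and> j = 4 \<or> i = 3 \<and> j = 4"
      using x by linarith
    moreover have "s = 1 \<or> s = -1" "t = 1 \<or> t = -1"
      using x by (auto simp: signs_def)
    ultimately show ?thesis
      unfolding x(1) by (elim disjE conjE) (simp_all add: F4_positive_def coord4_def F4_coeff_def lookup_simps)
  next
    case unit
    have "i = 1 \<or> i = 2 \<or> i = 3 \<or> i = 4"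
      using unit by auto
    moreover have "s = 1 \<or> s = -1"
      using unit by (auto simp: signs_def)
    ultimately show ?thesis
      unfolding unit(1) by (elim disjE conjE) (simp_all add: F4_positive_def coord4_def F4_coeff_def lookup_simps)
  next
    case half
    have lookup: "coord x k = s k / 2" if "k \<in> {1, 2, 3, 4}" for k
      unfolding half(1) lookup_scaleR lookup_sum_e using that by auto
    have l: "coord x 1 = s 1 / 2" "coord x 2 = s 2 / 2"
      "coord x 3 = s 3 / 2" "coord x 4 = s 4 / 2"
      by (rule lookup; simp)+
    have "s 1 = 1 \<or> s 1 = -1" "s 2 = 1 \<or> s 2 = -1" "s 3 = 1 \<or> s 3 = -1" "s 4 = 1 \<or> s 4 = -1"
      using half(2) unfolding atLeastAtMost_1_4 by (auto simp: signs_def)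
    then show ?thesis
      unfolding F4_coeff_def Let_def l
      by (elim disjE) (simp_all add: F4_positive_def coord4_def)
  qed
qed

theorem not_shellable_F4:
  assumes "simple_roots (root_system Type_F4) S"
  shows "\<not> shellable (antichain_complex (root_system Type_F4) S)"
proof -
  let ?I = "{1, 2, 3, 4::nat}" and ?\<Phi> = "root_system Type_F4"
  interpret root_sys ?\<Phi>
    by (rule root_sys_F4)
  interpret dual_basis ?I F4_simple F4_coeff
  proof (rule dual_basis.intro)
    show "F4_coeff i (F4_simple j) = (if i = j then 1 else 0)" if "i \<in> ?I" "j \<in> ?I" for i j
      using that by (elim insertE emptyE) (simp_all add: F4_coeff_def F4_simple_def lookup_simps)
  qed (simp_all add: linear_F4_coeff)
  define \<beta> where "\<beta> q = (\<Sum>k\<in>?I. real (coord4 k q) *\<^sub>R F4_simple k)" for q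
  have nonzero: "\<exists>k\<in>?I. coord4 k q \<noteq> 0" if "q \<in> F4_positive" for q
    using that by (auto simp: F4_positive_def coord4_def)
  have simple_lat: "F4_simple k \<in> F4_lattice" for k
    by (auto simp: F4_simple_def F4_lattice_def lookup_simps atLeastAtMost_1_4)
  have \<beta>_lat: "\<beta> q \<in> F4_lattice" for q
  proof -
    have "0 \<in> F4_lattice"
      by (simp add: F4_lattice_def)
    moreover have "real n *\<^sub>R F4_simple k + x \<in> F4_lattice" if "x \<in> F4_lattice" for x n k
      using F4_lattice_diff[OF that simple_lat[of k], of "- int n"] by (simp add: add.commute)
    ultimately have "(\<Sum>k\<in>J. real (coord4 k q) *\<^sub>R F4_simple k) \<in> F4_lattice" for J
      by (induction J rule: infinite_finite_induct) simp_all
    then show ?thesis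
      unfolding \<beta>_def .
  qed
  have gram: "ip (F4_simple (Suc 0)) (F4_simple (Suc 0)) = 2" "ip (F4_simple 2) (F4_simple 2) = 2"
    "ip (F4_simple 3) (F4_simple 3) = 1" "ip (F4_simple 4) (F4_simple 4) = 1"
    "ip (F4_simple (Suc 0)) (F4_simple 2) = -1" "ip (F4_simple 2) (F4_simple (Suc 0)) = -1"
    "ip (F4_simple 2) (F4_simple 3) = -1" "ip (F4_simple 3) (F4_simple 2) = -1"
    "ip (F4_simple 3) (F4_simple 4) = -1/2" "ip (F4_simple 4) (F4_simple 3) = -1/2"
    "ip (F4_simple (Suc 0)) (F4_simple 3) = 0" "ip (F4_simple 3) (F4_simple (Suc 0)) = 0"
    "ip (F4_simple (Suc 0)) (F4_simple 4) = 0" "ip (F4_simple 4) (F4_simple (Suc 0)) = 0"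
    "ip (F4_simple 2) (F4_simple 4) = 0" "ip (F4_simple 4) (F4_simple 2) = 0"
    by (simp_all add: F4_simple_def ip_bilinear lookup_simps)
  \<comment> \<open>The converse inclusion follows from \<open>roots_F4_iff\<close>: the listed
    combinations are lattice vectors, and the Gram matrix gives them norm 1 or 2.\<close>
  have \<beta>_norm: "ip (\<beta> q) (\<beta> q) \<in> {1, 2}" if "q \<in> F4_positive" for q
    using that unfolding F4_positive_def
    by (elim insertE emptyE) (simp_all add: \<beta>_def coord4_def ip_bilinear gram)
  have \<Phi>: "?\<Phi> = \<beta> ` F4_positive \<union> uminus ` \<beta> ` F4_positive"
  proof (intro set_eqI iffI)
    fix x assume x: "x \<in> ?\<Phi>"
    then have "x \<in> F4_lattice"
      unfolding roots_F4_iff by simp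
    then have x_eq: "x = (\<Sum>k\<in>?I. F4_coeff k x *\<^sub>R F4_simple k)"
      using F4_latticeD(1) by (intro F4_expand)
    obtain q where q: "q \<in> F4_positive" and
      "(\<forall>k\<in>?I. F4_coeff k x = real (coord4 k q)) \<or> (\<forall>k\<in>?I. F4_coeff k x = - real (coord4 k q))"
      using F4_root_coords[OF x] by blast
    then have "x = \<beta> q \<or> x = - \<beta> q"
    proof (elim disjE)
      assume *: "\<forall>k\<in>?I. F4_coeff k x = real (coord4 k q)"
      have "x = \<beta> q"
        unfolding \<beta>_def by (subst x_eq, rule sum.cong) (use * in auto)
      then show ?thesis ..
    next
      assume *: "\<forall>k\<in>?I. F4_coeff k x = - real (coord4 k q)"
      have "x = - \<beta> q"
        unfolding \<beta>_def sum_negf[symmetric] by (subst x_eq, rule sum.cong) (use * in auto)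
      then show ?thesis ..
    qed
    then show "x \<in> \<beta> ` F4_positive \<union> uminus ` \<beta> ` F4_positive"
      using q by blast
  next
    have "\<beta> q \<in> ?\<Phi>" if "q \<in> F4_positive" for q
      using \<beta>_lat \<beta>_norm[OF that] unfolding roots_F4_iff by blast
    then show "x \<in> ?\<Phi>" if "x \<in> \<beta> ` F4_positive \<union> uminus ` \<beta> ` F4_positive" for x
      using that neg_root by blast
  qed
  have base: "F4_simple ` ?I \<subseteq> ?\<Phi>"
  proof -
    have "F4_simple k \<in> ?\<Phi>" if "k \<in> ?I" for k
      using that simple_lat[of k] unfolding roots_F4_iff
      by (elim insertE emptyE) (simp_all add: F4_simple_def ip_bilinear lookup_simps)
    then show ?thesis
      by blast
  qed
  note coords = \<beta>_def nonzero \<Phi>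
  let ?T = "F4_simple ` ?I"
  let ?\<Delta> = "antichain_complex ?\<Phi> ?T"
  have simple: "simple_roots ?\<Phi> ?T"
    by (rule simple_roots_coordinates[OF coords base])
  have pos: "positive_roots ?\<Phi> ?T = \<beta> ` F4_positive"
    by (rule positive_roots_coordinates[OF coords])
  have le: "root_le ?T (\<beta> p) (\<beta> q) \<longleftrightarrow> le4 p q" if "p \<in> F4_positive" "q \<in> F4_positive" for p q
    using root_le_coordinates[OF coords that] by (auto simp: le4_def coord4_def split: prod.splits)
  have inj: "p = q" if "p \<in> F4_positive" "q \<in> F4_positive" "\<beta> p = \<beta> q" for p q
  proof -
    have "le4 p q" "le4 q p"
      using le that nat_combinations_0 by (metis diff_self root_le_def)+
    then show ?thesis
      by (auto simp: le4_def split: prod.splits)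
  qed
  have antichain: "\<beta> ` A \<in> ?\<Delta>" if "A \<subseteq> F4_positive" "\<forall>p\<in>A. \<forall>q\<in>A. le4 p q \<longrightarrow> p = q" for A
    using that le unfolding antichain_complex_def pos by blast
  have inj_\<beta>: "inj_on \<beta> F4_positive"
    by (rule inj_onI) (rule inj)
  have card_\<beta>: "card (\<beta> ` A) = card A" if "A \<subseteq> F4_positive" for A
    by (rule card_image[OF inj_on_subset[OF inj_\<beta> that]])
  have mid: "F4_middle \<subseteq> F4_positive"
    by (simp add: F4_middle_def F4_positive_def)
  have "\<not> shellable ?\<Delta>"
  \<comment> \<open>The three roots of height four represent the class inside the middle, three
    simple roots the class outside. The link is that of the empty face.\<close>
  proof (rule not_shellable_if_split[where \<rho> = "{}" and W = "\<beta> ` F4_middle"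
        and A\<^sub>1 = "\<beta> ` {(0, 1, 2, 1), (1, 1, 1, 1), (1, 1, 2, 0)}"
        and A\<^sub>2 = "\<beta> ` {(1, 0, 0, 0), (0, 1, 0, 0), (0, 0, 1, 0)}"])
    show "finite ?\<Delta>"
      using finite_roots by (rule finite_antichain_complex)
    show "finite A" if "A \<in> ?\<Delta>" for A
    proof (rule finite_subset[OF _ finite_roots])
      show "A \<subseteq> ?\<Phi>"
        using that by (auto simp: antichain_complex_def positive_roots_def simp del: root_system.simps)
    qed
    show "\<beta> ` {(0, 1, 2, 1), (1, 1, 1, 1), (1, 1, 2, 0)} \<in> ?\<Delta>"
      by (rule antichain) (simp_all add: F4_positive_def le4_def)
    show "\<beta> ` {(1, 0, 0, 0), (0, 1, 0, 0), (0, 0, 1, 0)} \<in> ?\<Delta>"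
      by (rule antichain) (simp_all add: F4_positive_def le4_def)
    have "card (\<beta> ` {(0, 1, 2, 1), (1, 1, 1, 1), (1, 1, 2, 0)}) = 3"
      using card_\<beta>[of "{(0, 1, 2, 1), (1, 1, 1, 1), (1, 1, 2, 0)}"] by (simp add: F4_positive_def)
    then show "3 \<le> card (\<beta> ` {(0, 1, 2, 1), (1, 1, 1, 1), (1, 1, 2, 0)} - {})"
      by simp
    have "card (\<beta> ` {(1, 0, 0, 0), (0, 1, 0, 0), (0, 0, 1, 0)}) = 3"
      using card_\<beta>[of "{(1, 0, 0, 0), (0, 1, 0, 0), (0, 0, 1, 0)}"] by (simp add: F4_positive_def)
    then show "3 \<le> card (\<beta> ` {(1, 0, 0, 0), (0, 1, 0, 0), (0, 0, 1, 0)} - {})"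
      by simp
    have "\<beta> ` {(0, 1, 2, 1), (1, 1, 1, 1), (1, 1, 2, 0)} \<subseteq> \<beta> ` F4_middle"
      by (rule image_mono) (simp add: F4_middle_def)
    then show "\<beta> ` {(0, 1, 2, 1), (1, 1, 1, 1), (1, 1, 2, 0)} \<subseteq> {} \<union> \<beta> ` F4_middle"
      by simp
    have "\<beta> (1, 0, 0, 0) \<notin> \<beta> ` F4_middle"
    proof
      assume "\<beta> (1, 0, 0, 0) \<in> \<beta> ` F4_middle"
      then obtain q where q: "q \<in> F4_middle" "\<beta> (1, 0, 0, 0) = \<beta> q"
        by blast
      have "(1, 0, 0, 0) \<in> F4_positive"
        by (simp add: F4_positive_def)
      from inj[OF this subsetD[OF mid q(1)] q(2)] have "(1, 0, 0, 0) \<in> F4_middle"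
        using q(1) by simp
      then show False
        by (simp add: F4_middle_def)
    qed
    then show "\<not> \<beta> ` {(1, 0, 0, 0), (0, 1, 0, 0), (0, 0, 1, 0)} \<subseteq> {} \<union> \<beta> ` F4_middle"
      by simp
  next
    fix A assume A: "A \<in> ?\<Delta>" "2 \<le> card (A \<inter> \<beta> ` F4_middle)"
    then obtain x y where xy: "x \<in> A \<inter> \<beta> ` F4_middle" "y \<in> A \<inter> \<beta> ` F4_middle" "x \<noteq> y"
      by (elim two_le_card_obtain)
    then obtain u v where uv: "u \<in> F4_middle" "v \<in> F4_middle" "x = \<beta> u" "y = \<beta> v"
      by blast
    have comp: "p = q" if "\<beta> p \<in> A" "\<beta> q \<in> A" "p \<in> F4_positive" "q \<in> F4_positive" "le4 p q" for p q
      using A(1) that le inj unfolding antichain_complex_def by blast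
    show "A \<subseteq> {} \<union> \<beta> ` F4_middle"
    proof
      fix z assume "z \<in> A"
      then obtain p where p: "p \<in> F4_positive" "z = \<beta> p"
        using A(1) unfolding antichain_complex_def pos by blast
      have "p \<in> F4_middle"
      proof (rule ccontr)
        assume "p \<notin> F4_middle"
        then have "u \<noteq> v" "p \<noteq> u" "p \<noteq> v"
          using uv xy(3) by auto
        moreover have "le4 u v \<or> le4 v u \<or> le4 p u \<or> le4 u p \<or> le4 p v \<or> le4 v p"
          using F4_middle_closed p(1) uv(1,2) \<open>p \<notin> F4_middle\<close> by blast
        ultimately show False
          using comp[of u v] comp[of v u] comp[of p u] comp[of u p] comp[of p v] comp[of v p]
            xy uv p \<open>z \<in> A\<close> mid by auto
      qed
      then show "z \<in> {} \<union> \<beta> ` F4_middle"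
        using p by simp
    qed
  qed simp_all
  then show ?thesis
    using not_shellable_simple_roots[OF simple] assms by blast
qed

theorem theorem1p1:
  fixes \<DD> :: dynkin_type and S :: "vec set"
  assumes "simple_roots (root_system \<DD>) S"
  shows "(\<DD> \<in> {Type_A n | n. n \<ge> 1} \<union> {Type_B n | n. n \<ge> 1} \<union> {Type_D 3, Type_G2} \<longrightarrow>
            shellable (antichain_complex (root_system \<DD>) S)) \<and>
         (\<DD> \<in> {Type_D n | n. n \<ge> 4} \<union> {Type_F4, Type_E6, Type_E7, Type_E8} \<longrightarrow>
            \<not> shellable (antichain_complex (root_system \<DD>) S))"
proof (intro conjI impI)
  assume "\<DD> \<in> {Type_A n | n. n \<ge> 1} \<union> {Type_B n | n. n \<ge> 1} \<union> {Type_D 3, Type_G2}"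
  then consider n where "\<DD> = Type_A n" | n where "\<DD> = Type_B n" | "\<DD> = Type_D 3" | "\<DD> = Type_G2"
    by blast
  then show "shellable (antichain_complex (root_system \<DD>) S)"
  proof cases
    case 1
    with assms show ?thesis
      using root_sys.shellable_simple_roots[OF root_sys_A shellable_A] by blast
  next
    case 2
    with assms show ?thesis
      using root_sys.shellable_simple_roots[OF root_sys_B shellable_B] by blast
  next
    case 3
    have "root_sys (root_system (Type_D 3))"
      using root_sys_D by simp
    from root_sys.shellable_simple_roots[OF this shellable_D3] show ?thesis
      using assms 3 by blast
  next
    case 4
    with assms show ?thesis
      using root_sys.shellable_simple_roots[OF root_sys_G2 shellable_G2] by blast
  qed
next
  assume "\<DD> \<in> {Type_D n | n. n \<ge> 4} \<union> {Type_F4, Type_E6, Type_E7, Type_E8}"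
  then show "\<not> shellable (antichain_complex (root_system \<DD>) S)"
    using assms not_shellable_D not_shellable_F4 not_shellable_E6 not_shellable_E7 not_shellable_E8
    by blast
qed

end
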